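(* Let $\mathbb{F}$ be an arbitrary field. The coinvariant algebra $\mathbb{F}[\mathbf{x}]/(\mathbb{F}[\mathbf{x}]^{\mathfrak S_n}_+)$, with the $H_n(0)$-action $T_i\mapsto\overline\pi_i$, has an $\mathbb{F}$-basis $\{\overline\pi_w x_{D(w)} : w\in\mathfrak S_n\}$ and decomposes as \[ \mathbb{F}[\mathbf{x}]/(\mathbb{F}[\mathbf{x}]^{\mathfrak S_n}_+)=\bigoplus_{\alpha\models n} H_n(0)\cdot\overline\pi_{w_0(\alpha)}x_{D(\alpha)}, \] where for every composition $\alpha$ of $n$ the summand $H_n(0)\cdot\overline\pi_{w_0(\alpha)}x_{D(\alpha)}$ has $\mathbb{F}$-basis $\{\overline\pi_w x_{D(\alpha)}: w\in[w_0(\alpha),w_1(\alpha)]\}$ and is isomorphic to the projective indecomposable $H_n(0)$-module $\mathbf P_\alpha$. Consequently $\mathbb{F}[\mathbf{x}]/(\mathbb{F}[\mathbf{x}]^{\mathfrak S_n}_+)$ is isomorphic to the regular representation of $H_n(0)$.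
   Context: Let $n\ge1$, $\mathbb{F}[\mathbf{x}]=\mathbb{F}[x_1,\dots,x_n]$, with $\mathfrak S_n$ permuting the variables; $s_i=(i,i+1)$. $(\mathbb{F}[\mathbf{x}]^{\mathfrak S_n}_+)$ is the ideal generated by symmetric polynomials of positive degree. The $0$-Hecke algebra $H_n(0)$ is the $\mathbb{F}$-algebra generated by $T_1,\dots,T_{n-1}$ with relations $T_i^2=-T_i$, $T_iT_{i+1}T_i=T_{i+1}T_iT_{i+1}$, $T_iT_j=T_jT_i$ for $|i-j|>1$; put $T'_i=T_i+1$, and for a reduced word $w=s_{i_1}\cdots s_{i_k}$ set $T_w=T_{i_1}\cdots T_{i_k}$, $T'_w=T'_{i_1}\cdots T'_{i_k}$. The Demazure operators are $\pi_i f=\frac{x_if-x_{i+1}s_i(f)}{x_i-x_{i+1}}$, and $\overline\pi_i=\pi_i-1$; $H_n(0)$ acts on $\mathbb{F}[\mathbf{x}]$ by $T_i\mapsto\overline\pi_i$ (this preserves degree and the ideal above, hence acts on the coinvariant algebra), and $\overline\pi_w=\overline\pi_{i_1}\cdots\overline\pi_{i_k}$ for a reduced word. For $I\subseteq[n-1]$, $x_I=\prod_{i\in I}x_1x_2\cdots x_i$. $D(w)=\{i\in[n-1]:w(i)>w(i+1)\}$. A composition $\alpha=(\alpha_1,\dots,\alpha_\ell)\models n$ has $D(\alpha)=\{\alpha_1,\alpha_1+\alpha_2,\dots,\alpha_1+\dots+\alpha_{\ell-1}\}$; $\alpha^c$ is the composition with $D(\alpha^c)=[n-1]\setminus D(\alpha)$.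 $w_0(\alpha)$ is the longest element of the subgroup generated by $\{s_i:i\in D(\alpha)\}$ (so $w_0(\alpha^c)$ is the longest element of the subgroup generated by $\{s_i:i\notin D(\alpha)\}$). The set $\{w:D(w)=D(\alpha)\}$ is an interval $[w_0(\alpha),w_1(\alpha)]$ in the left weak order. $\mathbf P_\alpha:=H_n(0)\,T_{w_0(\alpha)}T'_{w_0(\alpha^c)}$ (a projective indecomposable left $H_n(0)$-module). *)

theory Defs
  imports "HOL-Library.Poly_Mapping" "HOL-Combinatorics.Permutations"
begin

definition sc :: "'a::field \<Rightarrow> ('k \<Rightarrow>\<^sub>0 'a) \<Rightarrow> ('k \<Rightarrow>\<^sub>0 'a)" where
  "sc c f = Poly_Mapping.map (\<lambda>t. c * t) f"

definition cos :: "'v::ab_group_add set \<Rightarrow> 'v \<Rightarrow> 'v set" where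
  "cos K x = (\<lambda>k. x + k) ` K"

definition qcar :: "'v::ab_group_add set \<Rightarrow> 'v set \<Rightarrow> 'v set set" where
  "qcar A K = cos K ` A"

text \<open>Isomorphism of modules over an algebra generated by operators indexed by Idx,
  acting on the quotients (A1+K1)/K1 and (A2+K2)/K2 via act1, act2.\<close>
definition qmod_iso ::
  "nat set \<Rightarrow> ('k1 \<Rightarrow>\<^sub>0 'a::field) set \<Rightarrow> ('k1 \<Rightarrow>\<^sub>0 'a) set \<Rightarrow> (nat \<Rightarrow> ('k1 \<Rightarrow>\<^sub>0 'a) \<Rightarrow> ('k1 \<Rightarrow>\<^sub>0 'a))
   \<Rightarrow> ('k2 \<Rightarrow>\<^sub>0 'a) set \<Rightarrow> ('k2 \<Rightarrow>\<^sub>0 'a) set \<Rightarrow> (nat \<Rightarrow> ('k2 \<Rightarrow>\<^sub>0 'a) \<Rightarrow> ('k2 \<Rightarrow>\<^sub>0 'a)) \<Rightarrow> bool" where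
  "qmod_iso Idx A1 K1 act1 A2 K2 act2 \<longleftrightarrow>
     (\<exists>\<Phi>. bij_betw \<Phi> (qcar A1 K1) (qcar A2 K2) \<and>
       (\<forall>x\<in>A1. \<forall>x'\<in>A1. \<forall>y y'. \<Phi> (cos K1 x) = cos K2 y \<longrightarrow> \<Phi> (cos K1 x') = cos K2 y' \<longrightarrow>
            \<Phi> (cos K1 (x + x')) = cos K2 (y + y')) \<and>
       (\<forall>x\<in>A1. \<forall>y c. \<Phi> (cos K1 x) = cos K2 y \<longrightarrow> \<Phi> (cos K1 (sc c x)) = cos K2 (sc c y)) \<and>
       (\<forall>i\<in>Idx. \<forall>x\<in>A1. \<forall>y. \<Phi> (cos K1 x) = cos K2 y \<longrightarrow>
            \<Phi> (cos K1 (act1 i x)) = cos K2 (act2 i y)))"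

definition qbasis :: "('k \<Rightarrow>\<^sub>0 'a::field) set \<Rightarrow> ('k \<Rightarrow>\<^sub>0 'a) set \<Rightarrow> 'i set \<Rightarrow> ('i \<Rightarrow> ('k \<Rightarrow>\<^sub>0 'a)) \<Rightarrow> bool" where
  "qbasis A K B b \<longleftrightarrow>
     (\<forall>x\<in>B. \<exists>a\<in>A. b x - a \<in> K) \<and>
     (\<forall>c. (\<Sum>x\<in>B. sc (c x) (b x)) \<in> K \<longrightarrow> (\<forall>x\<in>B. c x = 0)) \<and>
     (\<forall>f\<in>A. \<exists>c. f - (\<Sum>x\<in>B. sc (c x) (b x)) \<in> K)"

type_synonym 'a mpoly = "(nat \<Rightarrow>\<^sub>0 nat) \<Rightarrow>\<^sub>0 'a"

definition polys :: "nat \<Rightarrow> ('a::field) mpoly set" where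
  "polys n = {f :: 'a mpoly. \<forall>m\<in>Poly_Mapping.keys f. Poly_Mapping.keys m \<subseteq> {1..n}}"

definition Var :: "nat \<Rightarrow> ('a::field) mpoly" where
  "Var i = Poly_Mapping.single (Poly_Mapping.single i 1) 1"

definition mon_perm :: "(nat \<Rightarrow> nat) \<Rightarrow> (nat \<Rightarrow>\<^sub>0 nat) \<Rightarrow> (nat \<Rightarrow>\<^sub>0 nat)" where
  "mon_perm \<sigma> m = (\<Sum>j\<in>Poly_Mapping.keys m. Poly_Mapping.single (\<sigma> j) (Poly_Mapping.lookup m j))"

definition perm_act :: "(nat \<Rightarrow> nat) \<Rightarrow> ('a::field) mpoly \<Rightarrow> 'a mpoly" where
  "perm_act \<sigma> f = (\<Sum>m\<in>Poly_Mapping.keys f. Poly_Mapping.single (mon_perm \<sigma> m) (Poly_Mapping.lookup f m))"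

definition s :: "nat \<Rightarrow> nat \<Rightarrow> nat" where
  "s i = (\<lambda>x. if x = i then Suc i else if x = Suc i then i else x)"

definition sym_plus :: "nat \<Rightarrow> ('a::field) mpoly set" where
  "sym_plus n = {f \<in> polys n. (\<forall>\<sigma>. \<sigma> permutes {1..n} \<longrightarrow> perm_act \<sigma> f = f) \<and> Poly_Mapping.lookup f 0 = 0}"

inductive_set coinv_ideal :: "nat \<Rightarrow> ('a::field) mpoly set" for n where
  zero: "0 \<in> coinv_ideal n"
| step: "f \<in> sym_plus n \<Longrightarrow> g \<in> polys n \<Longrightarrow> h \<in> coinv_ideal n \<Longrightarrow> g * f + h \<in> coinv_ideal n"

text \<open>Demazure operators pi_i f = (x_i f - x_(i+1) s_i(f)) / (x_i - x_(i+1)), and pibar_i = pi_i - 1.\<close>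
definition dem :: "nat \<Rightarrow> ('a::field) mpoly \<Rightarrow> 'a mpoly" where
  "dem i f = (THE g. (Var i - Var (Suc i)) * g = Var i * f - Var (Suc i) * perm_act (s i) f)"

definition pibar :: "nat \<Rightarrow> ('a::field) mpoly \<Rightarrow> 'a mpoly" where
  "pibar i f = dem i f - f"

definition Sn :: "nat \<Rightarrow> (nat \<Rightarrow> nat) set" where
  "Sn n = {w. w permutes {1..n}}"

definition word_perm :: "nat list \<Rightarrow> nat \<Rightarrow> nat" where
  "word_perm ws = foldr (\<lambda>i \<sigma>. s i \<circ> \<sigma>) ws id"

text \<open>Coxeter length = number of inversions.\<close>
definition inv_count :: "nat \<Rightarrow> (nat \<Rightarrow> nat) \<Rightarrow> nat" where
  "inv_count n w = card {(i, j). 1 \<le> i \<and> i < j \<and> j \<le> n \<and> w i > w j}"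

definition reduced_word :: "nat \<Rightarrow> (nat \<Rightarrow> nat) \<Rightarrow> nat list \<Rightarrow> bool" where
  "reduced_word n w ws \<longleftrightarrow> set ws \<subseteq> {1..<n} \<and> word_perm ws = w \<and> length ws = inv_count n w"

definition rword :: "nat \<Rightarrow> (nat \<Rightarrow> nat) \<Rightarrow> nat list" where
  "rword n w = (SOME ws. reduced_word n w ws)"

definition desc :: "nat \<Rightarrow> (nat \<Rightarrow> nat) \<Rightarrow> nat set" where
  "desc n w = {i. 1 \<le> i \<and> i < n \<and> w i > w (Suc i)}"

definition parab :: "nat set \<Rightarrow> (nat \<Rightarrow> nat) set" where
  "parab J = {word_perm ws | ws. set ws \<subseteq> J}"

definition longest :: "nat \<Rightarrow> nat set \<Rightarrow> nat \<Rightarrow> nat" where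
  "longest n J = (SOME w. w \<in> parab J \<and> (\<forall>u\<in>parab J. inv_count n u \<le> inv_count n w))"

definition pibar_w :: "nat \<Rightarrow> (nat \<Rightarrow> nat) \<Rightarrow> ('a::field) mpoly \<Rightarrow> 'a mpoly" where
  "pibar_w n w f = foldr pibar (rword n w) f"

definition xI :: "nat set \<Rightarrow> ('a::field) mpoly" where
  "xI I = (\<Prod>i\<in>I. \<Prod>j\<in>{1..i}. Var j)"

definition comps :: "nat \<Rightarrow> nat list set" where
  "comps n = {\<alpha>. sum_list \<alpha> = n \<and> 0 \<notin> set \<alpha>}"

definition Dc :: "nat list \<Rightarrow> nat set" where
  "Dc \<alpha> = {sum_list (take k \<alpha>) | k. 1 \<le> k \<and> k < length \<alpha>}"

definition w0 :: "nat \<Rightarrow> nat list \<Rightarrow> nat \<Rightarrow> nat" where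
  "w0 n \<alpha> = longest n (Dc \<alpha>)"

definition w0c :: "nat \<Rightarrow> nat list \<Rightarrow> nat \<Rightarrow> nat" where
  "w0c n \<alpha> = longest n ({1..<n} - Dc \<alpha>)"

section \<open>The 0-Hecke algebra H_n(0) as a quotient of the free algebra\<close>

text \<open>Free associative F-algebra on letters (nat): finitely supported functions on words.\<close>
type_synonym 'a ncpoly = "nat list \<Rightarrow>\<^sub>0 'a"

definition ncmult :: "('a::field) ncpoly \<Rightarrow> 'a ncpoly \<Rightarrow> 'a ncpoly" where
  "ncmult a b = (\<Sum>u\<in>Poly_Mapping.keys a. \<Sum>v\<in>Poly_Mapping.keys b. Poly_Mapping.single (u @ v) (Poly_Mapping.lookup a u * Poly_Mapping.lookup b v))"

definition nc1 :: "('a::field) ncpoly" where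
  "nc1 = Poly_Mapping.single [] 1"

definition T :: "nat \<Rightarrow> ('a::field) ncpoly" where
  "T i = Poly_Mapping.single [i] 1"

definition frees :: "nat \<Rightarrow> ('a::field) ncpoly set" where
  "frees n = {a. \<forall>u\<in>Poly_Mapping.keys a. set u \<subseteq> {1..<n}}"

definition hrels :: "nat \<Rightarrow> ('a::field) ncpoly set" where
  "hrels n =
     {ncmult (T i) (T i) + T i | i. i \<in> {1..<n}}
   \<union> {ncmult (T i) (ncmult (T (Suc i)) (T i)) - ncmult (T (Suc i)) (ncmult (T i) (T (Suc i)))
        | i. i \<in> {1..<n} \<and> Suc i \<in> {1..<n}}
   \<union> {ncmult (T i) (T j) - ncmult (T j) (T i)
        | i j. i \<in> {1..<n} \<and> j \<in> {1..<n} \<and> (i + 1 < j \<or> j + 1 < i)}"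

inductive_set hideal :: "nat \<Rightarrow> ('a::field) ncpoly set" for n where
  zero: "0 \<in> hideal n"
| step: "r \<in> hrels n \<Longrightarrow> a \<in> frees n \<Longrightarrow> b \<in> frees n \<Longrightarrow> h \<in> hideal n
          \<Longrightarrow> ncmult a (ncmult r b) + h \<in> hideal n"

definition Tw :: "nat \<Rightarrow> (nat \<Rightarrow> nat) \<Rightarrow> ('a::field) ncpoly" where
  "Tw n w = foldr (\<lambda>i acc. ncmult (T i) acc) (rword n w) nc1"

definition T'w :: "nat \<Rightarrow> (nat \<Rightarrow> nat) \<Rightarrow> ('a::field) ncpoly" where
  "T'w n w = foldr (\<lambda>i acc. ncmult (T i + nc1) acc) (rword n w) nc1"

text \<open>Representatives of the left ideal P_alpha = H_n(0) T_(w0(alpha)) T'_(w0(alpha^c)).\<close>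
definition Pmod :: "nat \<Rightarrow> nat list \<Rightarrow> ('a::field) ncpoly set" where
  "Pmod n \<alpha> = {ncmult a (ncmult (Tw n (w0 n \<alpha>)) (T'w n (w0c n \<alpha>))) | a. a \<in> frees n}"

definition lmult :: "nat \<Rightarrow> ('a::field) ncpoly \<Rightarrow> 'a ncpoly" where
  "lmult i a = ncmult (T i) a"

section \<open>The submodule H_n(0) . v of the coinvariant algebra (representatives)\<close>

inductive_set hspan :: "nat \<Rightarrow> ('a::field) mpoly \<Rightarrow> 'a mpoly set" for n v where
  base: "v \<in> hspan n v"
| act: "x \<in> hspan n v \<Longrightarrow> i \<in> {1..<n} \<Longrightarrow> pibar i x \<in> hspan n v"
| add: "x \<in> hspan n v \<Longrightarrow> y \<in> hspan n v \<Longrightarrow> x + y \<in> hspan n v"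
| smult: "x \<in> hspan n v \<Longrightarrow> sc c x \<in> hspan n v"

definition Msum :: "nat \<Rightarrow> nat list \<Rightarrow> ('a::field) mpoly set" where
  "Msum n \<alpha> = hspan n (pibar_w n (w0 n \<alpha>) (xI (Dc \<alpha>)))"

end

theory Submission
  imports Defs "HOL.Vector_Spaces" "HOL-Library.FuncSet"
begin

text \<open>The operators \<open>pibar i\<close> satisfy the relations of the 0-Hecke algebra and are linear over the symmetric
  polynomials. Let \<open>b\<^sub>w = pibar_w n w (xI (desc n w))\<close>. Because \<open>xI I\<close> is invariant under \<open>s j\<close> for \<open>j \<notin> I\<close>, the
  polynomial \<open>pibar i b\<^sub>w\<close> is exactly \<open>- b\<^sub>w\<close>, \<open>b\<^bsub>s i \<circ> w\<^esub>\<close> or \<open>0\<close>, according to whether left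
  multiplication by \<open>s i\<close> shortens \<open>w\<close>, lengthens it and keeps the descent set, or changes the descent set.

  The products of the \<open>b\<^sub>w\<close> with monomials \<open>e\<^sup>k\<close> in the elementary symmetric polynomials form a basis of the
  polynomial ring: order monomials first by the sum of the squares of the exponents (large is leading)
  and then by \<open>\<Sum> j a\<^sub>j\<close> (small is leading). The leading monomial of \<open>b\<^sub>w e\<^sup>k\<close> is then the partition belonging to
  \<open>xI (desc n w)\<close> and \<open>k\<close> with its entries permuted by \<open>w\<close>, and stable sorting shows that every monomial arises exactly once.
  A symmetric polynomial is killed by all \<open>pibar i\<close>, so the action on the \<open>b\<^sub>w\<close> forces its expansion to involve only
  \<open>w = id\<close>. Hence the coinvariant ideal is spanned by the \<open>b\<^sub>w e\<^sup>k\<close> with \<open>k \<noteq> 0\<close>, and the \<open>b\<^sub>w\<close> are a basis of the quotient.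

  In the 0-Hecke algebra, the elements \<open>h\<^sub>w = T\<^sub>w T'\<^sub>u\<close>, where \<open>u\<close> is the longest element of the parabolic subgroup of
  the non-descents of \<open>w\<close>, are multiplied by the generators \<open>T i\<close> according to the same table. They are a basis because
  \<open>h\<^sub>w - T\<^sub>w\<close> is a combination of \<open>T\<^sub>v\<close> with \<open>v\<close> longer than \<open>w\<close>. So \<open>b\<^sub>w \<mapsto> h\<^sub>w\<close> is an isomorphism
  of modules, and it respects the spans of the \<open>b\<^sub>w\<close> and \<open>h\<^sub>w\<close> with a fixed descent set.\<close>

text \<open>The order is dictated by the operators. \<open>pibar i\<close> replaces two exponents by
  pairs with the same sum lying between them; by convexity only the swapped or the original pair
  keeps the sum of squares. This key alone does not separate the terms of
  \<open>xI I * epow n k\<close>: choosing one set from every factor, the sum of squares is largest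
  whenever the chosen sets form a chain, and many chains exist. Such a chain contains the initial
  segments coming from \<open>xI I\<close>, and after permuting by \<open>w\<close> the weight is
  least exactly when all its sets are initial segments; hence the second key with its reversed
  direction.

  The 0-Hecke algebra is given by generators and relations only, so the independence of the
  \<open>T\<^sub>w\<close> needs a representation in which it is visible; the polynomial ring serves
  for this as well.\<close>

abbreviation coef :: "('k \<Rightarrow>\<^sub>0 'a::zero) \<Rightarrow> 'k \<Rightarrow> 'a" where
  "coef \<equiv> Poly_Mapping.lookup"

abbreviation supp :: "('k \<Rightarrow>\<^sub>0 'a::zero) \<Rightarrow> 'k set" where
  "supp \<equiv> Poly_Mapping.keys"

abbreviation mono1 :: "'k \<Rightarrow> 'k \<Rightarrow>\<^sub>0 'a::zero_neq_one" where
  "mono1 m \<equiv> Poly_Mapping.single m 1"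

section \<open>Linear algebra over finitely supported functions\<close>

lemma coef_sc [simp]: "coef (sc c f) k = c * coef f k"
  by (simp add: sc_def Poly_Mapping.map.rep_eq when_def)

lemma sc_single [simp]: "sc c (Poly_Mapping.single m d) = Poly_Mapping.single m (c * d)"
  by (rule poly_mapping_eqI) (auto simp: lookup_single when_def)

text \<open>Commutative polynomials and elements of the free algebra are both finitely supported
  functions, so one interpretation provides spans and subspaces for the two sides of the
  isomorphism.\<close>

interpretation pm: vector_space "sc :: 'a::field \<Rightarrow> ('k \<Rightarrow>\<^sub>0 'a) \<Rightarrow> _"
  by unfold_locales
    (rule poly_mapping_eqI; simp only: coef_sc lookup_add distrib_left distrib_right mult.assoc mult_1)+

lemma sc_mult_left: "sc c f * g = sc c (f * g)" for f :: "'k::monoid_add \<Rightarrow>\<^sub>0 'a::field"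
  by (simp add: sc_def mult_map_scale_conv_mult mult.assoc)

text \<open>The keys may form a noncommutative monoid, as words do; scalars are central
  nevertheless, because \<open>0\<close> is neutral on both sides.\<close>

lemma single_0_commute: "Poly_Mapping.single 0 c * f = f * Poly_Mapping.single 0 c"
  for f :: "'k::monoid_add \<Rightarrow>\<^sub>0 'a::field"
proof (induction f rule: update_induct)
  case (update f a b)
  have "Poly_Mapping.update a b f = f + Poly_Mapping.single a b"
    using update by (intro poly_mapping_eqI) (auto simp: lookup_update lookup_add lookup_single in_keys_iff)
  then show ?case
    by (simp add: algebra_simps update mult_single)
qed simp

lemma sc_mult_right: "f * sc c g = sc c (f * g)" for f :: "'k::monoid_add \<Rightarrow>\<^sub>0 'a::field"
  by (metis mult.assoc mult_map_scale_conv_mult sc_def single_0_commute)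

lemma supp_sc: "supp (sc c f) \<subseteq> supp f"
  by (auto simp: in_keys_iff)

lemma poly_mapping_expand: "f = (\<Sum>m\<in>supp f. sc (coef f m) (mono1 m))" for f :: "'k \<Rightarrow>\<^sub>0 'a::field"
proof (rule poly_mapping_eqI)
  fix k
  have "coef (\<Sum>m\<in>supp f. sc (coef f m) (mono1 m)) k = (\<Sum>m\<in>supp f. if m = k then coef f m else 0)"
    by (simp add: lookup_sum lookup_single when_def if_distrib cong: if_cong)
  then show "coef f k = coef (\<Sum>m\<in>supp f. sc (coef f m) (mono1 m)) k"
    by (simp add: in_keys_iff)
qed

abbreviation lin :: "(('k \<Rightarrow>\<^sub>0 'a::field) \<Rightarrow> ('l \<Rightarrow>\<^sub>0 'a)) \<Rightarrow> bool" where
  "lin F \<equiv> module_hom sc sc F"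

lemma linI:
  assumes "\<And>f g. F (f + g) = F f + F g" "\<And>c f. F (sc c f) = sc c (F f)"
  shows "lin F"
  using assms by (simp add: module_hom_iff pm.module_axioms)

lemma lin_id: "lin (\<lambda>f. f)" and lin_compose: "lin F \<Longrightarrow> lin G \<Longrightarrow> lin (\<lambda>f. F (G f))"
  by (auto simp: module_hom_iff pm.module_axioms)

lemma lin_mult_left: "lin (\<lambda>f. g * f)" and lin_mult_right: "lin (\<lambda>f. f * g)"
  for g :: "'k::monoid_add \<Rightarrow>\<^sub>0 'a::field"
  by (auto intro!: linI simp: algebra_simps sc_mult_left sc_mult_right)

lemma lin_ext_on:
  assumes "lin F" "lin G" "\<And>m. m \<in> supp f \<Longrightarrow> F (mono1 m) = G (mono1 m)"
  shows "F f = G f"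
proof -
  have "F (\<Sum>m\<in>supp f. sc (coef f m) (mono1 m)) = G (\<Sum>m\<in>supp f. sc (coef f m) (mono1 m))"
    using assms by (simp add: module_hom.sum module_hom.scale del: sc_single)
  then show ?thesis by (simp only: flip: poly_mapping_expand)
qed

lemma lin_ext:
  assumes "lin F" "lin G" "\<And>m. F (mono1 m) = G (mono1 m)"
  shows "F f = G f"
  using assms by (rule lin_ext_on)

definition extend :: "('k \<Rightarrow> 'l \<Rightarrow>\<^sub>0 'a::field) \<Rightarrow> ('k \<Rightarrow>\<^sub>0 'a) \<Rightarrow> ('l \<Rightarrow>\<^sub>0 'a)" where
  "extend \<phi> f = (\<Sum>m\<in>supp f. sc (coef f m) (\<phi> m))"

lemma extend_superset:
  assumes "finite A" "supp f \<subseteq> A"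
  shows "extend \<phi> f = (\<Sum>m\<in>A. sc (coef f m) (\<phi> m))"
  unfolding extend_def
  by (rule sum.mono_neutral_left) (use assms in \<open>auto simp: in_keys_iff\<close>)

lemma lin_extend: "lin (extend (\<phi> :: 'k \<Rightarrow> 'l \<Rightarrow>\<^sub>0 'a::field))"
proof (rule linI)
  fix f g :: "'k \<Rightarrow>\<^sub>0 'a"
  have "supp (f + g) \<subseteq> supp f \<union> supp g"
    by (rule keys_add)
  then show "extend \<phi> (f + g) = extend \<phi> f + extend \<phi> g"
    by (simp add: extend_superset[of "supp f \<union> supp g"] lookup_add pm.scale_left_distrib sum.distrib)
next
  fix c and f :: "'k \<Rightarrow>\<^sub>0 'a"
  show "extend \<phi> (sc c f) = sc c (extend \<phi> f)"
    by (simp add: extend_superset[of "supp f", OF _ supp_sc] extend_superset[of "supp f" f] pm.scale_sum_right)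
qed

lemma extend_mono1 [simp]: "extend \<phi> (mono1 m) = \<phi> m"
  by (simp add: extend_def)

text \<open>Coefficients are indexed by \<open>X\<close> rather than by its image: \<open>G\<close>
  contains one preimage for each vector used, so \<open>h\<close> may fail to be injective.\<close>

lemma span_image_explicit:
  assumes "f \<in> pm.span (h ` X)"
  obtains G c where "finite G" "G \<subseteq> X" "f = (\<Sum>x\<in>G. sc (c x) (h x))"
proof -
  obtain t r where t: "finite t" "t \<subseteq> h ` X" "f = (\<Sum>a\<in>t. sc (r a) a)"
    using assms unfolding pm.span_explicit by blast
  then obtain G where G: "G \<subseteq> X" "inj_on h G" "t = h ` G"
    by (meson subset_image_inj)
  show thesis
  proof
    show "finite G"
      using G t finite_image_iff by blast
    show "f = (\<Sum>x\<in>G. sc (r (h x)) (h x))"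
      using G t by (simp add: sum.reindex)
  qed (use G in simp)
qed

lemma span_image_finite:
  assumes "f \<in> pm.span (h ` X)" "finite X"
  obtains c where "f = (\<Sum>x\<in>X. sc (c x) (h x))"
proof -
  obtain G c where G: "finite G" "G \<subseteq> X" "f = (\<Sum>x\<in>G. sc (c x) (h x))"
    using assms(1) by (rule span_image_explicit)
  have "f = (\<Sum>x\<in>X. sc (if x \<in> G then c x else 0) (h x))"
    unfolding G(3) by (rule sum.mono_neutral_cong_left) (use G assms in auto)
  then show thesis by (rule that)
qed

lemma lin_span_in:
  assumes "lin F" "pm.subspace K" "\<And>x. x \<in> S \<Longrightarrow> F x \<in> K" "f \<in> pm.span S"
  shows "F f \<in> K"
  using assms(4)
proof (induction rule: pm.span_induct_alt)
  case base
  then show ?case using assms by (simp add: module_hom.zero pm.subspace_0)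
next
  case (step c x y)
  then show ?case using assms
    by (simp add: module_hom.add module_hom.scale pm.subspace_add pm.subspace_scale)
qed

section \<open>Polynomials and the action of permutations\<close>

lemma Var_eq: "Var i = mono1 (Poly_Mapping.single i 1)"
  by (simp add: Var_def)

lemma mono1_add: "mono1 (a + b) = mono1 a * (mono1 b :: 'k::monoid_add \<Rightarrow>\<^sub>0 'a::semiring_1)"
  by (simp add: mult_single)

lemma mono1_sum: "mono1 (\<Sum>x\<in>A. g x) = (\<Prod>x\<in>A. (mono1 (g x) :: 'k::comm_monoid_add \<Rightarrow>\<^sub>0 'a::comm_semiring_1))"
  by (induction A rule: infinite_finite_induct) (auto simp: mono1_add)

lemma mon_perm_superset:
  assumes "finite A" "supp m \<subseteq> A"
  shows "mon_perm \<sigma> m = (\<Sum>j\<in>A. Poly_Mapping.single (\<sigma> j) (coef m j))"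
  unfolding mon_perm_def by (rule sum.mono_neutral_left) (use assms in \<open>auto simp: in_keys_iff\<close>)

lemma mon_perm_add: "mon_perm \<sigma> (a + b) = mon_perm \<sigma> a + mon_perm \<sigma> b"
  using keys_add[of a b]
  by (simp add: mon_perm_superset[of "supp a \<union> supp b"] lookup_add single_add sum.distrib)

lemma mon_perm_0 [simp]: "mon_perm \<sigma> 0 = 0"
  by (simp add: mon_perm_def)

lemma mon_perm_sum: "mon_perm \<sigma> (\<Sum>x\<in>A. g x) = (\<Sum>x\<in>A. mon_perm \<sigma> (g x))"
  by (induction A rule: infinite_finite_induct) (auto simp: mon_perm_add)

lemma mon_perm_single [simp]: "mon_perm \<sigma> (Poly_Mapping.single j c) = Poly_Mapping.single (\<sigma> j) c"
  by (simp add: mon_perm_def)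

lemma mon_perm_compose: "mon_perm \<sigma> (mon_perm \<tau> m) = mon_perm (\<sigma> \<circ> \<tau>) m"
  by (simp add: mon_perm_def[of \<tau>] mon_perm_sum mon_perm_def[of "\<sigma> \<circ> \<tau>"])

lemma coef_mon_perm:
  assumes "bij \<sigma>"
  shows "coef (mon_perm \<sigma> m) (\<sigma> j) = coef m j"
proof -
  have "coef (mon_perm \<sigma> m) (\<sigma> j) = (\<Sum>i\<in>supp m. if i = j then coef m i else 0)"
    using assms
    by (auto simp: mon_perm_def lookup_sum lookup_single when_def bij_def inj_eq intro!: sum.cong)
  also have "\<dots> = coef m j"
    by (simp add: in_keys_iff)
  finally show ?thesis .
qed

lemma mon_perm_id [simp]: "mon_perm id m = m"
  by (rule poly_mapping_eqI) (use coef_mon_perm[of id m] in simp)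

lemma supp_mon_perm: "bij \<sigma> \<Longrightarrow> supp (mon_perm \<sigma> m) = \<sigma> ` supp m"
proof (intro equalityI subsetI)
  fix k assume b: "bij \<sigma>" and k: "k \<in> supp (mon_perm \<sigma> m)"
  obtain j where "k = \<sigma> j" using b by (metis bij_pointE)
  then show "k \<in> \<sigma> ` supp m" using k coef_mon_perm[OF b, of m j] by (auto simp: in_keys_iff)
qed (auto simp: in_keys_iff coef_mon_perm)

lemma perm_act_conv_extend: "perm_act \<sigma> = extend (\<lambda>m. mono1 (mon_perm \<sigma> m))"
  by (rule ext) (simp add: perm_act_def extend_def)

lemma lin_perm_act: "lin (perm_act \<sigma>)"
  by (simp add: perm_act_conv_extend lin_extend)

lemmas perm_act_add = module_hom.add[OF lin_perm_act]
  and perm_act_sum = module_hom.sum[OF lin_perm_act]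
  and perm_act_diff = module_hom.diff[OF lin_perm_act]
  and perm_act_sc = module_hom.scale[OF lin_perm_act]
  and perm_act_0 = module_hom.zero[OF lin_perm_act]

lemma perm_act_mono1 [simp]: "perm_act \<sigma> (mono1 m) = mono1 (mon_perm \<sigma> m)"
  by (simp add: perm_act_conv_extend)

lemma perm_act_1 [simp]: "perm_act \<sigma> 1 = 1"
  using perm_act_mono1[of \<sigma> 0] by simp

lemma perm_act_Var [simp]: "perm_act \<sigma> (Var j) = Var (\<sigma> j)"
  by (simp add: Var_eq)

lemma perm_act_mult: "perm_act \<sigma> (f * g) = perm_act \<sigma> f * perm_act \<sigma> g"
proof (rule lin_ext[where f = f])
  show "lin (\<lambda>f. perm_act \<sigma> (f * g))"
    by (rule lin_compose[OF lin_perm_act lin_mult_right])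
  show "lin (\<lambda>f. perm_act \<sigma> f * perm_act \<sigma> g)"
    by (rule lin_compose[OF lin_mult_right lin_perm_act])
  show "perm_act \<sigma> (mono1 a * g) = perm_act \<sigma> (mono1 a) * perm_act \<sigma> g" for a
  proof (rule lin_ext[where f = g])
    show "lin (\<lambda>f. perm_act \<sigma> (mono1 a * f))"
      by (rule lin_compose[OF lin_perm_act lin_mult_left])
    show "lin (\<lambda>f. perm_act \<sigma> (mono1 a) * perm_act \<sigma> f)"
      by (rule lin_compose[OF lin_mult_left lin_perm_act])
  qed (simp add: mon_perm_add flip: mono1_add)
qed

lemma perm_act_prod: "perm_act \<sigma> (\<Prod>x\<in>A. g x) = (\<Prod>x\<in>A. perm_act \<sigma> (g x))"
  by (induction A rule: infinite_finite_induct) (auto simp: perm_act_mult)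

lemma perm_act_power: "perm_act \<sigma> (f ^ k) = perm_act \<sigma> f ^ k"
  by (induction k) (auto simp: perm_act_mult)

lemma perm_act_compose: "perm_act \<sigma> (perm_act \<tau> f) = perm_act (\<sigma> \<circ> \<tau>) f"
  by (rule lin_ext[where f = f])
    (auto intro!: lin_compose[OF lin_perm_act] lin_perm_act simp: mon_perm_compose simp del: o_apply)

lemma perm_act_id [simp]: "perm_act id f = f"
proof -
  have "perm_act id f = (\<lambda>f. f) f"
    by (rule lin_ext[where f = f]) (use mon_perm_id in \<open>auto intro!: lin_perm_act lin_id simp: id_def\<close>)
  then show ?thesis by simp
qed

section \<open>Polynomials in the variables with indices 1 to n\<close>

definition mons :: "nat \<Rightarrow> (nat \<Rightarrow>\<^sub>0 nat) set" where
  "mons n = {m. supp m \<subseteq> {1..n}}"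

lemma polys_eq: "polys n = {f. supp f \<subseteq> mons n}"
  by (auto simp: polys_def mons_def)

lemma mons_0 [simp]: "0 \<in> mons n"
  by (simp add: mons_def)

lemma mons_add: "a \<in> mons n \<Longrightarrow> b \<in> mons n \<Longrightarrow> a + b \<in> mons n"
  using keys_add[of a b] by (auto simp: mons_def)

lemma mons_sum: "(\<And>x. x \<in> A \<Longrightarrow> g x \<in> mons n) \<Longrightarrow> (\<Sum>x\<in>A. g x) \<in> mons n"
  by (induction A rule: infinite_finite_induct) (auto simp: mons_add)

lemma mons_mon_perm: "\<sigma> permutes {1..n} \<Longrightarrow> m \<in> mons n \<Longrightarrow> mon_perm \<sigma> m \<in> mons n"
  unfolding mons_def mem_Collect_eq
  by (metis image_mono permutes_bij permutes_image supp_mon_perm)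

lemma subspace_supp: "pm.subspace {f. supp f \<subseteq> A}"
proof (rule pm.subspaceI)
  fix f g :: "'b \<Rightarrow>\<^sub>0 'a" assume "f \<in> {f. supp f \<subseteq> A}" "g \<in> {f. supp f \<subseteq> A}"
  then show "f + g \<in> {f. supp f \<subseteq> A}" using keys_add[of f g] by auto
qed (use supp_sc in fastforce)+

lemma subspace_polys: "pm.subspace (polys n)"
  by (simp add: polys_eq subspace_supp)

lemma polys_mono1: "m \<in> mons n \<Longrightarrow> mono1 m \<in> polys n"
  by (simp add: polys_eq)

lemma polys_1 [simp]: "1 \<in> polys n"
  using polys_mono1[OF mons_0] by simp

lemma polys_mult: "f \<in> polys n \<Longrightarrow> g \<in> polys n \<Longrightarrow> f * g \<in> polys n"
  using keys_mult[of f g] by (fastforce simp: polys_eq intro: mons_add)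

lemma polys_prod: "(\<And>x. x \<in> A \<Longrightarrow> g x \<in> polys n) \<Longrightarrow> (\<Prod>x\<in>A. g x) \<in> polys n"
  by (induction A rule: infinite_finite_induct) (auto simp: polys_mult)

lemma polys_power: "f \<in> polys n \<Longrightarrow> f ^ k \<in> polys n"
  by (induction k) (auto simp: polys_mult)

lemma polys_Var: "i \<in> {1..n} \<Longrightarrow> Var i \<in> polys n"
  by (auto simp: polys_def Var_def)

lemma polys_span: "polys n = pm.span (mono1 ` mons n)"
proof
  show "polys n \<subseteq> pm.span (mono1 ` mons n :: ('a::field) mpoly set)"
  proof
    fix f :: "'a mpoly" assume "f \<in> polys n"
    then have "(\<Sum>m\<in>supp f. sc (coef f m) (mono1 m)) \<in> pm.span (mono1 ` mons n)"
      by (intro pm.span_sum pm.span_scale pm.span_base) (auto simp: polys_eq)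
    then show "f \<in> pm.span (mono1 ` mons n)" by (simp only: flip: poly_mapping_expand)
  qed
  show "pm.span (mono1 ` mons n) \<subseteq> (polys n :: ('a::field) mpoly set)"
    by (intro pm.span_minimal subspace_polys) (auto simp: polys_mono1)
qed

section \<open>Demazure operators\<close>

lemma s_s [simp]: "s i (s i x) = x"
  by (auto simp: s_def)

lemma s_comp_s [simp]: "s i \<circ> s i = id"
  by auto

lemma s_eq_transpose: "s i = Transposition.transpose i (Suc i)"
  by (auto simp: s_def Transposition.transpose_def)

lemma bij_s [simp]: "bij (s i)"
  by (simp add: s_eq_transpose)

lemma s_permutes: "i \<in> {1..<n} \<Longrightarrow> s i permutes {1..n}"
  unfolding s_eq_transpose by (rule permutes_swap_id) auto

lemma s_braid: "s i \<circ> s (Suc i) \<circ> s i = s (Suc i) \<circ> s i \<circ> s (Suc i)"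
  by (auto simp: s_def)

lemma s_commute: "i + 1 < j \<or> j + 1 < i \<Longrightarrow> s i \<circ> s j = s j \<circ> s i"
  by (auto simp: s_def)

lemma s_fixes [simp]: "s i i = Suc i" "s i (Suc i) = i" "j \<noteq> i \<Longrightarrow> j \<noteq> Suc i \<Longrightarrow> s i j = j"
  by (auto simp: s_def)

abbreviation sact :: "nat \<Rightarrow> 'a::field mpoly \<Rightarrow> 'a mpoly" where
  "sact i \<equiv> perm_act (s i)"

lemma sact_sact [simp]: "sact i (sact i f) = f"
  by (simp add: perm_act_compose)

text \<open>Division by \<open>Var i - Var (Suc i)\<close> as a relation, so that quotients can be
  exhibited for monomials and added up before existence is known in general.\<close>

definition dem_quot :: "nat \<Rightarrow> 'a::field mpoly \<Rightarrow> 'a mpoly \<Rightarrow> bool" where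
  "dem_quot i f g \<longleftrightarrow> (Var i - Var (Suc i)) * g = Var i * f - Var (Suc i) * sact i f"

lemma Var_eq_iff [simp]: "(Var i :: 'a::field mpoly) = Var j \<longleftrightarrow> i = j"
proof
  assume "(Var i :: 'a mpoly) = Var j"
  then have "supp (Var i :: 'a mpoly) = supp (Var j :: 'a mpoly)" by simp
  then have "supp (Poly_Mapping.single i (1::nat)) = supp (Poly_Mapping.single j (1::nat))"
    by (simp add: Var_def)
  then show "i = j" by simp
qed simp

text \<open>The polynomial ring has no zero divisors, so the description in \<open>dem\<close>
  denotes whichever quotient has been exhibited.\<close>

lemma dem_eqI: "dem_quot i f g \<Longrightarrow> dem i f = g"
  unfolding dem_def dem_quot_def
  by (rule the_equality) (simp, metis Var_eq_iff eq_iff_diff_eq_0 mult_left_cancel n_not_Suc_n)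

lemma Var_power: "Var i ^ k = mono1 (Poly_Mapping.single i k)"
  by (induction k) (simp_all add: Var_eq mult_single flip: single_add)

text \<open>Isolates the two variables moved by \<open>s i\<close>: if \<open>r\<close> involves
  neither, the reflection just exchanges \<open>a\<close> and \<open>b\<close>.\<close>

definition bump :: "nat \<Rightarrow> (nat \<Rightarrow>\<^sub>0 nat) \<Rightarrow> nat \<Rightarrow> nat \<Rightarrow> (nat \<Rightarrow>\<^sub>0 nat)" where
  "bump i r a b = r + Poly_Mapping.single i a + Poly_Mapping.single (Suc i) b"

lemma mono1_bump: "mono1 (bump i r a b) = mono1 r * (Var i ^ a * Var (Suc i) ^ b)"
  by (simp add: bump_def mono1_add Var_power mult.assoc)

lemma bump_cases:
  obtains r a b where "coef r i = 0" "coef r (Suc i) = 0" "m = bump i r a b" "coef m i = a" "coef m (Suc i) = b"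
proof -
  define r where "r = m - Poly_Mapping.single i (coef m i) - Poly_Mapping.single (Suc i) (coef m (Suc i))"
  show thesis
  proof
    show "coef r i = 0" "coef r (Suc i) = 0"
      by (auto simp: r_def lookup_minus lookup_single)
    show "m = bump i r (coef m i) (coef m (Suc i))"
      by (rule poly_mapping_eqI) (auto simp: r_def bump_def lookup_minus lookup_add lookup_single when_def)
  qed auto
qed

lemma mon_perm_bump:
  assumes "coef r i = 0" "coef r (Suc i) = 0"
  shows "mon_perm (s i) (bump i r a b) = bump i r b a"
proof -
  have "mon_perm (s i) r = r"
  proof (rule poly_mapping_eqI)
    fix k
    have "coef (mon_perm (s i) r) (s i (s i k)) = coef r (s i k)"
      by (rule coef_mon_perm[OF bij_s])
    then show "coef (mon_perm (s i) r) k = coef r k"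
      using assms by (auto simp: s_def split: if_splits)
  qed
  then show ?thesis
    by (simp add: bump_def mon_perm_add algebra_simps)
qed

text \<open>With x, y for the two variables, the numerator is
  \<open>(x * y)^q * (x^(d+1) - y^(d+1))\<close> up to the factor \<open>r\<close>, and its quotient
  is a geometric sum.\<close>

lemma dem_quot_ge:
  assumes "coef r i = 0" "coef r (Suc i) = 0"
  shows "dem_quot i (mono1 (bump i r (q + d) q)) (\<Sum>t<Suc d. mono1 (bump i r (q + t) (q + d - t)))"
proof -
  define x y :: "'a mpoly" where "x = Var i" and "y = Var (Suc i)"
  have "mono1 (bump i r (q + t) (q + d - t)) = mono1 r * x ^ q * y ^ q * (x ^ t * y ^ (d - t))" if "t < Suc d" for t
  proof -
    have "q + d - t = q + (d - t)" using that by simp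
    then show ?thesis by (simp only: mono1_bump x_def y_def power_add) (simp add: mult_ac)
  qed
  then have "(\<Sum>t<Suc d. mono1 (bump i r (q + t) (q + d - t))) = mono1 r * x ^ q * y ^ q * (\<Sum>t<Suc d. x ^ t * y ^ (d - t))"
    unfolding sum_distrib_left by (intro sum.cong) auto
  then have "(x - y) * (\<Sum>t<Suc d. mono1 (bump i r (q + t) (q + d - t)))
      = mono1 r * x ^ q * y ^ q * ((x - y) * (\<Sum>t<Suc d. x ^ t * y ^ (d - t)))"
    by (simp only: mult_ac)
  also have "(x - y) * (\<Sum>t<Suc d. x ^ t * y ^ (d - t)) = x ^ Suc d - y ^ Suc d"
    by (simp only: diff_power_eq_sum)
  finally show ?thesis
    using assms unfolding dem_quot_def
    by (simp add: mon_perm_bump) (simp add: mono1_bump x_def y_def power_add algebra_simps)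
qed

text \<open>Here the numerator is \<open>(x * y)^(p+1) * (y^d - x^d)\<close> up to the factor
  \<open>r\<close>; hence the sign, and the empty sum when \<open>d = 0\<close>.\<close>

lemma dem_quot_lt:
  assumes "coef r i = 0" "coef r (Suc i) = 0"
  shows "dem_quot i (mono1 (bump i r p (p + 1 + d))) (- (\<Sum>t<d. mono1 (bump i r (p + 1 + t) (p + d - t))))"
proof -
  define x y :: "'a mpoly" where "x = Var i" and "y = Var (Suc i)"
  have "mono1 (bump i r (p + 1 + t) (p + d - t)) = mono1 r * x ^ (p + 1) * y ^ (p + 1) * (y ^ (d - Suc t) * x ^ t)"
    if "t < d" for t
  proof -
    have "p + d - t = p + 1 + (d - Suc t)" using that by simp
    then show ?thesis by (simp only: mono1_bump x_def y_def power_add) (simp add: mult_ac)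
  qed
  then have "(\<Sum>t<d. mono1 (bump i r (p + 1 + t) (p + d - t)))
      = mono1 r * x ^ (p + 1) * y ^ (p + 1) * (\<Sum>t<d. y ^ (d - Suc t) * x ^ t)"
    unfolding sum_distrib_left by (intro sum.cong) auto
  then have "(x - y) * - (\<Sum>t<d. mono1 (bump i r (p + 1 + t) (p + d - t)))
      = mono1 r * x ^ (p + 1) * y ^ (p + 1) * - ((x - y) * (\<Sum>t<d. y ^ (d - Suc t) * x ^ t))"
    by (simp only: mult_ac mult_minus_right)
  also have "(x - y) * (\<Sum>t<d. y ^ (d - Suc t) * x ^ t) = x ^ d - y ^ d"
    by (simp only: power_diff_sumr2)
  finally show ?thesis
    using assms unfolding dem_quot_def
    by (simp add: mon_perm_bump) (simp add: mono1_bump x_def y_def power_add algebra_simps)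
qed

lemma dem_quot_add: "dem_quot i f g \<Longrightarrow> dem_quot i f' g' \<Longrightarrow> dem_quot i (f + f') (g + g')"
  by (simp add: dem_quot_def perm_act_add algebra_simps)

lemma dem_quot_sc: "dem_quot i f g \<Longrightarrow> dem_quot i (sc c f) (sc c g)"
  by (simp only: dem_quot_def perm_act_sc sc_mult_right flip: pm.scale_right_diff_distrib)

lemma dem_quot_ex_mono: "\<exists>g. dem_quot i (mono1 m :: 'a::field mpoly) g"
proof -
  obtain r a b where r: "coef r i = 0" "coef r (Suc i) = 0" and m: "m = bump i r a b"
    by (rule bump_cases)
  consider d where "a = b + d" | d where "b = a + 1 + d"
    by (metis Suc_eq_plus1 add_Suc less_iff_Suc_add le_Suc_ex not_le add.commute)
  then show ?thesis
  proof cases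
    case 1
    then show ?thesis using dem_quot_ge[OF r] m by blast
  next
    case 2
    then show ?thesis using dem_quot_lt[OF r] m by blast
  qed
qed

lemma dem_quot_dem: "dem_quot i f (dem i f)" for f :: "'a::field mpoly"
proof -
  have "\<exists>g. dem_quot i (\<Sum>m\<in>A. sc (coef f m) (mono1 m)) g" if "finite A" for A
    using that
  proof (induction A rule: finite_induct)
    case empty
    have "dem_quot i 0 0" by (simp add: dem_quot_def perm_act_0)
    then show ?case by auto
  next
    case (insert m A)
    obtain g g' where g: "dem_quot i (mono1 m :: 'a mpoly) g" "dem_quot i (\<Sum>m\<in>A. sc (coef f m) (mono1 m)) g'"
      using dem_quot_ex_mono insert.IH by blast
    have "dem_quot i (sc (coef f m) (mono1 m) + (\<Sum>m\<in>A. sc (coef f m) (mono1 m))) (sc (coef f m) g + g')"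
      by (intro dem_quot_add dem_quot_sc g)
    then show ?case
      using insert.hyps by (auto simp del: sc_single)
  qed
  from this[of "supp f"] have "\<exists>g. dem_quot i f g"
    by (simp only: finite_keys simp_thms flip: poly_mapping_expand)
  then show ?thesis using dem_eqI by blast
qed

lemma dem_equation: "(Var i - Var (Suc i)) * dem i f = Var i * f - Var (Suc i) * sact i f"
  using dem_quot_dem by (simp add: dem_quot_def)

lemma lin_dem: "lin (dem i)"
  by (rule linI) (auto intro!: dem_eqI dem_quot_add dem_quot_sc dem_quot_dem)

lemma lin_pibar: "lin (pibar i)"
  by (rule linI)
    (simp_all add: pibar_def module_hom.add[OF lin_dem] module_hom.scale[OF lin_dem] pm.scale_right_diff_distrib)

lemmas pibar_add = module_hom.add[OF lin_pibar]
  and pibar_sum = module_hom.sum[OF lin_pibar]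
  and pibar_diff = module_hom.diff[OF lin_pibar]
  and pibar_sc = module_hom.scale[OF lin_pibar]
  and pibar_0 [simp] = module_hom.zero[OF lin_pibar]

lemma dem_invariant_factor:
  assumes "sact i e = e"
  shows "dem i (f * e) = dem i f * e"
proof (rule dem_eqI)
  have "(Var i - Var (Suc i)) * (dem i f * e) = ((Var i - Var (Suc i)) * dem i f) * e"
    by (simp only: mult.assoc)
  also have "\<dots> = Var i * (f * e) - Var (Suc i) * sact i (f * e)"
    unfolding dem_equation perm_act_mult assms by (simp only: left_diff_distrib mult.assoc)
  finally show "dem_quot i (f * e) (dem i f * e)"
    by (simp only: dem_quot_def)
qed

lemma dem_invariant: "sact i f = f \<Longrightarrow> dem i f = f"
  by (rule dem_eqI) (simp add: dem_quot_def algebra_simps)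

lemma pibar_invariant_factor: "sact i e = e \<Longrightarrow> pibar i (f * e) = pibar i f * e"
  by (simp only: pibar_def dem_invariant_factor left_diff_distrib)

lemma pibar_invariant: "sact i f = f \<Longrightarrow> pibar i f = 0"
  by (simp add: pibar_def dem_invariant)

lemma Var_diff_neq_0: "i \<noteq> j \<Longrightarrow> Var i - Var j \<noteq> (0 :: 'a::field mpoly)"
  by simp

lemma sact_dem [simp]: "sact i (dem i f) = dem i f"
proof -
  have "(Var i - Var (Suc i)) * sact i (dem i f) = - sact i ((Var i - Var (Suc i)) * dem i f)"
    by (simp add: perm_act_mult perm_act_diff algebra_simps)
  also have "\<dots> = (Var i - Var (Suc i)) * dem i f"
    unfolding dem_equation by (simp add: perm_act_mult perm_act_diff)
  finally show ?thesis
    by (metis Var_diff_neq_0 mult_left_cancel n_not_Suc_n)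
qed

lemma dem_dem [simp]: "dem i (dem i f) = dem i f"
  by (simp add: dem_invariant)

lemma pibar_pibar: "pibar i (pibar i f) = - pibar i f"
  by (simp add: pibar_def module_hom.diff[OF lin_dem])

text \<open>Read \<open>a\<close>, \<open>b\<close>, \<open>c\<close> as three consecutive variables
  and the prefixes \<open>p\<close>, \<open>q\<close> as the two reflections; the assumptions are
  then division equations for \<open>dem\<close> and their images under reflections. Multiplying by
  the Vandermonde product clears all divisions and leaves the alternating sum of the images of
  \<open>a^2 * b * f\<close> under the symmetric group on three letters, which favours neither side
  of the braid relation.\<close>

lemma braid_elimination_aux:
  fixes a b c :: "'a::comm_ring_1"
  assumes "(a - b) * g = a * f - b * pf" "(b - c) * h = b * g - c * qg" "(a - b) * k = a * h - b * ph"
    "(a - c) * qg = a * qf - c * qpf" "(a - c) * ph = a * g - c * pqg" "(b - c) * pqg = b * pqf - c * pqpf"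
  shows "(a - b) * (a - c) * (b - c) * k =
    a^2 * b * f - a * b^2 * pf - a^2 * c * qf + a * c^2 * qpf + b^2 * c * pqf - b * c^2 * pqpf"
proof -
  have "(a - b) * (a - c) * (b - c) * k = (a - c) * (b - c) * ((a - b) * k)"
    by (simp add: algebra_simps)
  also have "\<dots> = a * (a - c) * ((b - c) * h) - b * (b - c) * ((a - c) * ph)"
    unfolding assms(3) by (simp add: algebra_simps)
  also have "\<dots> = a * b * ((a - b) * g) - a * c * ((a - c) * qg) + b * c * ((b - c) * pqg)"
    unfolding assms(2,5) by (simp add: algebra_simps)
  also have "\<dots> = a^2 * b * f - a * b^2 * pf - a^2 * c * qf + a * c^2 * qpf + b^2 * c * pqf - b * c^2 * pqpf"
    unfolding assms(1,4,6) by (simp add: algebra_simps power2_eq_square)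
  finally show ?thesis .
qed

lemma braid_elimination_aux':
  fixes a b c :: "'a::comm_ring_1"
  assumes "(b - c) * g = b * f - c * qf" "(a - b) * h = a * g - b * pg" "(b - c) * k = b * h - c * qh"
    "(a - c) * pg = a * pf - c * pqf" "(a - c) * qh = a * g - c * qpg" "(a - b) * qpg = a * qpf - b * qpqf"
  shows "(a - b) * (a - c) * (b - c) * k =
    a^2 * b * f - a * b^2 * pf - a^2 * c * qf + a * c^2 * qpf + b^2 * c * pqf - b * c^2 * qpqf"
proof -
  have "(a - b) * (a - c) * (b - c) * k = (a - b) * (a - c) * ((b - c) * k)"
    by (simp add: algebra_simps)
  also have "\<dots> = b * (a - c) * ((a - b) * h) - c * (a - b) * ((a - c) * qh)"
    unfolding assms(3) by (simp add: algebra_simps)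
  also have "\<dots> = a^2 * ((b - c) * g) - b^2 * ((a - c) * pg) + c^2 * ((a - b) * qpg)"
    unfolding assms(2,5) by (simp add: algebra_simps power2_eq_square)
  also have "\<dots> = a^2 * b * f - a * b^2 * pf - a^2 * c * qf + a * c^2 * qpf + b^2 * c * pqf - b * c^2 * qpqf"
    unfolding assms(1,4,6) by (simp add: algebra_simps power2_eq_square)
  finally show ?thesis .
qed

lemma dem_braid: "dem i (dem (Suc i) (dem i f)) = dem (Suc i) (dem i (dem (Suc i) f))"
proof -
  define a b c :: "'a mpoly" where "a = Var i" and "b = Var (Suc i)" and "c = Var (Suc (Suc i))"
  define p q :: "'a mpoly \<Rightarrow> 'a mpoly" where "p = sact i" and "q = sact (Suc i)"
  have hom: "p (u * v) = p u * p v" "p (u - v) = p u - p v" "q (u * v) = q u * q v" "q (u - v) = q u - q v"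
    for u v by (auto simp: p_def q_def perm_act_mult perm_act_diff)
  have vars: "p a = b" "p b = a" "p c = c" "q a = a" "q b = c" "q c = b"
    by (simp_all add: p_def q_def a_def b_def c_def)
  have di: "(a - b) * dem i u = a * u - b * p u" and dj: "(b - c) * dem (Suc i) u = b * u - c * q u" for u
    unfolding a_def b_def c_def p_def q_def by (rule dem_equation)+
  have inv: "p (dem i u) = dem i u" "q (dem (Suc i) u) = dem (Suc i) u" for u
    by (simp_all add: p_def q_def)
  have qdi: "(a - c) * q (dem i u) = a * q u - c * q (p u)" for u
    using arg_cong[OF di[of u], of q] by (simp add: hom vars)
  have pdj: "(a - c) * p (dem (Suc i) u) = a * p u - c * p (q u)" for u
    using arg_cong[OF dj[of u], of p] by (simp add: hom vars)
  have pqdi: "(b - c) * p (q (dem i u)) = b * p (q u) - c * p (q (p u))" for u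
    using arg_cong[OF qdi[of u], of p] by (simp add: hom vars)
  have qpdj: "(a - b) * q (p (dem (Suc i) u)) = a * q (p u) - b * q (p (q u))" for u
    using arg_cong[OF pdj[of u], of q] by (simp add: hom vars)
  have pqp: "p (q (p f)) = q (p (q f))"
    by (simp add: p_def q_def perm_act_compose s_braid flip: o_assoc) (simp add: s_braid o_assoc)
  have 1: "(a - b) * (a - c) * (b - c) * dem i (dem (Suc i) (dem i f)) =
      a^2 * b * f - a * b^2 * p f - a^2 * c * q f + a * c^2 * q (p f) + b^2 * c * p (q f) - b * c^2 * p (q (p f))"
    by (rule braid_elimination_aux[OF di dj di qdi _ pqdi]) (simp add: pdj inv)
  have 2: "(a - b) * (a - c) * (b - c) * dem (Suc i) (dem i (dem (Suc i) f)) =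
      a^2 * b * f - a * b^2 * p f - a^2 * c * q f + a * c^2 * q (p f) + b^2 * c * p (q f) - b * c^2 * q (p (q f))"
    by (rule braid_elimination_aux'[OF dj di dj pdj _ qpdj]) (simp add: qdi inv)
  have "(a - b) * (a - c) * (b - c) \<noteq> 0"
    by (simp add: a_def b_def c_def)
  then show ?thesis
    using 1 2 pqp by (metis mult_left_cancel)
qed

lemma dem_commute:
  assumes "i + 1 < j \<or> j + 1 < i"
  shows "dem i (dem j f) = dem j (dem i f)"
proof -
  define a b c d :: "'a mpoly" where "a = Var i" and "b = Var (Suc i)" and "c = Var j" and "d = Var (Suc j)"
  define p q :: "'a mpoly \<Rightarrow> 'a mpoly" where "p = sact i" and "q = sact j"
  have hom: "p (u * v) = p u * p v" "p (u - v) = p u - p v" "q (u * v) = q u * q v" "q (u - v) = q u - q v"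
    for u v by (auto simp: p_def q_def perm_act_mult perm_act_diff)
  have vars: "p c = c" "p d = d" "q a = a" "q b = b"
    using assms by (auto simp add: p_def q_def a_def b_def c_def d_def)
  have di: "(a - b) * dem i u = a * u - b * p u" and dj: "(c - d) * dem j u = c * u - d * q u" for u
    unfolding a_def b_def c_def d_def p_def q_def by (rule dem_equation)+
  have qdi: "(a - b) * q (dem i f) = a * q f - b * q (p f)"
    using arg_cong[OF di[of f], of q] by (simp add: hom vars)
  have pdj: "(c - d) * p (dem j f) = c * p f - d * p (q f)"
    using arg_cong[OF dj[of f], of p] by (simp add: hom vars)
  have pq: "p (q f) = q (p f)"
    using s_commute[OF assms] by (simp add: p_def q_def perm_act_compose)
  have "(a - b) * (c - d) * dem i (dem j f) = (c - d) * ((a - b) * dem i (dem j f))"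
    by (simp add: algebra_simps)
  also have "\<dots> = a * ((c - d) * dem j f) - b * ((c - d) * p (dem j f))"
    unfolding di by (simp add: algebra_simps)
  also have "\<dots> = c * ((a - b) * dem i f) - d * ((a - b) * q (dem i f))"
    unfolding di dj pdj qdi pq by (simp add: algebra_simps)
  also have "\<dots> = (a - b) * ((c - d) * dem j (dem i f))"
    unfolding dj by (simp add: algebra_simps)
  finally have "(a - b) * (c - d) * dem i (dem j f) = (a - b) * (c - d) * dem j (dem i f)"
    by (simp add: mult.assoc)
  moreover have "(a - b) * (c - d) \<noteq> 0"
    by (simp add: a_def b_def c_def d_def)
  ultimately show ?thesis
    by (metis mult_left_cancel)
qed

lemma pibar_braid: "pibar i (pibar (Suc i) (pibar i f)) = pibar (Suc i) (pibar i (pibar (Suc i) f))"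
  by (simp add: pibar_def module_hom.diff[OF lin_dem] module_hom.add[OF lin_dem] dem_braid algebra_simps)

lemma pibar_commute: "i + 1 < j \<or> j + 1 < i \<Longrightarrow> pibar i (pibar j f) = pibar j (pibar i f)"
  by (simp add: pibar_def module_hom.diff[OF lin_dem] dem_commute[of i j])

section \<open>Leading terms under the sum of squares of the exponents\<close>

definition nrm :: "(nat \<Rightarrow>\<^sub>0 nat) \<Rightarrow> nat" where
  "nrm m = (\<Sum>j\<in>supp m. (coef m j)\<^sup>2)"

lemma nrm_superset: "finite A \<Longrightarrow> supp m \<subseteq> A \<Longrightarrow> nrm m = (\<Sum>j\<in>A. (coef m j)\<^sup>2)"
  unfolding nrm_def by (rule sum.mono_neutral_left) (auto simp: in_keys_iff)

lemma nrm_mon_perm: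
  assumes "bij \<sigma>"
  shows "nrm (mon_perm \<sigma> m) = nrm m"
  using assms unfolding nrm_def supp_mon_perm[OF assms]
  by (subst sum.reindex) (auto simp: coef_mon_perm bij_def inj_def inj_on_def)

lemma nrm_bump:
  assumes "coef r i = 0" "coef r (Suc i) = 0"
  shows "nrm (bump i r a b) = nrm r + a\<^sup>2 + b\<^sup>2"
proof -
  let ?A = "insert i (insert (Suc i) (supp r))"
  have "supp (bump i r a b) \<subseteq> ?A"
    by (auto simp: bump_def in_keys_iff lookup_add lookup_single when_def split: if_splits)
  then have "nrm (bump i r a b) = (\<Sum>j\<in>?A. (coef (bump i r a b) j)\<^sup>2)"
    by (intro nrm_superset) auto
  also have "\<dots> = (\<Sum>j\<in>supp r. (coef (bump i r a b) j)\<^sup>2) + a\<^sup>2 + b\<^sup>2"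
    using assms by (simp add: in_keys_iff bump_def lookup_add lookup_single)
  also have "(\<Sum>j\<in>supp r. (coef (bump i r a b) j)\<^sup>2) = nrm r"
    unfolding nrm_def using assms
    by (intro sum.cong) (auto simp: bump_def lookup_add lookup_single in_keys_iff when_def)
  finally show ?thesis .
qed

definition low :: "nat \<Rightarrow> 'a::field mpoly set" where
  "low k = {f. supp f \<subseteq> {m. nrm m < k}}"

lemma subspace_low: "pm.subspace (low k)"
  unfolding low_def by (rule subspace_supp)

lemma low_mono1: "nrm m < k \<Longrightarrow> mono1 m \<in> low k"
  by (simp add: low_def)

lemma pibar_mono1_ge:
  assumes "coef r i = 0" "coef r (Suc i) = 0"
  shows "pibar i (mono1 (bump i r (q + d) q)) = (\<Sum>t<d. mono1 (bump i r (q + t) (q + d - t)))"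
  by (simp add: pibar_def dem_eqI[OF dem_quot_ge[OF assms]])

lemma pibar_mono1_lt:
  assumes "coef r i = 0" "coef r (Suc i) = 0"
  shows "pibar i (mono1 (bump i r p (p + 1 + d)))
    = - (\<Sum>t<d. mono1 (bump i r (p + 1 + t) (p + d - t))) - mono1 (bump i r p (p + 1 + d))"
  unfolding pibar_def dem_eqI[OF dem_quot_lt[OF assms]] ..

text \<open>Convexity: moving two exponents towards each other with fixed sum lowers the sum of
  squares. Every drop in \<open>nrm\<close> caused by \<open>pibar\<close> comes from this
  inequality.\<close>

lemma square_sum_spread: "0 < t \<Longrightarrow> t < d \<Longrightarrow> (q + t)\<^sup>2 + (q + d - t)\<^sup>2 < (q + d)\<^sup>2 + (q::nat)\<^sup>2"
proof -
  assume "0 < t" "t < d"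
  then obtain u where u: "d = t + u" "0 < u" by (metis less_imp_add_positive)
  then show ?thesis using \<open>0 < t\<close> by (simp add: power2_eq_square algebra_simps)
qed

text \<open>The summand \<open>t = 0\<close> in \<open>pibar_mono1_ge\<close> is the swapped
  monomial; all others have both exponents strictly between the original two.\<close>

lemma pibar_mono1_leading:
  assumes "coef m (Suc i) < coef m i"
  shows "pibar i (mono1 m) - mono1 (mon_perm (s i) m) \<in> low (nrm m)"
proof -
  obtain r a q where r: "coef r i = 0" "coef r (Suc i) = 0" and m: "m = bump i r a q"
    and a: "coef m i = a" "coef m (Suc i) = q"
    by (rule bump_cases)
  obtain d where d: "a = q + Suc d"
    using assms unfolding a by (metis less_iff_Suc_add add_Suc_right)
  have "pibar i (mono1 m) - mono1 (mon_perm (s i) m) = (\<Sum>t<d. mono1 (bump i r (q + Suc t) (q + Suc d - Suc t)))"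
    unfolding m d
    by (simp only: pibar_mono1_ge[OF r] mon_perm_bump[OF r] sum.lessThan_Suc_shift) simp
  also have "\<dots> \<in> low (nrm m)"
  proof (intro pm.subspace_sum subspace_low low_mono1)
    fix t assume "t \<in> {..<d}"
    then show "nrm (bump i r (q + Suc t) (q + Suc d - Suc t)) < nrm m"
      using square_sum_spread[of "Suc t" "Suc d" q] unfolding m d nrm_bump[OF r] by simp
  qed
  finally show ?thesis .
qed

text \<open>Recording both the common factor \<open>r\<close> and the bound on the norm lets one
  case distinction yield the invariance of \<open>low k\<close> and of
  \<open>polys n\<close>.\<close>

lemma pibar_mono1_support:
  obtains r a b where "m = bump i r a b"
    "pibar i (mono1 m) \<in> pm.span (mono1 ` {bump i r a' b' | a' b'. nrm (bump i r a' b') \<le> nrm m})"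
proof -
  obtain r a b where r: "coef r i = 0" "coef r (Suc i) = 0" and m: "m = bump i r a b"
    by (rule bump_cases)
  let ?B = "{bump i r a' b' | a' b'. nrm (bump i r a' b') \<le> nrm m}"
  have B: "mono1 (bump i r a' b') \<in> pm.span (mono1 ` ?B)" if "nrm (bump i r a' b') \<le> nrm m" for a' b'
    using that by (intro pm.span_base imageI) blast
  consider d where "a = b + d" | d where "b = a + 1 + d"
    by (metis Suc_eq_plus1 add_Suc less_iff_Suc_add le_Suc_ex not_le add.commute)
  then have "pibar i (mono1 m) \<in> pm.span (mono1 ` ?B)"
  proof cases
    case (1 d)
    have "(\<Sum>t<d. mono1 (bump i r (b + t) (b + d - t))) \<in> pm.span (mono1 ` ?B)"
    proof (intro pm.span_sum B)
      fix t assume t: "t \<in> {..<d}"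
      show "nrm (bump i r (b + t) (b + d - t)) \<le> nrm m"
        unfolding m 1 nrm_bump[OF r]
        using square_sum_spread[of t d b] t by (cases "t = 0") auto
    qed
    then show ?thesis unfolding m 1 pibar_mono1_ge[OF r] .
  next
    case (2 d)
    have "- (\<Sum>t<d. mono1 (bump i r (a + 1 + t) (a + d - t))) - mono1 (bump i r a (a + 1 + d)) \<in> pm.span (mono1 ` ?B)"
    proof (intro pm.span_diff pm.span_neg pm.span_sum B)
      fix t assume t: "t \<in> {..<d}"
      show "nrm (bump i r (a + 1 + t) (a + d - t)) \<le> nrm m"
        unfolding m 2 nrm_bump[OF r]
        using square_sum_spread[of "t + 1" "d + 1" a] t by (auto simp: algebra_simps)
    qed (simp add: m 2)
    then show ?thesis unfolding m 2 pibar_mono1_lt[OF r] .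
  qed
  then show thesis using m by (rule that[rotated])
qed

lemma pibar_low: "f \<in> low k \<Longrightarrow> pibar i f \<in> low k" for f :: "'a::field mpoly"
proof -
  assume f: "f \<in> low k"
  have "pibar i (mono1 m :: 'a mpoly) \<in> low k" if "nrm m < k" for m
  proof -
    obtain r a b where "pibar i (mono1 m :: 'a mpoly) \<in> pm.span (mono1 ` {bump i r a' b' | a' b'. nrm (bump i r a' b') \<le> nrm m})"
      by (rule pibar_mono1_support[of m i])
    moreover have "pm.span (mono1 ` {bump i r a' b' | a' b'. nrm (bump i r a' b') \<le> nrm m}) \<subseteq> (low k :: 'a mpoly set)"
      using that by (intro pm.span_minimal subspace_low) (auto intro!: low_mono1)
    ultimately show ?thesis by (rule subsetD[rotated])
  qed
  then have "pibar i (\<Sum>m\<in>supp f. sc (coef f m) (mono1 m)) \<in> low k"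
    unfolding pibar_sum pibar_sc using f
    by (intro pm.subspace_sum[OF subspace_low] pm.subspace_scale[OF subspace_low]) (auto simp: low_def)
  then show ?thesis by (simp only: flip: poly_mapping_expand)
qed

lemma pibar_polys:
  fixes f :: "'a::field mpoly"
  assumes "i \<in> {1..<n}" "f \<in> polys n"
  shows "pibar i f \<in> polys n"
proof (rule lin_span_in[OF lin_pibar subspace_polys])
  show "f \<in> pm.span (mono1 ` mons n)" using assms by (simp add: polys_span)
next
  fix g :: "'a mpoly" assume "g \<in> mono1 ` mons n"
  then obtain m where m: "g = mono1 m" "m \<in> mons n" by auto
  obtain r a b where r: "m = bump i r a b"
    "pibar i (mono1 m :: 'a mpoly) \<in> pm.span (mono1 ` {bump i r a' b' | a' b'. nrm (bump i r a' b') \<le> nrm m})"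
    by (rule pibar_mono1_support[of m i])
  have "supp r \<subseteq> supp m"
    by (auto simp: r(1) bump_def in_keys_iff lookup_add)
  then have "r \<in> mons n" using m by (auto simp: mons_def)
  then have "bump i r a' b' \<in> mons n" for a' b'
    using assms(1) unfolding bump_def by (intro mons_add) (auto simp: mons_def)
  then have sub: "pm.span (mono1 ` {bump i r a' b' | a' b'. nrm (bump i r a' b') \<le> nrm m}) \<subseteq> (polys n :: 'a mpoly set)"
    by (intro pm.span_minimal subspace_polys) (auto intro!: polys_mono1)
  show "pibar i g \<in> polys n"
    unfolding m(1) by (rule subsetD[OF sub r(2)])
qed

section \<open>Inversions and reduced words in the symmetric group\<close>

definition Invs :: "nat \<Rightarrow> (nat \<Rightarrow> nat) \<Rightarrow> (nat \<times> nat) set" where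
  "Invs n w = {(p, q). 1 \<le> p \<and> p < q \<and> q \<le> n \<and> w q < w p}"

lemma inv_count_eq: "inv_count n w = card (Invs n w)"
  by (simp add: inv_count_def Invs_def)

lemma finite_Invs [simp]: "finite (Invs n w)"
  by (rule finite_subset[of _ "{1..n} \<times> {1..n}"]) (auto simp: Invs_def)

lemma finite_Sn [simp]: "finite (Sn n)"
  by (simp add: Sn_def finite_permutations)

lemma Sn_id [simp]: "id \<in> Sn n"
  by (simp add: Sn_def permutes_id)

lemma Sn_comp: "u \<in> Sn n \<Longrightarrow> w \<in> Sn n \<Longrightarrow> u \<circ> w \<in> Sn n"
  by (simp add: Sn_def permutes_compose)

lemma Sn_inv: "w \<in> Sn n \<Longrightarrow> inv w \<in> Sn n"
  by (simp add: Sn_def permutes_inv)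

lemma Sn_s: "i \<in> {1..<n} \<Longrightarrow> s i \<in> Sn n"
  using s_permutes[of i n] by (simp add: Sn_def)

lemma Sn_s_comp: "i \<in> {1..<n} \<Longrightarrow> w \<in> Sn n \<Longrightarrow> s i \<circ> w \<in> Sn n"
  by (intro Sn_comp Sn_s)

lemma Sn_bij: "w \<in> Sn n \<Longrightarrow> bij w"
  by (simp add: Sn_def permutes_bij)

lemma Sn_range: "w \<in> Sn n \<Longrightarrow> 1 \<le> w j \<and> w j \<le> n \<longleftrightarrow> 1 \<le> j \<and> j \<le> n"
  using permutes_in_image[of w "{1..n}" j] by (simp add: Sn_def)

lemma Sn_inv_eq: "w \<in> Sn n \<Longrightarrow> inv w a = p \<longleftrightarrow> w p = a"
  using Sn_bij[of w n] by (metis bij_inv_eq_iff)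

lemma Sn_eq_iff: "w \<in> Sn n \<Longrightarrow> w p = w q \<longleftrightarrow> p = q"
  by (simp add: Sn_bij bij_is_inj inj_eq)

lemma s_comp_s_comp [simp]: "s i \<circ> (s i \<circ> w) = w"
  by (auto simp: fun_eq_iff)

lemma inv_s_comp: "w \<in> Sn n \<Longrightarrow> inv (s i \<circ> w) = inv w \<circ> s i"
  by (simp add: o_inv_distrib Sn_bij s_eq_transpose)

text \<open>The value \<open>Suc i\<close> stands before \<open>i\<close> in one-line notation:
  \<open>i\<close> is a left descent, and multiplication by \<open>s i\<close> from the left
  shortens \<open>w\<close>.\<close>

abbreviation ldesc :: "(nat \<Rightarrow> nat) \<Rightarrow> nat \<Rightarrow> bool" where
  "ldesc w i \<equiv> inv w (Suc i) < inv w i"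

lemma ldesc_s_comp: "w \<in> Sn n \<Longrightarrow> ldesc (s i \<circ> w) i \<longleftrightarrow> \<not> ldesc w i"
  by (simp add: inv_s_comp) (metis Sn_inv Sn_eq_iff linorder_neqE_nat n_not_Suc_n not_less_iff_gr_or_eq)

text \<open>Exchanging the neighbouring values \<open>i\<close> and \<open>Suc i\<close> alters no
  comparison except the one between these two.\<close>

lemma Invs_ascent:
  assumes "w \<in> Sn n" "i \<in> {1..<n}" "\<not> ldesc w i"
  shows "Invs n (s i \<circ> w) = insert (inv w i, inv w (Suc i)) (Invs n w)"
    and "(inv w i, inv w (Suc i)) \<notin> Invs n w"
proof -
  define p q where "p = inv w i" and "q = inv w (Suc i)"
  have w: "w p = i" "w q = Suc i"
    unfolding p_def q_def using Sn_bij[OF assms(1)] by (simp_all add: bij_is_surj surj_f_inv_f)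
  have eqs: "w a = i \<longleftrightarrow> a = p" "w a = Suc i \<longleftrightarrow> a = q" for a
    by (metis Sn_inv_eq[OF assms(1)] p_def q_def)+
  have "p \<noteq> q" using w by auto
  then have pq: "p < q" using assms(3) by (simp add: p_def q_def)
  have "1 \<le> p" "q \<le> n"
    using Sn_range[OF assms(1), of p] Sn_range[OF assms(1), of q] assms(2) w by auto
  moreover have "s i (w b) < s i (w a) \<longleftrightarrow> w b < w a \<or> (a = p \<and> b = q)" if "a < b" for a b
    using that pq eqs[of a] eqs[of b] by (auto simp: s_def)
  ultimately show "Invs n (s i \<circ> w) = insert (inv w i, inv w (Suc i)) (Invs n w)"
    unfolding Invs_def p_def[symmetric] q_def[symmetric] using pq by auto
  show "(inv w i, inv w (Suc i)) \<notin> Invs n w"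
    unfolding Invs_def p_def[symmetric] q_def[symmetric] using w by auto
qed

lemma Invs_descent:
  assumes "w \<in> Sn n" "i \<in> {1..<n}" "ldesc w i"
  shows "Invs n w = insert (inv w (Suc i), inv w i) (Invs n (s i \<circ> w))"
    and "(inv w (Suc i), inv w i) \<notin> Invs n (s i \<circ> w)"
  using Invs_ascent[OF Sn_s_comp[OF assms(2,1)] assms(2)] assms
  by (simp_all add: ldesc_s_comp) (simp_all add: inv_s_comp)

lemma inv_count_ascent:
  "w \<in> Sn n \<Longrightarrow> i \<in> {1..<n} \<Longrightarrow> \<not> ldesc w i \<Longrightarrow> inv_count n (s i \<circ> w) = Suc (inv_count n w)"
  by (simp add: inv_count_eq Invs_ascent)

lemma inv_count_descent:
  "w \<in> Sn n \<Longrightarrow> i \<in> {1..<n} \<Longrightarrow> ldesc w i \<Longrightarrow> inv_count n w = Suc (inv_count n (s i \<circ> w))"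
  using Invs_descent[of w n i] by (simp add: inv_count_eq)

lemma inv_count_inv:
  assumes "w \<in> Sn n"
  shows "inv_count n (inv w) = inv_count n w"
proof -
  have "bij_betw (\<lambda>(p, q). (w q, w p)) (Invs n w) (Invs n (inv w))"
  proof (rule bij_betwI[where g = "\<lambda>(a, b). (inv w b, inv w a)"])
    have inv: "inv w (w p) = p" "w (inv w p) = p" for p
      using Sn_bij[OF assms] by (simp_all add: bij_is_inj bij_is_surj surj_f_inv_f)
    show "(\<lambda>(p, q). (w q, w p)) \<in> Invs n w \<rightarrow> Invs n (inv w)"
      by (auto simp: Invs_def inv) (metis Sn_range assms One_nat_def order_trans less_imp_le Suc_leI)+
    show "(\<lambda>(a, b). (inv w b, inv w a)) \<in> Invs n (inv w) \<rightarrow> Invs n w"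
      by (auto simp: Invs_def inv) (metis Sn_range Sn_inv assms One_nat_def order_trans less_imp_le Suc_leI)+
  qed (use Sn_bij[OF assms] in \<open>auto simp: bij_is_inj bij_is_surj surj_f_inv_f\<close>)
  then show ?thesis
    by (simp add: inv_count_eq bij_betw_same_card)
qed

lemma inv_count_right_ascent:
  assumes "w \<in> Sn n" "j \<in> {1..<n}" "w j < w (Suc j)"
  shows "inv_count n (w \<circ> s j) = Suc (inv_count n w)"
proof -
  have b: "bij w" "bij (s j)" "inv (s j) = s j" "inv (inv w) = w"
    using Sn_bij[OF assms(1)] by (simp_all add: s_eq_transpose inv_inv_eq)
  have "inv_count n (w \<circ> s j) = inv_count n (inv (w \<circ> s j))"
    using assms by (intro inv_count_inv[symmetric] Sn_comp Sn_s)
  also have "inv (w \<circ> s j) = s j \<circ> inv w"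
    using b by (simp add: o_inv_distrib)
  also have "inv_count n (s j \<circ> inv w) = Suc (inv_count n (inv w))"
    using assms b by (intro inv_count_ascent Sn_inv) auto
  finally show ?thesis
    unfolding inv_count_inv[OF assms(1)] .
qed

lemma Sn_increasing_imp_id:
  assumes "w \<in> Sn n" "\<And>i. i \<in> {1..<n} \<Longrightarrow> w i < w (Suc i)"
  shows "w = id"
proof (rule permutes_natset_ge[of _ "{1..n}"])
  show "w permutes {1..n}" using assms(1) by (simp add: Sn_def)
  have "1 \<le> i \<Longrightarrow> i \<le> n \<Longrightarrow> i \<le> w i" for i
  proof (induction i)
    case (Suc i)
    show ?case
    proof (cases "i = 0")
      case True
      then show ?thesis using Sn_range[OF assms(1), of 1] Suc.prems by auto
    next
      case False
      then show ?thesis using Suc assms(2)[of i] by auto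
    qed
  qed simp
  then show "\<forall>i\<in>{1..n}. i \<le> w i" by auto
qed

lemma ex_ldesc:
  assumes "w \<in> Sn n" "w \<noteq> id"
  shows "\<exists>i\<in>{1..<n}. ldesc w i"
proof (rule ccontr)
  assume "\<not> ?thesis"
  moreover have "inv w i \<noteq> inv w (Suc i)" for i
    using Sn_eq_iff[OF Sn_inv[OF assms(1)]] by simp
  ultimately have "inv w i < inv w (Suc i)" if "i \<in> {1..<n}" for i
    using that by (meson linorder_neqE_nat)
  then have "inv w = id"
    using Sn_inv[OF assms(1)] Sn_increasing_imp_id by blast
  then have "w = id"
    using Sn_bij[OF assms(1)] by (metis inv_id inv_inv_eq)
  then show False using assms by simp
qed

text \<open>Equal inversion sets make \<open>w \<circ> inv u\<close> increasing, and the only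
  increasing permutation is the identity.\<close>

lemma Invs_eqD:
  assumes "w \<in> Sn n" "u \<in> Sn n" "Invs n w = Invs n u"
  shows "w = u"
proof -
  have "w \<circ> inv u = id"
  proof (rule Sn_increasing_imp_id)
    show "w \<circ> inv u \<in> Sn n"
      using assms by (intro Sn_comp Sn_inv)
  next
    fix i assume i: "i \<in> {1..<n}"
    define p q where "p = inv u i" and "q = inv u (Suc i)"
    have u: "u p = i" "u q = Suc i"
      using Sn_inv_eq[OF assms(2)] by (auto simp: p_def q_def)
    have range: "1 \<le> p" "p \<le> n" "1 \<le> q" "q \<le> n"
      using Sn_range[OF assms(2), of p] Sn_range[OF assms(2), of q] i u by auto
    have "w p < w q"
    proof (cases "p < q")
      case True
      then have "(p, q) \<notin> Invs n w" using assms(3) u by (simp add: Invs_def)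
      moreover have "w p \<noteq> w q" using True Sn_eq_iff[OF assms(1)] by simp
      ultimately show ?thesis using True range by (simp add: Invs_def)
    next
      case False
      moreover have "p \<noteq> q" using u by auto
      ultimately have "(q, p) \<in> Invs n u" using u range by (simp add: Invs_def)
      then show ?thesis using assms(3) by (auto simp: Invs_def)
    qed
    then show "(w \<circ> inv u) i < (w \<circ> inv u) (Suc i)" by (simp add: p_def q_def)
  qed
  then show ?thesis
    using Sn_bij[OF assms(2)] by (metis bij_is_inj comp_id fun.map_id inv_o_cancel o_assoc)
qed

lemma word_perm_Nil [simp]: "word_perm [] = id"
  and word_perm_Cons: "word_perm (i # u) = s i \<circ> word_perm u"
  by (simp_all add: word_perm_def)

lemma word_perm_append: "word_perm (u @ v) = word_perm u \<circ> word_perm v"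
  by (induction u) (simp_all add: word_perm_Cons o_assoc)

lemma word_perm_Sn: "set u \<subseteq> {1..<n} \<Longrightarrow> word_perm u \<in> Sn n"
  by (induction u) (auto simp: word_perm_Cons intro!: Sn_s_comp)

lemma inv_count_word_perm: "set u \<subseteq> {1..<n} \<Longrightarrow> inv_count n (word_perm u) \<le> length u"
proof (induction u)
  case Nil
  have "Invs n id = {}" by (auto simp: Invs_def)
  then have "inv_count n id = 0" unfolding inv_count_eq by simp
  then show ?case by (simp del: id_apply)
next
  case (Cons i u)
  then have "word_perm u \<in> Sn n" "i \<in> {1..<n}" using word_perm_Sn[of u n] by simp_all
  then have "inv_count n (s i \<circ> word_perm u) \<le> Suc (inv_count n (word_perm u))"
    using inv_count_ascent inv_count_descent by (metis Suc_n_not_le_n le_SucI nle_le)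
  then show ?case using Cons unfolding word_perm_Cons by (simp del: o_apply)
qed

lemma reduced_word_Cons:
  assumes "w \<in> Sn n"
  shows "reduced_word n w (i # u) \<longleftrightarrow> i \<in> {1..<n} \<and> ldesc w i \<and> reduced_word n (s i \<circ> w) u"
proof
  assume r: "reduced_word n w (i # u)"
  then have i: "i \<in> {1..<n}" and u: "set u \<subseteq> {1..<n}" and w: "w = s i \<circ> word_perm u"
    and l: "Suc (length u) = inv_count n w"
    by (auto simp: reduced_word_def word_perm_Cons)
  have wu: "s i \<circ> w = word_perm u" by (simp add: w)
  then have le: "inv_count n (s i \<circ> w) \<le> length u"
    using inv_count_word_perm[OF u] by simp
  then have "ldesc w i"
    using l inv_count_ascent[OF assms i] by (cases "ldesc w i") auto
  then show "i \<in> {1..<n} \<and> ldesc w i \<and> reduced_word n (s i \<circ> w) u"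
    using i u wu l inv_count_descent[OF assms i] by (simp add: reduced_word_def)
next
  assume r: "i \<in> {1..<n} \<and> ldesc w i \<and> reduced_word n (s i \<circ> w) u"
  then have "word_perm (i # u) = w"
    by (simp add: word_perm_Cons reduced_word_def)
  then show "reduced_word n w (i # u)"
    using r inv_count_descent[OF assms] by (auto simp: reduced_word_def)
qed

lemma inv_count_eq_0_iff:
  assumes "w \<in> Sn n"
  shows "inv_count n w = 0 \<longleftrightarrow> w = id"
  using ex_ldesc[OF assms] inv_count_descent[OF assms] inv_count_word_perm[of "[]" n] by fastforce

lemma ex_reduced_word: "w \<in> Sn n \<Longrightarrow> \<exists>u. reduced_word n w u"
proof (induction "inv_count n w" arbitrary: w)
  case 0
  then have "w = id" by (simp add: inv_count_eq_0_iff)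
  then have "reduced_word n w []" using 0 by (simp add: reduced_word_def del: id_apply)
  then show ?case ..
next
  case (Suc k)
  then have "w \<noteq> id" using inv_count_eq_0_iff by fastforce
  then obtain i where i: "i \<in> {1..<n}" "ldesc w i" using ex_ldesc Suc.prems by blast
  then have "k = inv_count n (s i \<circ> w)"
    using Suc inv_count_descent by auto
  then obtain u where "reduced_word n (s i \<circ> w) u"
    using Suc i Sn_s_comp by blast
  then show ?case using reduced_word_Cons[OF Suc.prems] i by blast
qed

lemma reduced_rword: "w \<in> Sn n \<Longrightarrow> reduced_word n w (rword n w)"
  unfolding rword_def by (rule someI_ex) (rule ex_reduced_word)

lemma reduced_word_Sn: "reduced_word n w u \<Longrightarrow> w \<in> Sn n"
  by (auto simp: reduced_word_def word_perm_Sn)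

lemma rword_id: "rword n id = []"
  using reduced_rword[OF Sn_id] by (simp add: reduced_word_def inv_count_eq_0_iff[OF Sn_id, THEN iffD2])

section \<open>Braid moves and Matsumoto's theorem\<close>

inductive braid_eq :: "nat \<Rightarrow> nat list \<Rightarrow> nat list \<Rightarrow> bool" for n where
  beq_refl: "set u \<subseteq> {1..<n} \<Longrightarrow> braid_eq n u u"
| beq_sym: "braid_eq n u v \<Longrightarrow> braid_eq n v u"
| beq_trans: "braid_eq n u v \<Longrightarrow> braid_eq n v w \<Longrightarrow> braid_eq n u w"
| beq_Cons: "i \<in> {1..<n} \<Longrightarrow> braid_eq n u v \<Longrightarrow> braid_eq n (i # u) (i # v)"
| beq_far: "i \<in> {1..<n} \<Longrightarrow> j \<in> {1..<n} \<Longrightarrow> i + 1 < j \<or> j + 1 < i \<Longrightarrow> set u \<subseteq> {1..<n}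
    \<Longrightarrow> braid_eq n (i # j # u) (j # i # u)"
| beq_braid: "i \<in> {1..<n} \<Longrightarrow> Suc i \<in> {1..<n} \<Longrightarrow> set u \<subseteq> {1..<n}
    \<Longrightarrow> braid_eq n (i # Suc i # i # u) (Suc i # i # Suc i # u)"

lemma reduced_word_set: "reduced_word n w u \<Longrightarrow> set u \<subseteq> {1..<n}"
  by (simp add: reduced_word_def)

text \<open>Matsumoto's theorem: if two reduced words start with different letters \<open>i\<close> and \<open>j\<close>, then both
  are equivalent, by induction on the length, to words starting with the longest element of the
  rank two parabolic subgroup generated by \<open>i\<close> and \<open>j\<close>.\<close>

theorem matsumoto: "reduced_word n w u \<Longrightarrow> reduced_word n w v \<Longrightarrow> braid_eq n u v"
proof (induction "length u" arbitrary: w u v)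
  case 0
  then have "u = []" "v = []" by (metis length_0_conv reduced_word_def)+
  then show ?case by (simp add: beq_refl)
next
  case (Suc l)
  note w = reduced_word_Sn[OF Suc.prems(1)]
  have "length v = length u" using Suc.prems by (simp add: reduced_word_def)
  then obtain i u' j v' where u: "u = i # u'" and v: "v = j # v'" and l: "length u' = l" "length v' = l"
    using Suc.hyps(2) by (metis length_Suc_conv)
  have i: "i \<in> {1..<n}" "ldesc w i" "reduced_word n (s i \<circ> w) u'"
    and j: "j \<in> {1..<n}" "ldesc w j" "reduced_word n (s j \<circ> w) v'"
    using Suc.prems reduced_word_Cons[OF w] by (auto simp: u v)
  have adjacent: "braid_eq n (a # x) (b # y)"
    if a: "a \<in> {1..<n}" "ldesc w a" "reduced_word n (s a \<circ> w) x" "length x = l"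
    and b: "b \<in> {1..<n}" "ldesc w b" "reduced_word n (s b \<circ> w) y" "length y = l" and ab: "b = Suc a" for a b x y
  proof -
    let ?a = "s a \<circ> w" and ?b = "s b \<circ> w"
    have S: "?a \<in> Sn n" "?b \<in> Sn n" "s b \<circ> ?a \<in> Sn n" "s a \<circ> ?b \<in> Sn n"
      using a(1) b(1) w by (auto intro!: Sn_s_comp)
    have inv: "inv ?a = inv w \<circ> s a" "inv ?b = inv w \<circ> s b"
      "inv (s b \<circ> ?a) = inv w \<circ> s a \<circ> s b" "inv (s a \<circ> ?b) = inv w \<circ> s b \<circ> s a"
      using S w by (simp_all add: inv_s_comp)
    have ld: "ldesc ?a b" "ldesc (s b \<circ> ?a) a" "ldesc ?b a" "ldesc (s a \<circ> ?b) b"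
      unfolding inv using a(2) b(2) by (simp_all add: ab)
    have eq: "s a \<circ> (s b \<circ> ?a) = s b \<circ> (s a \<circ> ?b)"
      using s_braid[of a] by (simp add: ab o_assoc)
    obtain z where z: "reduced_word n (s a \<circ> (s b \<circ> ?a)) z"
      using ex_reduced_word[OF Sn_s_comp[OF a(1) S(3)]] by blast
    have "reduced_word n ?a (b # a # z)" "reduced_word n ?b (a # b # z)"
      using z a(1) b(1) ld eq by (simp_all add: reduced_word_Cons[OF S(1)] reduced_word_Cons[OF S(2)]
        reduced_word_Cons[OF S(3)] reduced_word_Cons[OF S(4)])
    then have "braid_eq n x (b # a # z)" "braid_eq n y (a # b # z)"
      using Suc.hyps(1)[OF a(4)[symmetric] a(3)] Suc.hyps(1)[OF b(4)[symmetric] b(3)] by blast+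
    then have "braid_eq n (a # x) (a # b # a # z)" "braid_eq n (b # y) (b # a # b # z)"
      using a(1) b(1) by (auto intro: beq_Cons)
    moreover have "braid_eq n (a # b # a # z) (b # a # b # z)"
      using a(1) b(1) reduced_word_set[OF z] unfolding ab by (intro beq_braid) auto
    ultimately show ?thesis by (meson beq_trans beq_sym)
  qed
  consider "i = j" | "j = Suc i" | "i = Suc j" | "i + 1 < j \<or> j + 1 < i" by linarith
  then show ?case
  proof cases
    case 1
    then show ?thesis using Suc.hyps(1)[of u'] i j l by (auto simp: u v intro!: beq_Cons)
  next
    case 2
    then show ?thesis using adjacent i j l by (simp add: u v)
  next
    case 3
    then show ?thesis using adjacent[of j v' i u'] i j l by (auto simp: u v intro: beq_sym)
  next
    case 4
    let ?i = "s i \<circ> w" and ?j = "s j \<circ> w"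
    have S: "?i \<in> Sn n" "?j \<in> Sn n"
      using i(1) j(1) w by (auto intro!: Sn_s_comp)
    have inv: "inv ?i = inv w \<circ> s i" "inv ?j = inv w \<circ> s j"
      using w by (simp_all add: inv_s_comp)
    have ld: "ldesc ?i j" "ldesc ?j i"
      unfolding inv using i(2) j(2) 4 by auto
    have eq: "s j \<circ> ?i = s i \<circ> ?j"
      using s_commute[OF 4] by (simp add: o_assoc)
    obtain z where z: "reduced_word n (s j \<circ> ?i) z"
      using ex_reduced_word[OF Sn_s_comp[OF j(1) S(1)]] by blast
    have "reduced_word n ?i (j # z)" "reduced_word n ?j (i # z)"
      using z i(1) j(1) ld eq by (simp_all add: reduced_word_Cons[OF S(1)] reduced_word_Cons[OF S(2)])
    then have "braid_eq n u' (j # z)" "braid_eq n v' (i # z)"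
      using Suc.hyps(1)[OF l(1)[symmetric] i(3)] Suc.hyps(1)[OF l(2)[symmetric] j(3)] by blast+
    then have "braid_eq n (i # u') (i # j # z)" "braid_eq n (j # v') (j # i # z)"
      using i(1) j(1) by (auto intro: beq_Cons)
    moreover have "braid_eq n (i # j # z) (j # i # z)"
      using i(1) j(1) 4 reduced_word_set[OF z] by (intro beq_far) auto
    ultimately show ?thesis unfolding u v by (meson beq_trans beq_sym)
  qed
qed

lemma reduced_word_snoc:
  assumes "reduced_word n w u" "j \<in> {1..<n}" "w j < w (Suc j)"
  shows "reduced_word n (w \<circ> s j) (u @ [j])"
  using assms inv_count_right_ascent[OF reduced_word_Sn[OF assms(1)] assms(2,3)]
  by (auto simp: reduced_word_def word_perm_append word_perm_Cons)

section \<open>Descent classes\<close>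

lemma mem_desc: "i \<in> desc n w \<longleftrightarrow> i \<in> {1..<n} \<and> w (Suc i) < w i"
  by (auto simp: desc_def)

lemma desc_subset: "desc n w \<subseteq> {1..<n}"
  by (auto simp: desc_def)

text \<open>Only the comparison of the values \<open>i\<close> and \<open>Suc i\<close> changes, and
  this is invisible to the descent set unless they occupy neighbouring positions.\<close>

lemma desc_s_comp:
  assumes w: "w \<in> Sn n" and i: "i \<in> {1..<n}" and nadj: "inv w (Suc i) \<noteq> Suc (inv w i)" "inv w i \<noteq> Suc (inv w (Suc i))"
  shows "desc n (s i \<circ> w) = desc n w"
proof -
  have "s i (w (Suc k)) < s i (w k) \<longleftrightarrow> w (Suc k) < w k" for k
  proof -
    have "\<not> (w k = i \<and> w (Suc k) = Suc i)" "\<not> (w k = Suc i \<and> w (Suc k) = i)"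
      using nadj Sn_inv_eq[OF w] by metis+
    moreover have "w k \<noteq> w (Suc k)" using Sn_eq_iff[OF w] by simp
    ultimately show ?thesis by (auto simp: s_def)
  qed
  then show ?thesis by (simp add: desc_def)
qed

text \<open>If the descent set changes, \<open>i\<close> and \<open>Suc i\<close> stand next to each
  other, and exchanging these values is the same as exchanging their positions. This right
  multiplication is the source of the zero entries in both action tables.\<close>

lemma ascent_same_desc_or_right_mult:
  assumes w: "w \<in> Sn n" and i: "i \<in> {1..<n}" and asc: "\<not> ldesc w i" and "desc n (s i \<circ> w) \<noteq> desc n w"
  obtains j where "j \<in> {1..<n}" "w j < w (Suc j)" "s i \<circ> w = w \<circ> s j"
proof -
  define p where "p = inv w i"
  have "inv w (Suc i) = Suc (inv w i)"
    using desc_s_comp[OF w i] assms by fastforce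
  then have wp: "w p = i" "w (Suc p) = Suc i"
    using Sn_inv_eq[OF w] p_def by auto
  show thesis
  proof
    show "p \<in> {1..<n}"
      using Sn_range[OF w, of p] Sn_range[OF w, of "Suc p"] wp i by auto
    show "w p < w (Suc p)" using wp by simp
    have "s i (w x) = w (s p x)" for x
      using wp Sn_eq_iff[OF w, of x p] Sn_eq_iff[OF w, of x "Suc p"] by (auto simp: s_def)
    then show "s i \<circ> w = w \<circ> s p" by (simp add: fun_eq_iff)
  qed
qed

text \<open>The inversion set of the longest element of the parabolic subgroup of \<open>J\<close>:
  pairs of positions not separated by any cut outside \<open>J\<close>.\<close>

definition Invs0 :: "nat \<Rightarrow> nat set \<Rightarrow> (nat \<times> nat) set" where
  "Invs0 n J = {(p, q). 1 \<le> p \<and> p < q \<and> q \<le> n \<and> {p..<q} \<subseteq> J}"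

lemma parab_Sn: "J \<subseteq> {1..<n} \<Longrightarrow> v \<in> parab J \<Longrightarrow> v \<in> Sn n"
  unfolding parab_def using word_perm_Sn order_trans by blast

lemma parab_stabilizes: "v \<in> parab J \<Longrightarrow> i \<notin> J \<Longrightarrow> v k \<le> i \<longleftrightarrow> k \<le> i"
proof -
  assume "v \<in> parab J" "i \<notin> J"
  then obtain u where "v = word_perm u" "set u \<subseteq> J" by (auto simp: parab_def)
  moreover have "set u \<subseteq> J \<Longrightarrow> word_perm u k \<le> i \<longleftrightarrow> k \<le> i" for u
  proof (induction u)
    case (Cons j u)
    then have "j \<noteq> i" using \<open>i \<notin> J\<close> by auto
    then have "s j x \<le> i \<longleftrightarrow> x \<le> i" for x by (auto simp: s_def)
    then show ?case using Cons by (simp add: word_perm_Cons)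
  qed simp
  ultimately show ?thesis by blast
qed

text \<open>An element of the parabolic subgroup preserves every initial segment ending at some
  \<open>i \<notin> J\<close>, so no inversion crosses such a cut.\<close>

lemma Invs_parab: "v \<in> parab J \<Longrightarrow> Invs n v \<subseteq> Invs0 n J"
proof -
  assume v: "v \<in> parab J"
  have "i \<in> J" if "v q < v p" "p \<le> i" "i < q" for p q i
    using parab_stabilizes[OF v, of i p] parab_stabilizes[OF v, of i q] that by force
  then show ?thesis by (auto simp: Invs_def Invs0_def)
qed

lemma Invs0_subset:
  assumes "J \<subseteq> desc n w"
  shows "Invs0 n J \<subseteq> Invs n w"
proof -
  have "w (p + Suc d) < w p" if "{p..<p + Suc d} \<subseteq> J" for p d
    using that
  proof (induction d)
    case 0
    then show ?case using assms by (auto simp: mem_desc)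
  next
    case (Suc d)
    then have "{p..<p + Suc d} \<subseteq> J" "p + Suc d \<in> J" by auto
    then show ?case using Suc.IH assms by (auto simp: mem_desc subset_iff intro: less_trans)
  qed
  then have "w q < w p" if "p < q" "{p..<q} \<subseteq> J" for p q
    using that by (metis less_imp_Suc_add add_Suc_right)
  then show ?thesis by (auto simp: Invs_def Invs0_def)
qed

lemma longest_parab:
  assumes "J \<subseteq> {1..<n}"
  shows "longest n J \<in> parab J" and "u \<in> parab J \<Longrightarrow> inv_count n u \<le> inv_count n (longest n J)"
proof -
  have fin: "finite (parab J)"
    using parab_Sn[OF assms] by (intro finite_subset[OF _ finite_Sn[of n]]) auto
  have "id \<in> parab J"
    by (auto simp: parab_def intro!: exI[of _ "[]"])
  then have "Max (inv_count n ` parab J) \<in> inv_count n ` parab J"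
    using fin by (intro Max_in) auto
  then obtain w where w: "w \<in> parab J" "Max (inv_count n ` parab J) = inv_count n w"
    by (rule imageE)
  have "\<forall>u\<in>parab J. inv_count n u \<le> inv_count n w"
    unfolding w(2)[symmetric] using fin by (intro ballI Max_ge) auto
  with w(1) have "\<exists>w. w \<in> parab J \<and> (\<forall>u\<in>parab J. inv_count n u \<le> inv_count n w)"
    by blast
  then have "longest n J \<in> parab J \<and> (\<forall>u\<in>parab J. inv_count n u \<le> inv_count n (longest n J))"
    unfolding longest_def by (rule someI_ex)
  then show "longest n J \<in> parab J" and "u \<in> parab J \<Longrightarrow> inv_count n u \<le> inv_count n (longest n J)"
    by auto
qed

lemma longest_Sn: "J \<subseteq> {1..<n} \<Longrightarrow> longest n J \<in> Sn n"
  using longest_parab(1) parab_Sn by blast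

lemma parab_right_mult: "v \<in> parab J \<Longrightarrow> j \<in> J \<Longrightarrow> v \<circ> s j \<in> parab J"
proof -
  assume "v \<in> parab J" "j \<in> J"
  then obtain u where "v = word_perm u" "set u \<subseteq> J" by (auto simp: parab_def)
  then show ?thesis
    using \<open>j \<in> J\<close> by (auto simp: parab_def word_perm_append word_perm_Cons intro!: exI[of _ "u @ [j]"])
qed

text \<open>An ascent at some \<open>j \<in> J\<close> would allow a longer element of the subgroup
  by multiplication with \<open>s j\<close>. So all of \<open>J\<close> consists of descents, and
  the inversion set is squeezed between the bounds of \<open>Invs0_subset\<close> and
  \<open>Invs_parab\<close>.\<close>

lemma Invs_longest:
  assumes "J \<subseteq> {1..<n}"
  shows "Invs n (longest n J) = Invs0 n J"
proof
  let ?w = "longest n J"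
  have "J \<subseteq> desc n ?w"
  proof
    fix j assume j: "j \<in> J"
    have "\<not> ?w j < ?w (Suc j)"
    proof
      assume "?w j < ?w (Suc j)"
      then have "inv_count n (?w \<circ> s j) = Suc (inv_count n ?w)"
        using j assms by (intro inv_count_right_ascent longest_Sn) auto
      then show False
        using longest_parab(2)[OF assms parab_right_mult[OF longest_parab(1)[OF assms] j]] by simp
    qed
    moreover have "?w j \<noteq> ?w (Suc j)"
      using Sn_eq_iff[OF longest_Sn[OF assms]] by simp
    ultimately show "j \<in> desc n ?w"
      using j assms by (auto simp: mem_desc)
  qed
  then show "Invs0 n J \<subseteq> Invs n ?w" by (rule Invs0_subset)
  show "Invs n ?w \<subseteq> Invs0 n J"
    using Invs_parab[OF longest_parab(1)[OF assms]] .
qed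

lemma desc_conv_Invs: "j \<in> desc n w \<longleftrightarrow> (j, Suc j) \<in> Invs n w"
  by (auto simp: mem_desc Invs_def)

lemma desc_longest: "J \<subseteq> {1..<n} \<Longrightarrow> desc n (longest n J) = J"
  by (fastforce simp: desc_conv_Invs Invs_longest Invs0_def)

text \<open>An inversion of \<open>w\<close> outside the minimal inversion set and with \<open>w p - w q\<close> as small as possible
  has \<open>w p - w q = 1\<close>; exchanging these two values keeps the descent set.\<close>

lemma ex_ldesc_same_desc:
  assumes w: "w \<in> Sn n" and ne: "w \<noteq> longest n (desc n w)"
  obtains i where "i \<in> {1..<n}" "ldesc w i" "desc n (s i \<circ> w) = desc n w"
proof -
  let ?J = "desc n w"
  have "Invs n w \<noteq> Invs0 n ?J"
    using ne Invs_eqD[OF w longest_Sn[OF desc_subset]] Invs_longest[OF desc_subset] by metis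
  then have "\<exists>x. x \<in> Invs n w - Invs0 n ?J"
    using Invs0_subset[of ?J n w] by blast
  then obtain x where x: "x \<in> Invs n w - Invs0 n ?J"
      and min: "\<And>y. y \<in> Invs n w - Invs0 n ?J \<Longrightarrow> w (fst x) - w (snd x) \<le> w (fst y) - w (snd y)"
    using ex_has_least_nat[of "\<lambda>x. x \<in> Invs n w - Invs0 n ?J" _ "\<lambda>x. w (fst x) - w (snd x)"] by metis
  obtain p q where pq: "x = (p, q)" by (cases x)
  have inv: "1 \<le> p" "p < q" "q \<le> n" "w q < w p" and out: "\<not> {p..<q} \<subseteq> ?J"
    using x by (auto simp: pq Invs_def Invs0_def)
  have wpq: "w p = Suc (w q)"
  proof (rule ccontr)
    assume "w p \<noteq> Suc (w q)"
    then have lt: "Suc (w q) < w p" using inv by simp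
    define r where "r = inv w (Suc (w q))"
    have wr: "w r = Suc (w q)" using Sn_inv_eq[OF w] r_def by auto
    have r: "1 \<le> r" "r \<le> n"
      using Sn_range[OF w, of r] Sn_range[OF w, of p] wr lt inv by auto
    have "r \<noteq> p" "r \<noteq> q" using wr lt by auto
    have no: False if "a < b" "1 \<le> a" "b \<le> n" "w b < w a" "\<not> {a..<b} \<subseteq> ?J" "w a - w b < w p - w q" for a b
    proof -
      have "(a, b) \<in> Invs n w - Invs0 n ?J" using that by (simp add: Invs_def Invs0_def)
      from min[OF this] that(6) show False by (simp add: pq)
    qed
    consider "r < p" | "p < r" "r < q" | "q < r"
      using \<open>r \<noteq> p\<close> \<open>r \<noteq> q\<close> by linarith
    then show False
    proof cases
      case 1
      then have "{p..<q} \<subseteq> {r..<q}" by auto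
      then have "\<not> {r..<q} \<subseteq> ?J" using out by blast
      with 1 r inv wr lt show False by (intro no[of r q]) simp_all
    next
      case 2
      then have "{p..<q} = {p..<r} \<union> {r..<q}" by auto
      then have "\<not> {p..<r} \<subseteq> ?J \<or> \<not> {r..<q} \<subseteq> ?J" using out by auto
      then show False
      proof
        assume "\<not> {p..<r} \<subseteq> ?J"
        with 2 r inv wr lt show False by (intro no[of p r]) simp_all
      next
        assume "\<not> {r..<q} \<subseteq> ?J"
        with 2 r inv wr lt show False by (intro no[of r q]) simp_all
      qed
    next
      case 3
      then have "{p..<q} \<subseteq> {p..<r}" by auto
      then have "\<not> {p..<r} \<subseteq> ?J" using out by blast
      with 3 r inv wr lt show False by (intro no[of p r]) simp_all
    qed
  qed
  have "q \<noteq> Suc p"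
  proof
    assume "q = Suc p"
    then have "p \<in> ?J" using inv by (auto simp: mem_desc)
    then show False using out \<open>q = Suc p\<close> by auto
  qed
  have i: "inv w (w q) = q" "inv w (Suc (w q)) = p"
    using Sn_inv_eq[OF w] wpq by auto
  show thesis
  proof
    show "w q \<in> {1..<n}"
      using Sn_range[OF w, of q] Sn_range[OF w, of p] inv wpq by auto
    then show "desc n (s (w q) \<circ> w) = ?J"
      using \<open>q \<noteq> Suc p\<close> inv i by (intro desc_s_comp[OF w]) auto
    show "ldesc w (w q)" using i inv by simp
  qed
qed

text \<open>Takes the place of the interval description of a descent class: each member is reached
  from the bottom element by left ascents that stay inside the class.\<close>

lemma descent_class_induct [consumes 1, case_names longest step]:
  assumes "w \<in> Sn n"
    and "P (longest n (desc n w))"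
    and "\<And>v i. v \<in> Sn n \<Longrightarrow> i \<in> {1..<n} \<Longrightarrow> ldesc v i \<Longrightarrow> desc n v = desc n w \<Longrightarrow>
      desc n (s i \<circ> v) = desc n w \<Longrightarrow> P (s i \<circ> v) \<Longrightarrow> P v"
  shows "P w"
proof -
  have "P v" if "v \<in> Sn n" "desc n v = desc n w" for v
    using that
  proof (induction "inv_count n v" arbitrary: v rule: less_induct)
    case less
    show ?case
    proof (cases "v = longest n (desc n v)")
      case True
      then show ?thesis using assms(2) less.prems by metis
    next
      case False
      then obtain i where i: "i \<in> {1..<n}" "ldesc v i" "desc n (s i \<circ> v) = desc n v"
        using ex_ldesc_same_desc less.prems(1) by blast
      then have "P (s i \<circ> v)"
        using less.prems inv_count_descent[of v n i] Sn_s_comp by (intro less.hyps) auto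
      then show ?thesis using assms(3) i less.prems by metis
    qed
  qed
  then show ?thesis using assms(1) by blast
qed

section \<open>Compositions and subsets\<close>

lemma Dc_Cons: "Dc (a # \<beta>) = (if \<beta> = [] then {} else insert a ((+) a ` Dc \<beta>))"
proof (cases "\<beta> = []")
  case False
  have "x \<in> Dc (a # \<beta>) \<longleftrightarrow> x \<in> insert a ((+) a ` Dc \<beta>)" for x
  proof
    assume "x \<in> Dc (a # \<beta>)"
    then obtain k where k: "x = a + sum_list (take k \<beta>)" "k < length \<beta>"
      by (auto simp: Dc_def take_Cons' split: if_splits)
    show "x \<in> insert a ((+) a ` Dc \<beta>)"
    proof (cases "k = 0")
      case True
      then show ?thesis using k by simp
    next
      case False
      then have "sum_list (take k \<beta>) \<in> Dc \<beta>"
        unfolding Dc_def using k by (intro CollectI exI[of _ k]) simp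
      then show ?thesis using k by blast
    qed
  next
    assume "x \<in> insert a ((+) a ` Dc \<beta>)"
    then consider "x = a" | k where "x = a + sum_list (take k \<beta>)" "1 \<le> k" "k < length \<beta>"
      by (auto simp: Dc_def)
    then show "x \<in> Dc (a # \<beta>)"
    proof cases
      case 1
      then show ?thesis using False by (auto simp: Dc_def intro!: exI[of _ 1])
    next
      case 2
      then show ?thesis by (auto simp: Dc_def intro!: exI[of _ "Suc k"])
    qed
  qed
  then show ?thesis using False by auto
qed (auto simp: Dc_def)

lemma Dc_subset: "0 \<notin> set \<alpha> \<Longrightarrow> Dc \<alpha> \<subseteq> {1..<sum_list \<alpha>}"
proof (induction \<alpha>)
  case (Cons a \<beta>)
  then show ?case
    by (cases \<beta>) (fastforce simp: Dc_Cons split: if_splits)+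
qed (auto simp: Dc_def)

lemma Dc_pos: "0 \<notin> set \<alpha> \<Longrightarrow> x \<in> Dc \<alpha> \<Longrightarrow> 0 < x"
  using Dc_subset by fastforce

text \<open>When there are at least two parts, the first part is the least element of
  \<open>Dc\<close>; removing it and shifting the rest gives the set of the remaining
  composition.\<close>

lemma Dc_inj:
  assumes "0 \<notin> set \<alpha>" "0 \<notin> set \<beta>" "sum_list \<alpha> = sum_list \<beta>" "Dc \<alpha> = Dc \<beta>"
  shows "\<alpha> = \<beta>"
  using assms
proof (induction \<alpha> arbitrary: \<beta>)
  case Nil
  then show ?case by (cases \<beta>) auto
next
  case (Cons a \<alpha>)
  then obtain b \<beta>' where b: "\<beta> = b # \<beta>'" by (cases \<beta>) auto
  show ?case
  proof (cases "\<alpha> = [] \<or> \<beta>' = []")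
    case True
    then show ?thesis using Cons.prems b by (auto simp: Dc_Cons split: if_splits)
  next
    case False
    have eq: "insert a ((+) a ` Dc \<alpha>) = insert b ((+) b ` Dc \<beta>')"
      using Cons.prems(4) False by (simp add: b Dc_Cons)
    have pos: "\<And>x. x \<in> Dc \<alpha> \<Longrightarrow> 0 < x" "\<And>x. x \<in> Dc \<beta>' \<Longrightarrow> 0 < x"
      using Dc_pos Cons.prems b by auto
    have "a \<in> insert b ((+) b ` Dc \<beta>')" "b \<in> insert a ((+) a ` Dc \<alpha>)"
      using eq by auto
    then have ab: "a = b" by auto
    have "a \<notin> (+) a ` Dc \<alpha>" "a \<notin> (+) a ` Dc \<beta>'"
      using pos by force+
    then have "(+) a ` Dc \<alpha> = (+) a ` Dc \<beta>'"
      using eq ab by (metis insert_ident)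
    then have "Dc \<alpha> = Dc \<beta>'" by (simp add: inj_image_eq_iff)
    then show ?thesis using Cons b ab by auto
  qed
qed

lemma Dc_surj: "J \<subseteq> {1..<n} \<Longrightarrow> 1 \<le> n \<Longrightarrow> \<exists>\<alpha>\<in>comps n. Dc \<alpha> = J"
proof (induction n arbitrary: J rule: less_induct)
  case (less n)
  show ?case
  proof (cases "J = {}")
    case True
    then show ?thesis using less.prems by (intro bexI[of _ "[n]"]) (auto simp: Dc_Cons comps_def)
  next
    case False
    have fin: "finite J" using less.prems(1) finite_subset by blast
    define a where "a = Min J"
    have a: "a \<in> J" "\<And>j. j \<in> J \<Longrightarrow> a \<le> j" using False fin by (auto simp: a_def)
    then have an: "1 \<le> a" "a < n" using less.prems by auto
    let ?J = "(\<lambda>j. j - a) ` (J - {a})"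
    have "?J \<subseteq> {1..<n - a}"
      using a less.prems(1) by (fastforce simp: image_subset_iff)
    then have "\<exists>\<beta>\<in>comps (n - a). Dc \<beta> = ?J"
      by (rule less.IH[rotated]) (use an in auto)
    then obtain \<beta> where \<beta>: "\<beta> \<in> comps (n - a)" "Dc \<beta> = ?J"
      by blast
    have "(+) a ` ?J = J - {a}"
      using a(2) by (force simp: image_image)
    moreover have "\<beta> \<noteq> []" using \<beta>(1) an by (auto simp: comps_def)
    ultimately have "Dc (a # \<beta>) = J"
      using a \<beta> by (auto simp: Dc_Cons)
    moreover have "a # \<beta> \<in> comps n" using \<beta>(1) an by (auto simp: comps_def)
    ultimately show ?thesis by blast
  qed
qed

lemma bij_betw_Dc:
  assumes "1 \<le> n"
  shows "bij_betw Dc (comps n) (Pow {1..<n})"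
proof (rule bij_betw_imageI)
  show "inj_on Dc (comps n)"
    by (rule inj_onI, rule Dc_inj) (simp_all add: comps_def)
  show "Dc ` comps n = Pow {1..<n}"
  proof
    show "Dc ` comps n \<subseteq> Pow {1..<n}"
      using Dc_subset unfolding comps_def by blast
    show "Pow {1..<n} \<subseteq> Dc ` comps n"
      using Dc_surj[OF _ assms] by blast
  qed
qed

section \<open>The operators of permutations and the action on the basis elements\<close>

lemma foldr_pibar_braid_eq: "braid_eq n u v \<Longrightarrow> foldr pibar u f = foldr pibar v f"
proof (induction rule: braid_eq.induct)
  case (beq_far i j u)
  then show ?case using pibar_commute[of i j "foldr pibar u f"] by simp
qed (simp_all add: pibar_braid)

text \<open>By Matsumoto's theorem the choice made by \<open>rword\<close> is immaterial, so a
  reduced word with a convenient first or last letter may be used.\<close>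

lemma pibar_w_eq: "reduced_word n w u \<Longrightarrow> pibar_w n w f = foldr pibar u f"
  unfolding pibar_w_def
  by (rule foldr_pibar_braid_eq, rule matsumoto[OF reduced_rword]) (auto intro: reduced_word_Sn)

lemma pibar_w_id [simp]: "pibar_w n id f = f"
  by (simp add: pibar_w_def rword_id)

lemma pibar_w_ldesc:
  assumes "w \<in> Sn n" "i \<in> {1..<n}" "ldesc w i"
  shows "pibar_w n w f = pibar i (pibar_w n (s i \<circ> w) f)"
proof -
  have "reduced_word n w (i # rword n (s i \<circ> w))"
    using assms reduced_rword[OF Sn_s_comp[OF assms(2,1)]] by (simp add: reduced_word_Cons)
  then show ?thesis by (simp add: pibar_w_eq pibar_w_def[of n "s i \<circ> w"])
qed

lemma lin_foldr_pibar: "lin (foldr pibar u)"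
  by (induction u) (auto simp: module_hom_iff pm.module_axioms pibar_add pibar_sc)

lemma lin_pibar_w: "lin (pibar_w n w)"
  using lin_foldr_pibar unfolding pibar_w_def[abs_def] .

lemma foldr_pibar_low: "f \<in> low k \<Longrightarrow> foldr pibar u f \<in> low k"
  by (induction u) (auto intro: pibar_low)

lemma pibar_w_low: "f \<in> low k \<Longrightarrow> pibar_w n w f \<in> low k"
  unfolding pibar_w_def by (rule foldr_pibar_low)

lemma foldr_pibar_polys: "set u \<subseteq> {1..<n} \<Longrightarrow> f \<in> polys n \<Longrightarrow> foldr pibar u f \<in> polys n"
proof (induction u)
  case (Cons i u)
  then show ?case using pibar_polys[of i n "foldr pibar u f"] by simp
qed simp

lemma rword_set: "w \<in> Sn n \<Longrightarrow> set (rword n w) \<subseteq> {1..<n}"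
  using reduced_rword reduced_word_set by blast

lemma pibar_w_polys: "w \<in> Sn n \<Longrightarrow> f \<in> polys n \<Longrightarrow> pibar_w n w f \<in> polys n"
  unfolding pibar_w_def by (intro foldr_pibar_polys rword_set)

lemma pibar_w_invariant_factor:
  assumes "w \<in> Sn n" "\<And>i. i \<in> {1..<n} \<Longrightarrow> sact i e = e"
  shows "pibar_w n w (f * e) = pibar_w n w f * e"
proof -
  have "set u \<subseteq> {1..<n} \<Longrightarrow> foldr pibar u (f * e) = foldr pibar u f * e" for u
  proof (induction u)
    case (Cons i u)
    then show ?case using pibar_invariant_factor[OF assms(2)[of i], of "foldr pibar u f"] by simp
  qed simp
  then show ?thesis unfolding pibar_w_def using rword_set[OF assms(1)] by blast
qed

text \<open>\<open>s j\<close> permutes the variables of \<open>x\<^sub>1 \<cdots> x\<^sub>i\<close>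
  among themselves unless \<open>i = j\<close>. For \<open>j = 0\<close> it would introduce the
  variable with index 0.\<close>

lemma sact_xI:
  assumes "j \<notin> I" "0 < j"
  shows "sact j (xI I) = xI I"
proof -
  have *: "sact j (\<Prod>k\<in>{1..i}. Var k) = (\<Prod>k\<in>{1..i}. Var k :: 'a::field mpoly)" if "i \<in> I" for i
  proof -
    have "i \<noteq> j" using that assms by auto
    have "sact j (\<Prod>k\<in>{1..i}. Var k) = (\<Prod>k\<in>{1..i}. Var (s j k) :: 'a mpoly)"
      by (simp add: perm_act_prod)
    also have "\<dots> = (\<Prod>k\<in>{1..i}. Var k)"
      by (rule prod.reindex_bij_witness[of _ "s j" "s j"])
        (use assms \<open>i \<noteq> j\<close> in \<open>auto simp: s_def split: if_splits\<close>)
    finally show ?thesis .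
  qed
  show ?thesis
    unfolding xI_def by (subst perm_act_prod, rule prod.cong[OF refl], rule *)
qed

definition bvec :: "nat \<Rightarrow> (nat \<Rightarrow> nat) \<Rightarrow> 'a::field mpoly" where
  "bvec n w = pibar_w n w (xI (desc n w))"

lemma xI_polys: "I \<subseteq> {1..<n} \<Longrightarrow> xI I \<in> polys n"
  unfolding xI_def by (intro polys_prod polys_Var) auto

lemma bvec_polys: "w \<in> Sn n \<Longrightarrow> bvec n w \<in> polys n"
  unfolding bvec_def by (intro pibar_w_polys xI_polys desc_subset)

lemma desc_id [simp]: "desc n id = {}"
  by (auto simp: desc_def)

lemma bvec_id: "bvec n id = 1"
  by (simp add: bvec_def xI_def del: id_apply)

theorem pibar_bvec:
  assumes w: "w \<in> Sn n" and i: "i \<in> {1..<n}"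
  shows "pibar i (bvec n w) = (if ldesc w i then - bvec n w
    else if desc n (s i \<circ> w) = desc n w then bvec n (s i \<circ> w) else 0)"
proof (cases "ldesc w i")
  case True
  then show ?thesis by (simp add: bvec_def pibar_w_ldesc[OF w i] pibar_pibar)
next
  case False
  have sw: "s i \<circ> w \<in> Sn n" using w i by (rule Sn_s_comp[rotated])
  have step: "pibar i (pibar_w n w f) = pibar_w n (s i \<circ> w) f" for f :: "'a mpoly"
    using pibar_w_ldesc[OF sw i, of f] False ldesc_s_comp[OF w, of i] by (simp del: o_apply)
  show ?thesis
  proof (cases "desc n (s i \<circ> w) = desc n w")
    case True
    then show ?thesis using False step unfolding bvec_def by simp
  next
    case ndesc: False
    obtain j where j: "j \<in> {1..<n}" "w j < w (Suc j)" "s i \<circ> w = w \<circ> s j"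
      using ascent_same_desc_or_right_mult[OF w i False ndesc] .
    \<comment> \<open>With a reduced word ending in \<open>j\<close>, the operator
      \<open>pibar j\<close> is applied first and meets \<open>xI (desc n w)\<close>, which is
      invariant under \<open>s j\<close> because \<open>j\<close> is not a descent.\<close>
    have "reduced_word n (s i \<circ> w) (rword n w @ [j])"
      unfolding j(3) by (intro reduced_word_snoc reduced_rword w j)
    then have "pibar_w n (s i \<circ> w) f = pibar_w n w (pibar j f)" for f :: "'a mpoly"
      by (simp add: pibar_w_eq pibar_w_def[of n w])
    moreover have "pibar j (xI (desc n w)) = (0 :: 'a mpoly)"
      using j by (intro pibar_invariant sact_xI) (auto simp: mem_desc)
    ultimately have "pibar i (bvec n w) = (0 :: 'a mpoly)"
      unfolding bvec_def step by (simp add: module_hom.zero[OF lin_pibar_w])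
    then show ?thesis using False ndesc by simp
  qed
qed

section \<open>Leading monomials\<close>

text \<open>Each letter of a reduced word exchanges the entries of one inversion of
  \<open>w\<close>. By the hypothesis the exponents at the two places are then strictly decreasing,
  so \<open>pibar_mono1_leading\<close> applies at every letter and the errors stay in
  \<open>low\<close>.\<close>

lemma pibar_w_mono1_leading:
  assumes "w \<in> Sn n" "\<And>p q. (p, q) \<in> Invs n w \<Longrightarrow> coef a q < coef a p"
  shows "pibar_w n w (mono1 a) - mono1 (mon_perm w a) \<in> (low (nrm a) :: 'a::field mpoly set)"
  using assms
proof (induction "inv_count n w" arbitrary: w)
  case 0
  then have "w = id" using inv_count_eq_0_iff by metis
  then show ?case by (simp add: pm.subspace_0[OF subspace_low] del: id_apply)
next
  case (Suc l)
  note w = Suc.prems(1)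
  have "w \<noteq> id" using Suc.hyps(2) inv_count_eq_0_iff[OF w] by linarith
  then obtain i where i: "i \<in> {1..<n}" "ldesc w i" using ex_ldesc[OF w] by blast
  define v where "v = s i \<circ> w"
  have v: "v \<in> Sn n" unfolding v_def using i w by (intro Sn_s_comp)
  have inv: "Invs n w = insert (inv w (Suc i), inv w i) (Invs n v)"
    unfolding v_def using Invs_descent[OF w i] by simp
  have sv: "s i \<circ> v = w" by (simp add: v_def)
  have "pibar_w n v (mono1 a) - mono1 (mon_perm v a) \<in> (low (nrm a) :: 'a mpoly set)"
    using Suc.hyps Suc.prems inv_count_descent[OF w i] inv v by (intro Suc.hyps(1)) (auto simp: v_def)
  then have "pibar i (pibar_w n v (mono1 a) - mono1 (mon_perm v a)) \<in> (low (nrm a) :: 'a mpoly set)"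
    by (rule pibar_low)
  moreover have "pibar i (mono1 (mon_perm v a)) - mono1 (mon_perm (s i) (mon_perm v a)) \<in> (low (nrm (mon_perm v a)) :: 'a mpoly set)"
  proof (rule pibar_mono1_leading)
    have "v (inv w (Suc i)) = i" "v (inv w i) = Suc i"
      using Sn_bij[OF w] by (simp_all add: v_def bij_is_surj surj_f_inv_f)
    then have "coef (mon_perm v a) i = coef a (inv w (Suc i))" "coef (mon_perm v a) (Suc i) = coef a (inv w i)"
      using coef_mon_perm[OF Sn_bij[OF v]] by metis+
    then show "coef (mon_perm v a) (Suc i) < coef (mon_perm v a) i"
      using Suc.prems(2) inv by simp
  qed
  ultimately have "pibar i (pibar_w n v (mono1 a) - mono1 (mon_perm v a)) +
     (pibar i (mono1 (mon_perm v a)) - mono1 (mon_perm (s i) (mon_perm v a))) \<in> (low (nrm a) :: 'a mpoly set)"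
    unfolding nrm_mon_perm[OF Sn_bij[OF v]] by (rule pm.subspace_add[OF subspace_low])
  then show ?case
    unfolding pibar_w_ldesc[OF w i] v_def[symmetric] mon_perm_compose sv pibar_diff by simp
qed

section \<open>Elementary symmetric polynomials and the monomials of their products\<close>

definition ind :: "nat set \<Rightarrow> (nat \<Rightarrow>\<^sub>0 nat)" where
  "ind A = (\<Sum>j\<in>A. Poly_Mapping.single j 1)"

lemma coef_ind: "finite A \<Longrightarrow> coef (ind A) j = of_bool (j \<in> A)"
  by (simp add: ind_def lookup_sum lookup_single when_def)

lemma ind_mons: "A \<subseteq> {1..n} \<Longrightarrow> ind A \<in> mons n"
  unfolding ind_def by (intro mons_sum) (auto simp: mons_def)

lemma xI_eq: "xI I = mono1 (\<Sum>i\<in>I. ind {1..i})"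
  by (simp add: xI_def mono1_sum ind_def Var_eq)

definition elem :: "nat \<Rightarrow> nat \<Rightarrow> 'a::field mpoly" where
  "elem n j = (\<Sum>A | A \<subseteq> {1..n} \<and> card A = j. mono1 (ind A))"

lemma finite_sets_card [simp]: "finite {A. A \<subseteq> {1..n::nat} \<and> card A = j}"
  by (rule finite_subset[of _ "Pow {1..n}"]) auto

lemma elem_polys: "elem n j \<in> polys n"
  unfolding elem_def by (intro pm.subspace_sum subspace_polys polys_mono1 ind_mons) auto

lemma perm_act_elem:
  assumes "\<sigma> permutes {1..n}"
  shows "perm_act \<sigma> (elem n j) = elem n j"
proof -
  have inj: "inj \<sigma>" using assms by (simp add: permutes_inj)
  have ind: "mon_perm \<sigma> (ind A) = ind (\<sigma> ` A)" for A
    using inj by (simp add: ind_def mon_perm_sum sum.reindex inj_on_subset)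
  have img: "\<tau> ` A \<subseteq> {1..n} \<and> card (\<tau> ` A) = card A" if "\<tau> permutes {1..n}" "A \<subseteq> {1..n}" for \<tau> A
    using that by (metis card_image image_mono inj_on_subset permutes_image permutes_inj subset_UNIV)
  have "perm_act \<sigma> (elem n j) = (\<Sum>A | A \<subseteq> {1..n} \<and> card A = j. mono1 (ind (\<sigma> ` A)))"
    by (simp add: elem_def perm_act_sum ind)
  also have "\<dots> = elem n j"
    unfolding elem_def
  proof (rule sum.reindex_bij_betw[where g = "\<lambda>A. mono1 (ind A)"])
    show "bij_betw ((`) \<sigma>) {A. A \<subseteq> {1..n} \<and> card A = j} {A. A \<subseteq> {1..n} \<and> card A = j}"
    proof (rule bij_betwI[where g = "(`) (inv \<sigma>)"])
      show "(`) \<sigma> \<in> {A. A \<subseteq> {1..n} \<and> card A = j} \<rightarrow> {A. A \<subseteq> {1..n} \<and> card A = j}"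
        using img[OF assms] by (intro funcsetI, unfold mem_Collect_eq) metis
      show "(`) (inv \<sigma>) \<in> {A. A \<subseteq> {1..n} \<and> card A = j} \<rightarrow> {A. A \<subseteq> {1..n} \<and> card A = j}"
        using img[OF permutes_inv[OF assms]] by (intro funcsetI, unfold mem_Collect_eq) metis
    qed (use permutes_inverses[OF assms] in \<open>auto simp: image_image\<close>)
  qed
  finally show ?thesis .
qed

text \<open>Exponents of \<open>k\<close> outside \<open>{1..n}\<close> are ignored; therefore
  \<open>k\<close> ranges over \<open>mons n\<close> wherever uniqueness matters.\<close>

definition epow :: "nat \<Rightarrow> (nat \<Rightarrow>\<^sub>0 nat) \<Rightarrow> 'a::field mpoly" where
  "epow n k = (\<Prod>j\<in>{1..n}. elem n j ^ coef k j)"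

lemma epow_polys: "epow n k \<in> polys n"
  unfolding epow_def by (intro polys_prod polys_power elem_polys)

lemma epow_add: "epow n (k + l) = epow n k * epow n l"
  by (simp add: epow_def lookup_add power_add prod.distrib)

lemma epow_0 [simp]: "epow n 0 = 1"
  by (simp add: epow_def)

lemma sact_epow: "i \<in> {1..<n} \<Longrightarrow> sact i (epow n k) = epow n k"
  unfolding epow_def perm_act_prod perm_act_power by (simp only: perm_act_elem[OF s_permutes])

text \<open>The factors of \<open>xI I * epow n k\<close> are indexed by the pairs \<open>(j, t)\<close> in \<open>slots n I k\<close>: those with
  \<open>t < coef k j\<close> stand for a factor \<open>elem n j\<close>, and \<open>(j, coef k j)\<close> with \<open>j \<in> I\<close> stands for the factor
  \<open>x\<^sub>1 \<cdots> x\<^sub>j\<close> of \<open>xI I\<close>. A choice function \<open>g\<close> selects a monomial, i.e. a set, from each factor.\<close>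

definition slots :: "nat \<Rightarrow> nat set \<Rightarrow> (nat \<Rightarrow>\<^sub>0 nat) \<Rightarrow> (nat \<times> nat) set" where
  "slots n I k = (SIGMA j:{1..n}. {..<coef k j + of_bool (j \<in> I)})"

definition choices :: "nat \<Rightarrow> (nat \<Rightarrow>\<^sub>0 nat) \<Rightarrow> nat \<times> nat \<Rightarrow> nat set set" where
  "choices n k x = (if snd x = coef k (fst x) then {{1..fst x}} else {A. A \<subseteq> {1..n} \<and> card A = fst x})"

lemma finite_slots [simp]: "finite (slots n I k)"
  by (simp add: slots_def)

lemma finite_choices [simp]: "finite (choices n k x)"
  by (simp add: choices_def)

lemma xI_epow_expand:
  assumes "I \<subseteq> {1..n}"
  shows "xI I * epow n k = (\<Sum>g\<in>PiE (slots n I k) (choices n k). mono1 (\<Sum>x\<in>slots n I k. ind (g x)))"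
proof -
  let ?F = "\<lambda>x. \<Sum>A\<in>choices n k x. (mono1 (ind A) :: 'a mpoly)"
  have slot: "(\<Prod>t<coef k j + of_bool (j \<in> I). ?F (j, t)) = (if j \<in> I then mono1 (ind {1..j}) else 1) * elem n j ^ coef k j" for j
  proof -
    have "(\<Prod>t<coef k j. ?F (j, t)) = (\<Prod>t<coef k j. elem n j)"
      by (intro prod.cong) (auto simp: choices_def elem_def)
    then show ?thesis by (simp add: choices_def)
  qed
  have "xI I = (\<Prod>j\<in>{1..n}. if j \<in> I then mono1 (ind {1..j}) else (1 :: 'a mpoly))"
    unfolding xI_eq mono1_sum using assms by (simp add: prod.If_cases Int_absorb1)
  then have "xI I * epow n k = (\<Prod>j\<in>{1..n}. \<Prod>t<coef k j + of_bool (j \<in> I). ?F (j, t))"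
    unfolding epow_def slot prod.distrib by simp
  also have "\<dots> = (\<Prod>x\<in>slots n I k. ?F x)"
    unfolding slots_def by (subst prod.Sigma) auto
  also have "\<dots> = (\<Sum>g\<in>PiE (slots n I k) (choices n k). \<Prod>x\<in>slots n I k. mono1 (ind (g x)))"
    by (rule prod_sum_PiE) auto
  finally show ?thesis by (simp only: mono1_sum)
qed

section \<open>Weights of exponents and extremal families of sets\<close>

definition wt :: "(nat \<Rightarrow>\<^sub>0 nat) \<Rightarrow> nat" where
  "wt m = (\<Sum>j\<in>supp m. j * coef m j)"

lemma wt_superset: "finite A \<Longrightarrow> supp m \<subseteq> A \<Longrightarrow> wt m = (\<Sum>j\<in>A. j * coef m j)"
  unfolding wt_def by (rule sum.mono_neutral_left) (auto simp: in_keys_iff)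

lemma wt_add: "wt (a + b) = wt a + wt b"
  using keys_add[of a b]
  by (simp add: wt_superset[of "supp a \<union> supp b"] lookup_add algebra_simps sum.distrib)

lemma wt_0 [simp]: "wt 0 = 0"
  by (simp add: wt_def)

lemma wt_sum: "wt (\<Sum>x\<in>A. g x) = (\<Sum>x\<in>A. wt (g x))"
  by (induction A rule: infinite_finite_induct) (auto simp: wt_add)

lemma wt_mon_perm_ind: "wt (mon_perm w (ind A)) = (\<Sum>j\<in>A. w j)"
  by (simp add: ind_def mon_perm_sum wt_sum) (simp add: wt_def)

text \<open>In the monomial order a larger weight means a smaller monomial, so descending chains of
  constant norm stop only because the weight is bounded above.\<close>

lemma wt_le_nrm: "m \<in> mons n \<Longrightarrow> wt m \<le> n * nrm m"
  unfolding wt_def nrm_def sum_distrib_left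
  by (intro sum_mono mult_mono) (auto simp: mons_def power2_eq_square)

lemma nrm_sum_ind:
  assumes "finite S" "\<And>x. x \<in> S \<Longrightarrow> G x \<subseteq> {1..n}"
  shows "nrm (\<Sum>x\<in>S. ind (G x)) = (\<Sum>x\<in>S. \<Sum>y\<in>S. card (G x \<inter> G y))"
proof -
  have fin: "finite (G x)" if "x \<in> S" for x
    using assms(2)[OF that] finite_subset by blast
  have "(\<Sum>x\<in>S. ind (G x)) \<in> mons n"
    using assms by (intro mons_sum ind_mons)
  then have "nrm (\<Sum>x\<in>S. ind (G x)) = (\<Sum>j\<in>{1..n}. (\<Sum>x\<in>S. of_bool (j \<in> G x))\<^sup>2)"
    using fin by (simp add: nrm_superset[of "{1..n}"] mons_def lookup_sum coef_ind)
  also have "\<dots> = (\<Sum>j\<in>{1..n}. \<Sum>x\<in>S. \<Sum>y\<in>S. of_bool (j \<in> G x \<inter> G y))"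
    by (simp add: power2_eq_square sum_product of_bool_conj)
  also have "\<dots> = (\<Sum>x\<in>S. \<Sum>y\<in>S. \<Sum>j\<in>{1..n}. of_bool (j \<in> G x \<inter> G y))"
    by (subst sum.swap, rule sum.cong[OF refl], subst sum.swap) (rule refl)
  also have "\<dots> = (\<Sum>x\<in>S. \<Sum>y\<in>S. card (G x \<inter> G y))"
  proof (intro sum.cong refl)
    fix x y assume "x \<in> S" "y \<in> S"
    then have "{1..n} \<inter> (G x \<inter> G y) = G x \<inter> G y" using assms(2) by blast
    then show "(\<Sum>j\<in>{1..n}. of_bool (j \<in> G x \<inter> G y)) = card (G x \<inter> G y)"
      by (simp only: of_bool_def sum.If_cases[OF finite_atLeastAtMost] Collect_mem_eq) simp
  qed
  finally show ?thesis .
qed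

text \<open>By \<open>nrm_sum_ind\<close> the norm adds up the sizes of all pairwise intersections.
  Each is at most the smaller of the two cardinalities, a bound that nested sets attain; equality of
  the totals forces equality for every pair, hence a chain.\<close>

lemma nrm_le_initial:
  assumes "finite S" "\<And>x. x \<in> S \<Longrightarrow> G x \<subseteq> {1..n} \<and> card (G x) = h x"
  shows "nrm (\<Sum>x\<in>S. ind (G x)) \<le> nrm (\<Sum>x\<in>S. ind {1..h x})"
    and "nrm (\<Sum>x\<in>S. ind (G x)) = nrm (\<Sum>x\<in>S. ind {1..h x}) \<Longrightarrow> x \<in> S \<Longrightarrow> y \<in> S \<Longrightarrow> G x \<subseteq> G y \<or> G y \<subseteq> G x"
proof -
  have h: "h x \<le> n" if "x \<in> S" for x
    using assms(2)[OF that] card_mono[of "{1..n}" "G x"] by auto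
  have fin: "finite (G x)" if "x \<in> S" for x
    using assms(2)[OF that] finite_subset by blast
  have le: "card (G x \<inter> G y) \<le> card ({1..h x} \<inter> {1..h y})" if "x \<in> S" "y \<in> S" for x y
  proof -
    have "card (G x \<inter> G y) \<le> h x" "card (G x \<inter> G y) \<le> h y"
      using assms(2) that fin by (metis card_mono inf_le1 inf_le2)+
    then show ?thesis by simp
  qed
  have eqs: "nrm (\<Sum>x\<in>S. ind (G x)) = (\<Sum>x\<in>S. \<Sum>y\<in>S. card (G x \<inter> G y))"
    "nrm (\<Sum>x\<in>S. ind {1..h x}) = (\<Sum>x\<in>S. \<Sum>y\<in>S. card ({1..h x} \<inter> {1..h y}))"
    by (rule nrm_sum_ind[where n = n]; use assms h in force)+
  show "nrm (\<Sum>x\<in>S. ind (G x)) \<le> nrm (\<Sum>x\<in>S. ind {1..h x})"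
    unfolding eqs by (intro sum_mono le)
  assume eq: "nrm (\<Sum>x\<in>S. ind (G x)) = nrm (\<Sum>x\<in>S. ind {1..h x})" and xy: "x \<in> S" "y \<in> S"
  have "(\<Sum>y\<in>S. card (G x \<inter> G y)) = (\<Sum>y\<in>S. card ({1..h x} \<inter> {1..h y}))"
    by (rule sum_mono_inv[OF eq[unfolded eqs] _ xy(1) assms(1)]) (intro sum_mono le)
  then have "card (G x \<inter> G y) = card ({1..h x} \<inter> {1..h y})"
    by (rule sum_mono_inv[OF _ _ xy(2) assms(1)]) (intro le xy)
  then have "card (G x \<inter> G y) = card (G x) \<or> card (G x \<inter> G y) = card (G y)"
    using assms(2) xy by (auto simp: min_def)
  then have "G x \<inter> G y = G x \<or> G x \<inter> G y = G y"
    using fin xy by (metis card_subset_eq inf_le1 inf_le2)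
  then show "G x \<subseteq> G y \<or> G y \<subseteq> G x" by blast
qed

lemma Invs_desc_between:
  assumes "(p, q) \<in> Invs n w"
  obtains i where "i \<in> desc n w" "p \<le> i" "i < q"
proof -
  have "\<exists>i\<in>desc n w. p \<le> i \<and> i < q"
  proof (rule ccontr)
    assume no: "\<not> ?thesis"
    have "w p \<le> w (p + d)" if "p + d \<le> q" for d
      using that
    proof (induction d)
      case (Suc d)
      then have "p + d \<notin> desc n w" using no by auto
      then have "w (p + d) \<le> w (Suc (p + d))"
        using Suc.prems assms by (auto simp: mem_desc Invs_def)
      then show ?case using Suc by simp
    qed simp
    from this[of "q - p"] show False using assms by (auto simp: Invs_def)
  qed
  then show thesis using that by blast
qed

text \<open>Exchanging the elements of \<open>{1..k} - A\<close> for those of \<open>A - {1..k}\<close> increases the values of \<open>w\<close>,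
  because \<open>A\<close> does not cut the intervals between descents.\<close>

lemma sum_initial_minimal:
  assumes "A \<subseteq> {1..n}" "card A = k" "A \<noteq> {1..k}" "w \<in> Sn n"
    and comparable: "\<And>i. i \<in> desc n w \<Longrightarrow> A \<subseteq> {1..i} \<or> {1..i} \<subseteq> A"
  shows "(\<Sum>j\<in>{1..k}. w j) < (\<Sum>j\<in>A. w j)"
proof -
  have fin: "finite A" using assms(1) finite_subset by blast
  let ?P = "{1..k} - A" and ?Q = "A - {1..k}"
  have less: "w p < w q" if "p \<in> ?P" "q \<in> ?Q" for p q
  proof (rule ccontr)
    assume "\<not> w p < w q"
    moreover have "p < q" using that assms(1) by auto
    moreover have "w p \<noteq> w q" using \<open>p < q\<close> Sn_eq_iff[OF assms(4)] by simp
    ultimately have "(p, q) \<in> Invs n w" using that assms(1) by (auto simp: Invs_def)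
    then obtain i where i: "i \<in> desc n w" "p \<le> i" "i < q" by (rule Invs_desc_between)
    then have "{1..i} \<subseteq> A" using comparable[OF i(1)] that by auto
    then show False using that i by auto
  qed
  have cards: "card ?P = card ?Q"
    using fin assms(2) by (simp add: card_Diff_subset_Int Int_commute)
  have "?P \<noteq> {}"
  proof
    assume "?P = {}"
    then have "{1..k} \<subseteq> A" by auto
    then show False using assms(2,3) fin by (metis card_atLeastAtMost card_subset_eq diff_Suc_1)
  qed
  obtain h where h: "bij_betw h ?P ?Q"
    using cards fin by (metis finite_Diff finite_atLeastAtMost finite_same_card_bij)
  have "(\<Sum>j\<in>?P. w j) < (\<Sum>j\<in>?P. w (h j))"
    using \<open>?P \<noteq> {}\<close> h by (intro sum_strict_mono less) (auto simp: bij_betw_def)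
  also have "\<dots> = (\<Sum>j\<in>?Q. w j)"
    by (rule sum.reindex_bij_betw[OF h])
  finally have "(\<Sum>j\<in>?P. w j) + (\<Sum>j\<in>{1..k} \<inter> A. w j) < (\<Sum>j\<in>?Q. w j) + (\<Sum>j\<in>{1..k} \<inter> A. w j)"
    by simp
  moreover have "(\<Sum>j\<in>{1..k}. w j) = (\<Sum>j\<in>?P. w j) + (\<Sum>j\<in>{1..k} \<inter> A. w j)"
    by (subst add.commute, rule sum.Int_Diff) simp
  moreover have "(\<Sum>j\<in>A. w j) = (\<Sum>j\<in>?Q. w j) + (\<Sum>j\<in>{1..k} \<inter> A. w j)"
    by (subst add.commute, subst Int_commute, rule sum.Int_Diff) (rule fin)
  ultimately show ?thesis by simp
qed

definition smaller :: "(nat \<Rightarrow>\<^sub>0 nat) \<Rightarrow> 'a::field mpoly set" where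
  "smaller c = {f. supp f \<subseteq> {m. nrm m < nrm c \<or> nrm m = nrm c \<and> wt c < wt m}}"

lemma subspace_smaller: "pm.subspace (smaller c)"
  unfolding smaller_def by (rule subspace_supp)

lemma low_smaller: "low (nrm c) \<subseteq> smaller c"
  by (auto simp: low_def smaller_def)

text \<open>As a Young diagram this partition has one column of length \<open>j\<close> for each
  slot \<open>(j, t)\<close>, so its conjugate has the part \<open>j\<close> with multiplicity
  \<open>coef k j + of_bool (j \<in> I)\<close>.\<close>

definition lam :: "nat \<Rightarrow> nat set \<Rightarrow> (nat \<Rightarrow>\<^sub>0 nat) \<Rightarrow> (nat \<Rightarrow>\<^sub>0 nat)" where
  "lam n I k = (\<Sum>x\<in>slots n I k. ind {1..fst x})"

definition lexp :: "nat \<Rightarrow> (nat \<Rightarrow> nat) \<Rightarrow> (nat \<Rightarrow>\<^sub>0 nat) \<Rightarrow> (nat \<Rightarrow>\<^sub>0 nat)" where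
  "lexp n w k = mon_perm w (lam n (desc n w) k)"

text \<open>The symmetric factor passes through \<open>pibar_w\<close>, so the operator may be
  applied to each monomial of \<open>xI ?I * epow n k\<close>. Choices of non-maximal norm stay low.
  The others form chains with the initial segments of the descents; their leading terms are permuted
  by \<open>w\<close>, and the weight singles out the choice \<open>g0\<close> of initial
  segments.\<close>

theorem bvec_epow_leading:
  assumes w: "w \<in> Sn n"
  shows "bvec n w * epow n k - mono1 (lexp n w k) \<in> (smaller (lexp n w k) :: 'a::field mpoly set)"
proof -
  let ?I = "desc n w"
  let ?S = "slots n ?I k"
  let ?X = "PiE ?S (choices n k)"
  define a where "a g = (\<Sum>x\<in>?S. ind (g x))" for g
  define g0 where "g0 = restrict (\<lambda>x. {1..fst x}) ?S"
  let ?c = "lexp n w k"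
  have I: "?I \<subseteq> {1..n}" using desc_subset[of n w] by auto
  have finX: "finite ?X" by (intro finite_PiE) auto
  have S: "fst x \<le> n" if "x \<in> ?S" for x using that by (auto simp: slots_def)
  have g0: "g0 \<in> ?X" using S by (auto simp: g0_def choices_def)
  have a0: "a g0 = lam n ?I k" by (simp add: a_def g0_def lam_def)
  have c: "?c = mon_perm w (a g0)" by (simp add: lexp_def a0)
  have nc: "nrm ?c = nrm (a g0)" unfolding c by (rule nrm_mon_perm[OF Sn_bij[OF w]])
  have gx: "g x \<subseteq> {1..n} \<and> card (g x) = fst x" if "g \<in> ?X" "x \<in> ?S" for g x
    using PiE_mem[OF that] S[OF that(2)] by (auto simp: choices_def split: if_splits)
  have slot_I: "(i, coef k i) \<in> ?S" if "i \<in> ?I" for i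
    using that I by (auto simp: slots_def)
  have g_I: "g (i, coef k i) = {1..i}" if "g \<in> ?X" "i \<in> ?I" for g i
    using PiE_mem[OF that(1) slot_I[OF that(2)]] by (simp add: choices_def)
  have le: "nrm (a g) \<le> nrm (a g0)" if "g \<in> ?X" for g
    using nrm_le_initial(1)[of ?S g n fst] gx[OF that] by (simp add: a0 lam_def a_def[of g])
  have chain: "g x \<subseteq> {1..i} \<or> {1..i} \<subseteq> g x" if "g \<in> ?X" "nrm (a g) = nrm (a g0)" "x \<in> ?S" "i \<in> ?I" for g x i
    using nrm_le_initial(2)[of ?S g n fst x "(i, coef k i)"] gx[OF that(1)] that slot_I[OF that(4)] g_I[OF that(1,4)]
    by (simp add: a0 lam_def a_def[of g])
  have lead: "pibar_w n w (mono1 (a g)) - mono1 (mon_perm w (a g)) \<in> (low (nrm ?c) :: 'a mpoly set)"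
    if g: "g \<in> ?X" "nrm (a g) = nrm (a g0)" for g
    unfolding nc g(2)[symmetric]
  proof (rule pibar_w_mono1_leading[OF w])
    fix p q assume pq: "(p, q) \<in> Invs n w"
    then obtain i where i: "i \<in> ?I" "p \<le> i" "i < q" by (rule Invs_desc_between)
    have fin: "finite (g x)" if "x \<in> ?S" for x
      using gx[OF g(1) that] finite_subset by blast
    have p: "1 \<le> p" using pq by (simp add: Invs_def)
    \<comment> \<open>Every chosen set either lies in \<open>{1..i}\<close> and misses
      \<open>q\<close>, or contains \<open>{1..i}\<close> and hence \<open>p\<close>. The factor of
      \<open>xI ?I\<close> belonging to \<open>i\<close> makes the inequality strict.\<close>
    have "(\<Sum>x\<in>?S. coef (ind (g x)) q) < (\<Sum>x\<in>?S. coef (ind (g x)) p)"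
    proof (rule sum_strict_mono_ex1)
      show "\<forall>x\<in>?S. coef (ind (g x)) q \<le> coef (ind (g x)) p"
      proof
        fix x assume x: "x \<in> ?S"
        show "coef (ind (g x)) q \<le> coef (ind (g x)) p"
          using chain[OF g x i(1)] i p fin[OF x] by (auto simp: coef_ind)
      qed
      show "\<exists>x\<in>?S. coef (ind (g x)) q < coef (ind (g x)) p"
        using slot_I[OF i(1)] g_I[OF g(1) i(1)] i p by (auto simp: coef_ind intro!: bexI[of _ "(i, coef k i)"])
    qed simp
    then show "coef (a g) q < coef (a g) p" by (simp add: a_def lookup_sum)
  qed
  have other: "pibar_w n w (mono1 (a g)) \<in> (smaller ?c :: 'a mpoly set)" if g: "g \<in> ?X" "g \<noteq> g0" for g
  proof (cases "nrm (a g) = nrm (a g0)")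
    case False
    then have "mono1 (a g) \<in> (low (nrm ?c) :: 'a mpoly set)"
      using le[OF g(1)] nc by (intro low_mono1) simp
    then show ?thesis using pibar_w_low low_smaller by blast
  next
    case True
    obtain x where x: "x \<in> ?S" "g x \<noteq> g0 x"
      using g g0 by (metis PiE_ext)
    \<comment> \<open>The weight after permuting is the sum of \<open>w j\<close> over all chosen
      sets, so replacing an initial segment by another admissible set of the same size raises
      it.\<close>
    have sums: "(\<Sum>j\<in>{1..fst y}. w j) < (\<Sum>j\<in>g y. w j)" if "y \<in> ?S" "g y \<noteq> {1..fst y}" for y
      using gx[OF g(1) that(1)] that(2) chain[OF g(1) True that(1)] by (intro sum_initial_minimal[OF _ _ _ w]) auto
    have "(\<Sum>y\<in>?S. \<Sum>j\<in>{1..fst y}. w j) < (\<Sum>y\<in>?S. \<Sum>j\<in>g y. w j)"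
    proof (rule sum_strict_mono_ex1)
      show "\<forall>y\<in>?S. (\<Sum>j\<in>{1..fst y}. w j) \<le> (\<Sum>j\<in>g y. w j)"
        using sums by (metis less_imp_le order_refl)
      show "\<exists>y\<in>?S. (\<Sum>j\<in>{1..fst y}. w j) < (\<Sum>j\<in>g y. w j)"
        using sums[OF x(1)] x by (auto simp: g0_def)
    qed simp
    then have "wt ?c < wt (mon_perm w (a g))"
      by (simp add: c a_def g0_def mon_perm_sum wt_sum wt_mon_perm_ind)
    moreover have "nrm (mon_perm w (a g)) = nrm ?c"
      using True nc nrm_mon_perm[OF Sn_bij[OF w]] by simp
    ultimately have "mono1 (mon_perm w (a g)) \<in> (smaller ?c :: 'a mpoly set)"
      by (simp add: smaller_def)
    then have "(pibar_w n w (mono1 (a g)) - mono1 (mon_perm w (a g))) + mono1 (mon_perm w (a g)) \<in> (smaller ?c :: 'a mpoly set)"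
      using lead[OF g(1) True] low_smaller by (intro pm.subspace_add[OF subspace_smaller]) auto
    then show ?thesis by simp
  qed
  have "bvec n w * epow n k = pibar_w n w (xI ?I * epow n k :: 'a mpoly)"
    unfolding bvec_def by (rule pibar_w_invariant_factor[OF w sact_epow, symmetric])
  also have "\<dots> = (\<Sum>g\<in>?X. pibar_w n w (mono1 (a g)))"
    unfolding xI_epow_expand[OF I] module_hom.sum[OF lin_pibar_w] a_def ..
  also have "\<dots> = pibar_w n w (mono1 (a g0)) + (\<Sum>g\<in>?X - {g0}. pibar_w n w (mono1 (a g)))"
    by (rule sum.remove[OF finX g0])
  finally have "(bvec n w * epow n k - mono1 ?c :: 'a mpoly) = (pibar_w n w (mono1 (a g0)) - mono1 (mon_perm w (a g0)))
      + (\<Sum>g\<in>?X - {g0}. pibar_w n w (mono1 (a g)))"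
    by (simp add: c)
  also have "\<dots> \<in> (smaller ?c :: 'a mpoly set)"
    using lead[OF g0 refl] low_smaller other
    by (intro pm.subspace_add[OF subspace_smaller] pm.subspace_sum[OF subspace_smaller]) auto
  finally show ?thesis .
qed

section \<open>A basis of the polynomial ring\<close>

lemma lam_mons: "lam n I k \<in> mons n"
  unfolding lam_def by (intro mons_sum ind_mons) (auto simp: slots_def)

lemma coef_lam:
  assumes "1 \<le> j"
  shows "coef (lam n I k) j = (\<Sum>i\<in>{j..n}. coef k i + of_bool (i \<in> I))"
proof -
  have "coef (lam n I k) j = (\<Sum>x\<in>slots n I k. of_bool (j \<le> fst x))"
    using assms by (simp add: lam_def lookup_sum coef_ind)
  also have "\<dots> = (\<Sum>i\<in>{1..n}. \<Sum>t<coef k i + of_bool (i \<in> I). of_bool (j \<le> i))"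
    unfolding slots_def by (subst sum.Sigma) (auto simp: case_prod_unfold)
  also have "\<dots> = (\<Sum>i\<in>{1..n}. if i \<in> {j..n} then coef k i + of_bool (i \<in> I) else 0)"
    by (intro sum.cong) auto
  also have "\<dots> = (\<Sum>i\<in>{1..n} \<inter> {j..n}. coef k i + of_bool (i \<in> I))"
    by (simp only: sum.inter_restrict[OF finite_atLeastAtMost])
  also have "{1..n} \<inter> {j..n} = {j..n}" using assms by auto
  finally show ?thesis .
qed

lemma coef_lam_Suc:
  assumes "1 \<le> i" "i \<le> n"
  shows "coef (lam n I k) i = coef k i + of_bool (i \<in> I) + coef (lam n I k) (Suc i)"
  using assms by (simp add: coef_lam sum.atLeast_Suc_atMost)

lemma coef_lam_antimono: "1 \<le> p \<Longrightarrow> p \<le> q \<Longrightarrow> coef (lam n I k) q \<le> coef (lam n I k) p"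
  by (simp add: coef_lam sum_mono2)

lemma coef_lam_strict:
  assumes "1 \<le> p" "p \<le> i" "i < q" "i \<in> I" "i \<le> n"
  shows "coef (lam n I k) q < coef (lam n I k) p"
proof -
  have "coef (lam n I k) q \<le> coef (lam n I k) (Suc i)" "coef (lam n I k) i \<le> coef (lam n I k) p"
    using assms by (auto intro: coef_lam_antimono)
  moreover have "coef (lam n I k) (Suc i) < coef (lam n I k) i"
    using assms coef_lam_Suc[of i n I k] by simp
  ultimately show ?thesis by linarith
qed

text \<open>The permutation \<open>w\<close> can be read off from \<open>lexp n w k\<close>: it is the stable sorting permutation.\<close>

lemma Invs_inv_lexp:
  assumes w: "w \<in> Sn n"
  shows "Invs n (inv w) = {(a, b). 1 \<le> a \<and> a < b \<and> b \<le> n \<and> coef (lexp n w k) a < coef (lexp n w k) b}"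
proof -
  let ?l = "lam n (desc n w) k"
  have "inv w b < inv w a \<longleftrightarrow> coef (lexp n w k) a < coef (lexp n w k) b" if ab: "1 \<le> a" "a < b" "b \<le> n" for a b
  proof -
    define p q where "p = inv w a" and "q = inv w b"
    have wpq: "w p = a" "w q = b" using Sn_inv_eq[OF w] by (auto simp: p_def q_def)
    then have range: "1 \<le> p" "p \<le> n" "1 \<le> q" "q \<le> n"
      using Sn_range[OF w, of p] Sn_range[OF w, of q] ab by auto
    have c: "coef (lexp n w k) a = coef ?l p" "coef (lexp n w k) b = coef ?l q"
      unfolding lexp_def wpq[symmetric] by (rule coef_mon_perm[OF Sn_bij[OF w]])+
    show ?thesis
    proof (cases "q < p")
      case True
      then have "(q, p) \<in> Invs n w" using range ab wpq by (simp add: Invs_def)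
      then obtain i where i: "i \<in> desc n w" "q \<le> i" "i < p" by (rule Invs_desc_between)
      then have "coef ?l p < coef ?l q"
        using range by (intro coef_lam_strict[OF range(3) i(2,3,1)]) simp
      then show ?thesis using True by (simp add: c flip: p_def q_def)
    next
      case False
      then have "coef ?l q \<le> coef ?l p" using range by (intro coef_lam_antimono) auto
      then show ?thesis using False by (simp add: c flip: p_def q_def)
    qed
  qed
  then show ?thesis unfolding Invs_def by auto
qed

text \<open>Once \<open>w\<close> is recovered from the comparisons of exponents, \<open>lam\<close>
  is known, and its consecutive differences minus the indicator of the descent set give
  \<open>k\<close>.\<close>

lemma lexp_inj: "inj_on (\<lambda>(w, k). lexp n w k) (Sn n \<times> mons n)"
proof (rule inj_onI, clarify)
  fix w k w' k'
  assume w: "w \<in> Sn n" and w': "w' \<in> Sn n" and k: "k \<in> mons n" and k': "k' \<in> mons n"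
    and eq: "lexp n w k = lexp n w' k'"
  have "Invs n (inv w) = Invs n (inv w')"
    using Invs_inv_lexp[OF w, of k] Invs_inv_lexp[OF w', of k'] eq by simp
  then have "inv w = inv w'"
    by (rule Invs_eqD[OF Sn_inv[OF w] Sn_inv[OF w']])
  then have ww: "w = w'"
    using Sn_bij[OF w] Sn_bij[OF w'] by (metis inv_inv_eq)
  have lam: "coef (lam n (desc n w) k) j = coef (lam n (desc n w) k') j" for j
    using eq coef_mon_perm[OF Sn_bij[OF w]] unfolding lexp_def ww by metis
  have "coef k i = coef k' i" for i
  proof (cases "1 \<le> i \<and> i \<le> n")
    case True
    then show ?thesis
      using coef_lam_Suc[of i n "desc n w" k] coef_lam_Suc[of i n "desc n w" k'] lam by simp
  next
    case False
    then have "i \<notin> supp k" "i \<notin> supp k'" using k k' by (auto simp: mons_def)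
    then show ?thesis by (simp add: in_keys_iff)
  qed
  then show "w = w' \<and> k = k'" using ww by (simp add: poly_mapping_eqI)
qed

text \<open>\<open>v a\<close> is the rank of \<open>a\<close> when positions are ordered by
  decreasing exponent with ties broken by position. Stability of the sorting means that ties create
  no inversion.\<close>

lemma ex_sorting_perm:
  obtains v where "v \<in> Sn n"
    "\<And>a b. 1 \<le> a \<Longrightarrow> a < b \<Longrightarrow> b \<le> n \<Longrightarrow> v b < v a \<longleftrightarrow> coef c a < (coef c b :: nat)"
proof -
  define before where "before b a \<longleftrightarrow> coef c a < coef c b \<or> coef c b = coef c a \<and> b < a" for a b
  define B where "B a = {b \<in> {1..n}. before b a}" for a
  define v where "v a = (if a \<in> {1..n} then Suc (card (B a)) else a)" for a
  have less: "v a < v b" if "a \<in> {1..n}" "b \<in> {1..n}" "before a b" for a b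
  proof -
    have "B a \<subset> B b" using that by (auto simp: B_def before_def)
    moreover have "finite (B b)" by (simp add: B_def)
    ultimately have "card (B a) < card (B b)" by (rule psubset_card_mono[rotated])
    then show ?thesis using that by (simp add: v_def)
  qed
  have total: "before a b \<or> before b a" if "a \<noteq> b" for a b
    using that by (auto simp: before_def)
  have "inj_on v {1..n}"
    by (rule inj_onI) (metis less total less_irrefl)
  moreover have "v ` {1..n} \<subseteq> {1..n}"
  proof
    fix x assume "x \<in> v ` {1..n}"
    then obtain a where a: "a \<in> {1..n}" "x = v a" by auto
    have "B a \<subseteq> {1..n} - {a}" by (auto simp: B_def before_def)
    then have "card (B a) \<le> card ({1..n} - {a})" by (intro card_mono) auto
    then show "x \<in> {1..n}" using a by (auto simp: v_def)
  qed
  ultimately have "bij_betw v {1..n} {1..n}"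
    using endo_inj_surj[of "{1..n}" v] by (simp add: bij_betw_def)
  then have "v permutes {1..n}"
    by (rule bij_imp_permutes) (auto simp: v_def)
  moreover have "v b < v a \<longleftrightarrow> coef c a < coef c b" if "1 \<le> a" "a < b" "b \<le> n" for a b
  proof (cases "coef c a < coef c b")
    case True
    then show ?thesis using less[of b a] that by (simp add: before_def)
  next
    case False
    then have "before a b" using that by (auto simp: before_def)
    then show ?thesis using less[of a b] that False by simp
  qed
  ultimately show thesis using that by (simp add: Sn_def)
qed

lemma lexp_surj:
  assumes c: "c \<in> mons n"
  obtains w k where "w \<in> Sn n" "k \<in> mons n" "lexp n w k = c"
proof -
  obtain v where v: "v \<in> Sn n"
    and sorts: "\<And>a b. 1 \<le> a \<Longrightarrow> a < b \<Longrightarrow> b \<le> n \<Longrightarrow> v b < v a \<longleftrightarrow> coef c a < coef c b"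
    using ex_sorting_perm[of n c] by blast
  define w where "w = inv v"
  have w: "w \<in> Sn n" unfolding w_def by (rule Sn_inv[OF v])
  define l where "l = mon_perm v c"
  have vw: "v (w j) = j" "w (v j) = j" for j
    using Sn_bij[OF v] by (simp_all add: w_def bij_is_inj bij_is_surj surj_f_inv_f)
  have l: "coef l j = coef c (w j)" for j
    using coef_mon_perm[OF Sn_bij[OF v], of c "w j"] by (simp add: l_def vw)
  have l_mons: "l \<in> mons n"
    unfolding l_def using v c by (intro mons_mon_perm) (simp_all add: Sn_def)
  \<comment> \<open>This keeps the subtractions defining \<open>k\<close> below from being
    truncated. At a descent of \<open>w\<close> the sorted exponents drop strictly, since equal ones
    would have kept their order.\<close>
  have step: "coef l (Suc j) + of_bool (j \<in> desc n w) \<le> coef l j" if j: "1 \<le> j" "j \<le> n" for j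
  proof (cases "j = n")
    case True
    then have "Suc j \<notin> supp l" using l_mons by (auto simp: mons_def)
    then show ?thesis using True by (simp add: in_keys_iff mem_desc)
  next
    case False
    have range: "1 \<le> w j" "w j \<le> n" "1 \<le> w (Suc j)" "w (Suc j) \<le> n"
      using Sn_range[OF w, of j] Sn_range[OF w, of "Suc j"] j False by auto
    show ?thesis
    proof (cases "w (Suc j) < w j")
      case True
      then show ?thesis using sorts[OF range(3) True range(2)] vw j False by (simp add: l mem_desc)
    next
      case nd: False
      then have "w j < w (Suc j)" using Sn_eq_iff[OF w, of j "Suc j"] by simp
      then show ?thesis using sorts[OF range(1) _ range(4)] vw nd by (simp add: l mem_desc)
    qed
  qed
  define k where "k = (\<Sum>j\<in>{1..n}. Poly_Mapping.single j (coef l j - coef l (Suc j) - of_bool (j \<in> desc n w)))"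
  have k: "coef k j = coef l j - coef l (Suc j) - of_bool (j \<in> desc n w)" if "1 \<le> j" "j \<le> n" for j
    using that by (simp add: k_def lookup_sum lookup_single when_def)
  have k_mons: "k \<in> mons n"
    unfolding k_def by (intro mons_sum) (auto simp: mons_def)
  have "coef (lam n (desc n w) k) j = coef l j" if "1 \<le> j" "j \<le> Suc n" for j
    using that(2,1)
  proof (induction rule: inc_induct)
    case base
    have "Suc n \<notin> supp l" using l_mons by (auto simp: mons_def)
    then show ?case by (simp add: coef_lam in_keys_iff)
  next
    case (step j)
    then show ?case using coef_lam_Suc[of j n "desc n w" k] k[of j] \<open>\<And>j. 1 \<le> j \<Longrightarrow> j \<le> n \<Longrightarrow> _ \<le> coef l j\<close>[of j] by simp
  qed
  moreover have "coef (lam n (desc n w) k) j = coef l j" if "\<not> (1 \<le> j \<and> j \<le> Suc n)" for j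
  proof -
    have "j \<notin> supp l" "j \<notin> supp (lam n (desc n w) k)"
      using that l_mons lam_mons[of n "desc n w" k] by (auto simp: mons_def)
    then show ?thesis by (simp add: in_keys_iff)
  qed
  ultimately have "lam n (desc n w) k = l" by (metis poly_mapping_eqI)
  then have "lexp n w k = mon_perm (w \<circ> v) c"
    by (simp only: lexp_def l_def mon_perm_compose)
  also have "w \<circ> v = id" using vw by (simp add: fun_eq_iff)
  finally have "lexp n w k = c" by (simp only: mon_perm_id)
  then show thesis using that w k_mons by blast
qed

lemma polys_subset_span:
  "(polys n :: 'a::field mpoly set) \<subseteq> pm.span ((\<lambda>(w, k). bvec n w * epow n k) ` (Sn n \<times> mons n))" (is "_ \<subseteq> pm.span ?B")
proof -
  \<comment> \<open>The difference \<open>n * nrm m - wt m\<close> converts growing weight at fixed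
    norm into a decreasing natural number; \<open>wt_le_nrm\<close> ensures that the subtraction is
    exact.\<close>
  define R where "R = inv_image (less_than <*lex*> less_than) (\<lambda>m. (nrm m, n * nrm m - wt m))"
  have "wf R" by (simp add: R_def wf_lex_prod)
  then have mono: "m \<in> mons n \<longrightarrow> mono1 m \<in> pm.span ?B" for m
  proof (induction m rule: wf_induct_rule)
    case (less m)
    show ?case
    proof
      assume m: "m \<in> mons n"
      obtain w k where wk: "w \<in> Sn n" "k \<in> mons n" "lexp n w k = m"
        using lexp_surj[OF m] .
      let ?r = "bvec n w * epow n k - mono1 m :: 'a mpoly"
      have r: "?r \<in> smaller m" using bvec_epow_leading[OF wk(1), of k] wk(3) by simp
      have rp: "?r \<in> polys n"
        using wk m by (intro pm.subspace_diff subspace_polys polys_mult bvec_polys epow_polys polys_mono1)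
      have "(\<Sum>m'\<in>supp ?r. sc (coef ?r m') (mono1 m')) \<in> pm.span ?B"
      proof (intro pm.span_sum pm.span_scale)
        fix m' assume m': "m' \<in> supp ?r"
        have "m' \<in> mons n" using rp m' by (auto simp: polys_eq)
        moreover have "(m', m) \<in> R"
        proof -
          have "nrm m' < nrm m \<or> nrm m' = nrm m \<and> wt m < wt m'"
            using r m' by (auto simp: smaller_def)
          then show ?thesis
            using wt_le_nrm[OF \<open>m' \<in> mons n\<close>] by (auto simp: R_def intro: diff_less_mono2)
        qed
        ultimately show "mono1 m' \<in> pm.span ?B" using less by blast
      qed
      then have "?r \<in> pm.span ?B" by (simp only: flip: poly_mapping_expand)
      moreover have "bvec n w * epow n k \<in> pm.span ?B"
        using wk by (intro pm.span_base) force
      ultimately have "bvec n w * epow n k - ?r \<in> pm.span ?B"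
        by (rule pm.span_diff[rotated])
      then show "mono1 m \<in> pm.span ?B" by simp
    qed
  qed
  then show ?thesis
    unfolding polys_span by (intro pm.span_minimal pm.subspace_span) auto
qed

lemma smaller_asym: "m \<in> supp f \<Longrightarrow> f \<in> smaller c \<Longrightarrow> nrm m < nrm c \<or> nrm m = nrm c \<and> wt c < wt m"
  by (auto simp: smaller_def)

text \<open>Choose a term \<open>z\<close> of maximal norm and, among these, of minimal weight.
  Other leading monomials may share both values but differ from that of \<open>z\<close> by
  \<open>lexp_inj\<close>, and all remainders are strictly smaller; so only \<open>z\<close>
  contributes to its own leading coefficient.\<close>

lemma bvec_epow_independent:
  assumes G: "finite G" "G \<subseteq> Sn n \<times> mons n"
    and 0: "(\<Sum>x\<in>G. sc (c x) (bvec n (fst x) * epow n (snd x))) = (0 :: 'a::field mpoly)"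
    and x: "x \<in> G"
  shows "c x = 0"
proof (rule ccontr)
  assume nz: "c x \<noteq> 0"
  define L where "L x = lexp n (fst x) (snd x)" for x
  define F where "F x = (bvec n (fst x) * epow n (snd x) :: 'a mpoly)" for x
  define A where "A = {x \<in> G. c x \<noteq> 0}"
  have "x \<in> A" using x nz by (simp add: A_def)
  then have A: "finite A" "A \<noteq> {}" using finite_subset[of A G] G by (blast | simp add: A_def)+
  define A' where "A' = {x \<in> A. nrm (L x) = Max (nrm ` L ` A)}"
  have "Max (nrm ` L ` A) \<in> nrm ` L ` A" using A by (intro Max_in) auto
  then obtain y where "y \<in> A" "nrm (L y) = Max (nrm ` L ` A)" by (metis imageE)
  then have "y \<in> A'" by (simp add: A'_def)
  moreover have "A' \<subseteq> A" unfolding A'_def by blast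
  ultimately have A': "finite A'" "A' \<noteq> {}" using finite_subset A(1) by blast+
  have "Min (wt ` L ` A') \<in> wt ` L ` A'" using A' by (intro Min_in) auto
  then obtain z where z: "z \<in> A'" "wt (L z) = Min (wt ` L ` A')" by (metis imageE)
  have zA: "z \<in> A" using z by (simp add: A'_def)
  have max: "nrm (L y) < nrm (L z) \<or> nrm (L y) = nrm (L z) \<and> wt (L z) \<le> wt (L y)" if "y \<in> A" for y
  proof (cases "nrm (L y) = nrm (L z)")
    case True
    then have "y \<in> A'" using that z(1) by (simp add: A'_def)
    then show ?thesis using True z(2) A' by simp
  next
    case False
    have "nrm (L y) \<le> Max (nrm ` L ` A)" using that A by simp
    then show ?thesis using False z(1) by (simp add: A'_def)
  qed
  have lead: "F y - mono1 (L y) \<in> smaller (L y)" if "y \<in> G" for y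
    unfolding F_def L_def using that G by (intro bvec_epow_leading) auto
  have coef: "coef (F y) (L z) = of_bool (y = z)" if y: "y \<in> A" for y
  proof -
    have yG: "y \<in> G" "z \<in> G" using y zA by (auto simp: A_def)
    have "L z \<notin> supp (F y - mono1 (L y))"
      using smaller_asym[OF _ lead[OF yG(1)], of "L z"] max[OF y] by auto
    then have "coef (F y) (L z) = coef (mono1 (L y)) (L z)"
      by (simp add: in_keys_iff lookup_minus)
    moreover have "L y = L z \<longleftrightarrow> y = z"
      using inj_onD[OF lexp_inj, of n y z] yG G by (auto simp: L_def case_prod_unfold)
    ultimately show ?thesis by (simp add: lookup_single when_def)
  qed
  have "(\<Sum>x\<in>G. c x * coef (F x) (L z)) = coef (\<Sum>x\<in>G. sc (c x) (F x)) (L z)"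
    by (simp add: lookup_sum)
  also have "\<dots> = 0" using 0 by (simp add: F_def)
  also have "(\<Sum>x\<in>G. c x * coef (F x) (L z)) = (\<Sum>x\<in>A. c x * coef (F x) (L z))"
    unfolding A_def by (rule sum.mono_neutral_right) (use G in auto)
  also have "\<dots> = (\<Sum>x\<in>A. if x = z then c x else 0)"
    by (intro sum.cong) (auto simp: coef)
  also have "\<dots> = c z" using A zA by simp
  finally show False using zA by (simp add: A_def)
qed

text \<open>The expansion is padded with zeros to all of \<open>Sn n\<close> for each
  \<open>k\<close>, since \<open>pibar i\<close> mixes the permutations while leaving
  \<open>k\<close> fixed.\<close>

lemma polys_expand:
  assumes "f \<in> polys n"
  obtains G c where "finite G" "G \<subseteq> mons n" "f = (\<Sum>k\<in>G. \<Sum>w\<in>Sn n. sc (c w k) (bvec n w * epow n k))"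
proof -
  have "f \<in> pm.span ((\<lambda>x. bvec n (fst x) * epow n (snd x)) ` (Sn n \<times> mons n))"
    using assms polys_subset_span[of n] by (auto simp: case_prod_unfold)
  then obtain H d where H: "finite H" "H \<subseteq> Sn n \<times> mons n"
      and f: "f = (\<Sum>x\<in>H. sc (d x) (bvec n (fst x) * epow n (snd x)))"
    by (rule span_image_explicit)
  let ?d = "\<lambda>w k. if (w, k) \<in> H then d (w, k) else 0"
  have "f = (\<Sum>x\<in>Sn n \<times> snd ` H. sc (?d (fst x) (snd x)) (bvec n (fst x) * epow n (snd x)))"
    unfolding f by (rule sum.mono_neutral_cong_left) (use H in \<open>force+\<close>)
  also have "\<dots> = (\<Sum>w\<in>Sn n. \<Sum>k\<in>snd ` H. sc (?d w k) (bvec n w * epow n k))"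
    using H by (simp add: sum.cartesian_product case_prod_unfold)
  also have "\<dots> = (\<Sum>k\<in>snd ` H. \<Sum>w\<in>Sn n. sc (?d w k) (bvec n w * epow n k))"
    by (rule sum.swap)
  finally show thesis
    using H by (intro that[of "snd ` H" ?d]) auto
qed

lemma expansion_unique:
  assumes "finite G" "G \<subseteq> mons n"
    and 0: "(\<Sum>k\<in>G. \<Sum>w\<in>Sn n. sc (c w k) (bvec n w * epow n k)) = (0 :: 'a::field mpoly)"
    and "w \<in> Sn n" "k \<in> G"
  shows "c w k = 0"
proof -
  have "(\<Sum>x\<in>Sn n \<times> G. sc (c (fst x) (snd x)) (bvec n (fst x) * epow n (snd x)))
      = (\<Sum>w\<in>Sn n. \<Sum>k\<in>G. sc (c w k) (bvec n w * epow n k) :: 'a mpoly)"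
    using assms(1) by (simp add: sum.cartesian_product case_prod_unfold)
  also have "\<dots> = 0" using 0 by (subst sum.swap)
  finally show ?thesis
    using bvec_epow_independent[of "Sn n \<times> G" n "\<lambda>x. c (fst x) (snd x)" "(w, k)"] assms by auto
qed

section \<open>The coinvariant algebra\<close>

lemma coef_0_elem: "1 \<le> j \<Longrightarrow> coef (elem n j) 0 = 0"
proof -
  assume j: "1 \<le> j"
  have "ind A \<noteq> 0" if "A \<subseteq> {1..n}" "card A = j" for A
  proof
    assume "ind A = 0"
    have "A \<noteq> {}" using that j by auto
    then obtain a where a: "a \<in> A" by auto
    have "finite A" using that finite_subset by blast
    then have "coef (ind A) a = 1" using a by (simp add: coef_ind)
    then show False using \<open>ind A = 0\<close> by simp
  qed
  then show ?thesis
    unfolding elem_def lookup_sum by (intro sum.neutral) (auto simp: lookup_single when_def)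
qed

lemma elem_sym_plus: "1 \<le> j \<Longrightarrow> elem n j \<in> sym_plus n"
  by (simp add: sym_plus_def elem_polys perm_act_elem coef_0_elem)

lemma coinv_mult: "f \<in> coinv_ideal n \<Longrightarrow> g \<in> polys n \<Longrightarrow> g * f \<in> coinv_ideal n"
proof (induction rule: coinv_ideal.induct)
  case zero
  then show ?case by (simp add: coinv_ideal.zero)
next
  case (step f g' h)
  then show ?case
    using coinv_ideal.step[of f n "g * g'" "g * h"] by (simp add: polys_mult distrib_left mult.assoc)
qed

lemma subspace_coinv: "pm.subspace (coinv_ideal n :: 'a::field mpoly set)"
proof (rule pm.subspaceI)
  show "0 \<in> coinv_ideal n" by (rule coinv_ideal.zero)
next
  fix f g :: "'a mpoly" assume "f \<in> coinv_ideal n" "g \<in> coinv_ideal n"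
  then show "f + g \<in> coinv_ideal n"
    by (induction rule: coinv_ideal.induct) (auto simp: add.assoc intro: coinv_ideal.step)
next
  fix c and f :: "'a mpoly" assume "f \<in> coinv_ideal n"
  then have "sc c 1 * f \<in> coinv_ideal n"
    by (intro coinv_mult pm.subspace_scale[OF subspace_polys]) auto
  then show "sc c f \<in> coinv_ideal n" by (simp add: sc_mult_left)
qed

lemma epow_coinv:
  assumes "k \<in> mons n" "k \<noteq> 0"
  shows "epow n k \<in> (coinv_ideal n :: 'a::field mpoly set)"
proof -
  obtain j where j: "j \<in> supp k" using assms(2) by (metis equals0I keys_eq_empty)
  then have j1: "j \<in> {1..n}" using assms(1) by (auto simp: mons_def)
  have "coef k j \<noteq> 0" using j by (simp add: in_keys_iff)
  then obtain l where "coef k j = Suc l" by (cases "coef k j") auto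
  then have "epow n k = ((\<Prod>i\<in>{1..n} - {j}. elem n i ^ coef k i) * elem n j ^ l) * elem n j + (0 :: 'a mpoly)"
    unfolding epow_def using j1 by (simp add: prod.remove[of _ j] mult_ac)
  also have "\<dots> \<in> coinv_ideal n"
    using j1 by (intro coinv_ideal.step coinv_ideal.zero elem_sym_plus polys_mult polys_prod polys_power elem_polys) auto
  finally show ?thesis .
qed

text \<open>Collects the image of \<open>pibar i\<close> by target. Only targets with left descent
  \<open>i\<close> occur; each receives \<open>-1\<close> times its own coefficient and, if the
  descent set agrees, the coefficient of \<open>s i \<circ> w\<close>.\<close>

lemma sum_ascent_reindex:
  assumes i: "i \<in> {1..<n}"
  shows "(\<Sum>w\<in>Sn n. sc (d w) (pibar i (bvec n w) * e)) =
    (\<Sum>w\<in>Sn n. sc (if ldesc w i then - d w + (if desc n (s i \<circ> w) = desc n w then d (s i \<circ> w) else 0) else 0)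
       (bvec n w * (e :: 'a::field mpoly)))"
proof -
  define same where "same w \<longleftrightarrow> desc n (s i \<circ> w) = desc n w" for w
  have bij: "bij_betw (\<lambda>w. s i \<circ> w) (Sn n) (Sn n)"
    by (rule bij_betwI[where g = "\<lambda>w. s i \<circ> w"]) (auto simp: Sn_s_comp[OF i] simp del: o_apply)
  define up where "up w = (if \<not> ldesc w i \<and> same w then sc (d w) (bvec n (s i \<circ> w) * e) else 0)" for w
  define down where "down w = (if ldesc w i then sc (- d w) (bvec n w * e) else 0)" for w
  have "(\<Sum>w\<in>Sn n. sc (d w) (pibar i (bvec n w) * e)) = (\<Sum>w\<in>Sn n. down w) + (\<Sum>w\<in>Sn n. up w)"
    unfolding sum.distrib[symmetric]
    by (rule sum.cong) (auto simp: pibar_bvec[OF _ i] same_def up_def down_def simp del: o_apply)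
  also have "(\<Sum>w\<in>Sn n. up w) = (\<Sum>w\<in>Sn n. up (s i \<circ> w))"
    by (rule sum.reindex_bij_betw[OF bij, symmetric])
  also have "(\<Sum>w\<in>Sn n. down w) + (\<Sum>w\<in>Sn n. up (s i \<circ> w)) = (\<Sum>w\<in>Sn n. down w + up (s i \<circ> w))"
    by (rule sum.distrib[symmetric])
  also have "\<dots> = (\<Sum>w\<in>Sn n. sc (if ldesc w i then - d w + (if desc n (s i \<circ> w) = desc n w then d (s i \<circ> w) else 0) else 0)
       (bvec n w * e))"
  proof (rule sum.cong[OF refl])
    fix w assume w: "w \<in> Sn n"
    have "same (s i \<circ> w) \<longleftrightarrow> same w" unfolding same_def s_comp_s_comp by (rule eq_commute)
    then have "up (s i \<circ> w) = (if ldesc w i \<and> same w then sc (d (s i \<circ> w)) (bvec n w * e) else 0)"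
      by (simp only: up_def ldesc_s_comp[OF w] s_comp_s_comp not_not)
    then show "down w + up (s i \<circ> w) = sc (if ldesc w i then - d w + (if desc n (s i \<circ> w) = desc n w then d (s i \<circ> w) else 0) else 0)
       (bvec n w * e)"
      unfolding down_def same_def
      by (cases "ldesc w i"; cases "desc n (s i \<circ> w) = desc n w")
        (simp_all only: if_True if_False simp_thms pm.scale_left_distrib pm.scale_zero_left add_0_right)
  qed
  finally show ?thesis .
qed

text \<open>A symmetric polynomial is killed by all operators \<open>pibar i\<close>; comparing coefficients shows that
  in its expansion only the terms with \<open>w = id\<close> survive.\<close>

lemma symmetric_expand:
  fixes f :: "'a::field mpoly"
  assumes f: "f \<in> polys n" "\<And>i. i \<in> {1..<n} \<Longrightarrow> sact i f = f"
  obtains G c where "finite G" "G \<subseteq> mons n" "f = (\<Sum>k\<in>G. sc (c k) (epow n k))"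
proof -
  obtain G c where G: "finite G" "G \<subseteq> mons n" and e: "f = (\<Sum>k\<in>G. \<Sum>w\<in>Sn n. sc (c w k) (bvec n w * epow n k))"
    using polys_expand[OF f(1)] .
  define d where "d i w k = (if ldesc w i then - c w k + (if desc n (s i \<circ> w) = desc n w then c (s i \<circ> w) k else 0) else 0)"
    for i w k
  have d0: "d i w k = 0" if "i \<in> {1..<n}" "w \<in> Sn n" "k \<in> G" for i w k
  proof (rule expansion_unique[where c = "d i", OF G _ that(2,3)])
    have "(\<Sum>k\<in>G. \<Sum>w\<in>Sn n. sc (d i w k) (bvec n w * epow n k)) = (\<Sum>k\<in>G. \<Sum>w\<in>Sn n. sc (c w k) (pibar i (bvec n w) * epow n k))"
      unfolding d_def by (intro sum.cong refl sum_ascent_reindex[symmetric] that)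
    also have "\<dots> = pibar i f"
      unfolding e pibar_sum pibar_sc pibar_invariant_factor[OF sact_epow[OF that(1)]] ..
    also have "\<dots> = 0" by (rule pibar_invariant[OF f(2)[OF that(1)]])
    finally show "(\<Sum>k\<in>G. \<Sum>w\<in>Sn n. sc (d i w k) (bvec n w * epow n k)) = (0 :: 'a mpoly)" .
  qed
  \<comment> \<open>The vanishing of \<open>d\<close> equates the coefficient at \<open>w\<close>
    with zero or with that of a shorter permutation having the same descent set. The descent never
    arrives at the identity, which would make \<open>w\<close> a simple reflection with a nonempty
    descent set.\<close>
  have c0: "c w k = 0" if "w \<in> Sn n" "w \<noteq> id" "k \<in> G" for w k
    using that
  proof (induction "inv_count n w" arbitrary: w rule: less_induct)
    case less
    obtain i where i: "i \<in> {1..<n}" "ldesc w i" using ex_ldesc less.prems by blast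
    let ?v = "s i \<circ> w"
    have cw: "c w k = (if desc n ?v = desc n w then c ?v k else 0)"
      using d0[OF i(1) less.prems(1,3)] i(2) by (simp add: d_def del: o_apply)
    show ?case
    proof (cases "desc n ?v = desc n w")
      case True
      have v: "?v \<in> Sn n" by (intro Sn_s_comp i less.prems)
      have "?v \<noteq> id"
      proof
        assume id: "?v = id"
        then have "w = s i" by (metis comp_id s_comp_s_comp)
        then have "i \<in> desc n w" using i(1) by (simp add: mem_desc)
        then show False using True id by simp
      qed
      moreover have "inv_count n ?v < inv_count n w"
        using inv_count_descent[OF less.prems(1) i] by linarith
      ultimately have "c ?v k = 0" using less.hyps v less.prems(3) by blast
      then show ?thesis using cw by simp
    qed (use cw in simp)
  qed
  have "f = (\<Sum>k\<in>G. sc (c id k) (epow n k))"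
    unfolding e
  proof (rule sum.cong[OF refl])
    fix k assume k: "k \<in> G"
    have "(\<Sum>w\<in>Sn n. sc (c w k) (bvec n w * epow n k)) = (\<Sum>w\<in>{id}. sc (c w k) (bvec n w * epow n k) :: 'a mpoly)"
      by (rule sum.mono_neutral_right) (use c0[OF _ _ k] in auto)
    then show "(\<Sum>w\<in>Sn n. sc (c w k) (bvec n w * epow n k)) = (sc (c id k) (epow n k) :: 'a mpoly)"
      by (simp add: bvec_id del: id_apply)
  qed
  then show thesis using that G by blast
qed

lemma coef_0_mult: "coef (f * g) 0 = coef f 0 * coef g 0" for f g :: "'a::field mpoly"
proof -
  have "coef (mono1 a * mono1 b :: 'a mpoly) 0 = coef (mono1 a) 0 * coef (mono1 b) 0" for a b
  proof -
    have "a + b = 0 \<longleftrightarrow> a = 0 \<and> b = 0"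
      by (auto simp: poly_mapping_eq_iff fun_eq_iff lookup_add)
    then show ?thesis by (auto simp: mult_single lookup_single when_def)
  qed
  then have 1: "coef (sc c (mono1 a) * sc d (mono1 b) :: 'a mpoly) 0 = coef (sc c (mono1 a)) 0 * coef (sc d (mono1 b)) 0" for a b c d
    by (simp add: sc_mult_left sc_mult_right del: sc_single)
  have "coef ((\<Sum>a\<in>supp f. sc (coef f a) (mono1 a)) * (\<Sum>b\<in>supp g. sc (coef g b) (mono1 b))) 0
    = coef (\<Sum>a\<in>supp f. sc (coef f a) (mono1 a)) 0 * coef (\<Sum>b\<in>supp g. sc (coef g b) (mono1 b)) 0"
    by (simp only: sum_product lookup_sum 1)
  then show ?thesis by (simp only: flip: poly_mapping_expand)
qed

lemma coef_0_coinv: "f \<in> coinv_ideal n \<Longrightarrow> coef f 0 = 0"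
  by (induction rule: coinv_ideal.induct) (auto simp: lookup_add coef_0_mult sym_plus_def)

text \<open>Multiplying a basis element by \<open>epow n l\<close> merely adds \<open>l\<close> to
  its index, so products with symmetric polynomials of zero constant term are combinations of basis
  elements with nonzero second index.\<close>

lemma coinv_expand:
  fixes f :: "'a::field mpoly"
  assumes "f \<in> coinv_ideal n"
  shows "f \<in> pm.span ((\<lambda>x. bvec n (fst x) * epow n (snd x)) ` (Sn n \<times> (mons n - {0})))" (is "_ \<in> pm.span ?B")
  using assms
proof (induction rule: coinv_ideal.induct)
  case zero
  then show ?case by (rule pm.span_zero)
next
  case (step f g h)
  have fp: "f \<in> polys n" "coef f 0 = 0" and sym: "\<And>i. i \<in> {1..<n} \<Longrightarrow> sact i f = f"
    using step(1) s_permutes unfolding sym_plus_def by auto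
  obtain G c where G: "finite G" "G \<subseteq> mons n" and f: "f = (\<Sum>k\<in>G. sc (c k) (epow n k))"
    using symmetric_expand[OF fp(1) sym] .
  \<comment> \<open>Only \<open>epow n 0 = 1\<close> has a constant term, so its coefficient is the
    constant term of \<open>f\<close>, which is zero.\<close>
  have "sc (c k) (epow n k) = 0" if k: "k \<in> G" "k = 0" for k
  proof -
    have "coef (epow n l :: 'a mpoly) 0 = 0" if "l \<in> G - {0}" for l
      using that G by (intro coef_0_coinv[of _ n] epow_coinv) auto
    then have "coef f 0 = (\<Sum>l\<in>{0}. c l * coef (epow n l :: 'a mpoly) 0)"
      unfolding f lookup_sum coef_sc using k G by (intro sum.mono_neutral_right) auto
    then show ?thesis using fp k by (simp add: lookup_one)
  qed
  then have f': "f = (\<Sum>k\<in>G - {0}. sc (c k) (epow n k))"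
    unfolding f by (intro sum.mono_neutral_right) (use G in auto)
  obtain H d where H: "finite H" "H \<subseteq> mons n" and g: "g = (\<Sum>k\<in>H. \<Sum>w\<in>Sn n. sc (d w k) (bvec n w * epow n k))"
    using polys_expand[OF step(2)] .
  have "g * f = (\<Sum>k\<in>H. \<Sum>w\<in>Sn n. \<Sum>l\<in>G - {0}. sc (c l) (sc (d w k) (bvec n w * epow n (k + l))))"
    unfolding f' g sum_distrib_right
    by (simp add: sum_distrib_left sc_mult_left sc_mult_right epow_add mult.assoc)
  also have "\<dots> \<in> pm.span ?B"
  proof (intro pm.span_sum pm.span_scale pm.span_base)
    fix k w l assume "k \<in> H" "w \<in> Sn n" "l \<in> G - {0}"
    moreover have "k + l \<noteq> 0" if "l \<noteq> 0"
      using that by (auto simp: poly_mapping_eq_iff fun_eq_iff lookup_add)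
    ultimately have "(w, k + l) \<in> Sn n \<times> (mons n - {0})"
      using G H by (auto intro!: mons_add)
    then show "bvec n w * epow n (k + l) \<in> ?B" by force
  qed
  finally show ?case using step.IH by (rule pm.span_add)
qed

lemma coinv_independent:
  assumes "(\<Sum>w\<in>Sn n. sc (c w) (bvec n w)) \<in> (coinv_ideal n :: 'a::field mpoly set)" "w \<in> Sn n"
  shows "c w = 0"
proof -
  obtain H d where H: "finite H" "H \<subseteq> Sn n \<times> (mons n - {0})"
      and f: "(\<Sum>w\<in>Sn n. sc (c w) (bvec n w)) = (\<Sum>x\<in>H. sc (d x) (bvec n (fst x) * epow n (snd x)) :: 'a mpoly)"
    using coinv_expand[OF assms(1)] by (rule span_image_explicit)
  let ?A = "Sn n \<times> {0 :: nat \<Rightarrow>\<^sub>0 nat}"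
  \<comment> \<open>Merges the given combination, indexed by \<open>k = 0\<close>, and its expansion
    inside the ideal, indexed by \<open>k \<noteq> 0\<close>, into one linear relation between basis
    elements.\<close>
  let ?c = "\<lambda>x. if snd x = 0 then c (fst x) else - d x"
  have disj: "?A \<inter> H = {}" using H by auto
  have "(\<Sum>w\<in>Sn n. sc (c w) (bvec n w)) = (\<Sum>x\<in>?A. sc (?c x) (bvec n (fst x) * epow n (snd x)) :: 'a mpoly)"
    by (rule sum.reindex_bij_witness[of _ fst "\<lambda>w. (w, 0)"]) auto
  moreover have "(\<Sum>x\<in>H. sc (d x) (bvec n (fst x) * epow n (snd x))) = - (\<Sum>x\<in>H. sc (?c x) (bvec n (fst x) * epow n (snd x)) :: 'a mpoly)"
    unfolding sum_negf[symmetric] by (intro sum.cong) (use H in auto)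
  ultimately have eq: "(\<Sum>x\<in>?A. sc (?c x) (bvec n (fst x) * epow n (snd x)) :: 'a mpoly)
      = - (\<Sum>x\<in>H. sc (?c x) (bvec n (fst x) * epow n (snd x)))"
    using f by metis
  have fin: "finite ?A" by simp
  have "(\<Sum>x\<in>?A \<union> H. sc (?c x) (bvec n (fst x) * epow n (snd x)) :: 'a mpoly) = 0"
    unfolding sum.union_disjoint[OF fin H(1) disj] eq by simp
  then have "?c (w, 0) = 0"
    by (rule bvec_epow_independent[rotated 2]) (use H assms(2) in auto)
  then show ?thesis by simp
qed

lemma coinv_spanning:
  fixes f :: "'a::field mpoly"
  assumes "f \<in> polys n"
  obtains c where "f - (\<Sum>w\<in>Sn n. sc (c w) (bvec n w)) \<in> coinv_ideal n"
proof -
  obtain G c where G: "finite G" "G \<subseteq> mons n" and f: "f = (\<Sum>k\<in>G. \<Sum>w\<in>Sn n. sc (c w k) (bvec n w * epow n k))"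
    using polys_expand[OF assms] .
  have G0: "(\<Sum>k\<in>G - {0}. \<Sum>w\<in>Sn n. sc (c w k) (bvec n w * epow n k)) \<in> (coinv_ideal n :: 'a mpoly set)"
    by (intro pm.subspace_sum[OF subspace_coinv] pm.subspace_scale[OF subspace_coinv] coinv_mult epow_coinv bvec_polys)
      (use G in auto)
  show thesis
  proof (cases "0 \<in> G")
    case True
    have "f - (\<Sum>w\<in>Sn n. sc (c w 0) (bvec n w)) = (\<Sum>k\<in>G - {0}. \<Sum>w\<in>Sn n. sc (c w k) (bvec n w * epow n k))"
      unfolding f using G True by (simp add: sum.remove[of G 0])
    then show ?thesis using that[of "\<lambda>w. c w 0"] G0 by simp
  next
    case False
    then show ?thesis using that[of "\<lambda>w. 0"] G0 f by simp
  qed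
qed

section \<open>The free algebra and the 0-Hecke algebra\<close>

text \<open>With concatenation as a noncommutative addition on words, the convolution product of
  finitely supported functions is multiplication in the free algebra, and the ring laws come with
  it.\<close>

instantiation list :: (type) monoid_add
begin

definition zero_list :: "'a list" where "zero_list = []"
definition plus_list :: "'a list \<Rightarrow> 'a list \<Rightarrow> 'a list" where "plus_list = (@)"

instance by standard (auto simp: zero_list_def plus_list_def)

end

lemma ncmult_eq: "ncmult a b = a * b"
proof -
  have "(\<Sum>u\<in>supp a. sc (coef a u) (mono1 u)) * (\<Sum>v\<in>supp b. sc (coef b v) (mono1 v)) = ncmult a b"
    by (simp add: ncmult_def sum_product mult_single plus_list_def)
  then show ?thesis by (simp only: flip: poly_mapping_expand)
qed

lemma nc1_eq: "nc1 = 1"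
  unfolding nc1_def zero_list_def[symmetric] by simp

lemma mono1_Cons: "mono1 (i # u) = T i * mono1 u"
  by (simp add: T_def mult_single plus_list_def)

lemma mono1_append: "mono1 (u @ v) = mono1 u * (mono1 v :: 'a::field ncpoly)"
  by (simp add: mult_single plus_list_def)

lemma mono1_Nil: "mono1 [] = (1 :: 'a::field ncpoly)"
  using nc1_eq by (simp add: nc1_def)

definition words :: "nat \<Rightarrow> nat list set" where
  "words n = {u. set u \<subseteq> {1..<n}}"

lemma frees_eq: "frees n = {a. supp a \<subseteq> words n}"
  by (auto simp: frees_def words_def)

lemma subspace_frees: "pm.subspace (frees n)"
  unfolding frees_eq by (rule subspace_supp)

lemma frees_mono1: "u \<in> words n \<Longrightarrow> mono1 u \<in> frees n"
  by (simp add: frees_eq)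

lemma frees_mult: "a \<in> frees n \<Longrightarrow> b \<in> frees n \<Longrightarrow> a * b \<in> frees n"
  using keys_mult[of a b] by (fastforce simp: frees_eq words_def plus_list_def)

lemma frees_1: "1 \<in> frees n"
  unfolding mono1_Nil[symmetric] by (rule frees_mono1) (simp add: words_def)

lemma frees_T: "i \<in> {1..<n} \<Longrightarrow> T i \<in> frees n"
  unfolding T_def by (rule frees_mono1) (simp add: words_def)

lemma frees_span: "a \<in> frees n \<Longrightarrow> a \<in> pm.span (mono1 ` words n)"
proof -
  assume "a \<in> frees n"
  then have "(\<Sum>m\<in>supp a. sc (coef a m) (mono1 m)) \<in> pm.span (mono1 ` words n)"
    by (intro pm.span_sum pm.span_scale pm.span_base) (auto simp: frees_eq)
  then show ?thesis by (simp only: flip: poly_mapping_expand)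
qed

lemma hideal_step: "r \<in> hrels n \<Longrightarrow> a \<in> frees n \<Longrightarrow> b \<in> frees n \<Longrightarrow> h \<in> hideal n \<Longrightarrow> a * (r * b) + h \<in> hideal n"
  using hideal.step by (simp add: ncmult_eq)

lemma hideal_mult_left: "x \<in> hideal n \<Longrightarrow> c \<in> frees n \<Longrightarrow> c * x \<in> hideal n"
proof (induction rule: hideal.induct)
  case (step r a b h)
  then show ?case
    using hideal_step[of r n "c * a" b "c * h"] by (simp add: frees_mult distrib_left mult.assoc ncmult_eq)
qed (simp add: hideal.zero)

lemma hideal_mult_right: "x \<in> hideal n \<Longrightarrow> c \<in> frees n \<Longrightarrow> x * c \<in> hideal n"
proof (induction rule: hideal.induct)
  case (step r a b h)
  then show ?case
    using hideal_step[of r n a "b * c" "h * c"] by (simp add: frees_mult distrib_right mult.assoc ncmult_eq)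
qed (simp add: hideal.zero)

lemma subspace_hideal: "pm.subspace (hideal n :: 'a::field ncpoly set)"
proof (rule pm.subspaceI)
  show "0 \<in> hideal n" by (rule hideal.zero)
next
  fix f g :: "'a ncpoly" assume "f \<in> hideal n" "g \<in> hideal n"
  then show "f + g \<in> hideal n"
    by (induction rule: hideal.induct) (auto simp: add.assoc intro: hideal.step)
next
  fix c and f :: "'a ncpoly" assume "f \<in> hideal n"
  then have "sc c 1 * f \<in> hideal n"
    by (intro hideal_mult_left pm.subspace_scale[OF subspace_frees] frees_1)
  then show "sc c f \<in> hideal n" by (simp add: sc_mult_left)
qed

lemma hrels_hideal: "r \<in> hrels n \<Longrightarrow> r \<in> hideal n"
  using hideal_step[OF _ frees_1 frees_1 hideal.zero, of r n] by simp

lemma hrels_square: "i \<in> {1..<n} \<Longrightarrow> T i * T i + T i \<in> hideal n"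
  by (rule hrels_hideal) (auto simp: hrels_def ncmult_eq)

lemma hrels_braid:
  "i \<in> {1..<n} \<Longrightarrow> Suc i \<in> {1..<n} \<Longrightarrow> T i * (T (Suc i) * T i) - T (Suc i) * (T i * T (Suc i)) \<in> hideal n"
  by (rule hrels_hideal) (auto simp: hrels_def ncmult_eq)

lemma hrels_far:
  "i \<in> {1..<n} \<Longrightarrow> j \<in> {1..<n} \<Longrightarrow> i + 1 < j \<or> j + 1 < i \<Longrightarrow> T i * T j - T j * T i \<in> hideal n"
  by (rule hrels_hideal) (unfold hrels_def ncmult_eq, blast)

section \<open>Congruence modulo the relations of the 0-Hecke algebra\<close>

definition heq :: "nat \<Rightarrow> 'a::field ncpoly \<Rightarrow> 'a ncpoly \<Rightarrow> bool" where
  "heq n a b \<longleftrightarrow> a - b \<in> hideal n"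

lemma heq_refl: "heq n a a"
  by (simp add: heq_def hideal.zero)

lemma heq_sym: "heq n a b \<Longrightarrow> heq n b a"
  unfolding heq_def using pm.subspace_neg[OF subspace_hideal] by fastforce

lemma heq_trans [trans]: "heq n a b \<Longrightarrow> heq n b c \<Longrightarrow> heq n a c"
  unfolding heq_def using pm.subspace_add[OF subspace_hideal] by fastforce

lemma heq_mult_left: "heq n a b \<Longrightarrow> c \<in> frees n \<Longrightarrow> heq n (c * a) (c * b)"
  using hideal_mult_left[of "a - b" n c] by (simp add: heq_def right_diff_distrib)

lemma heq_mult_right: "heq n a b \<Longrightarrow> c \<in> frees n \<Longrightarrow> heq n (a * c) (b * c)"
  using hideal_mult_right[of "a - b" n c] by (simp add: heq_def left_diff_distrib)

lemma heq_uminus: "heq n a b \<Longrightarrow> heq n (- a) (- b)"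
  unfolding heq_def using pm.subspace_neg[OF subspace_hideal] by fastforce

lemma heq_T_T: "i \<in> {1..<n} \<Longrightarrow> heq n (T i * T i) (- T i)"
  using hrels_square by (simp add: heq_def)

lemma braid_eq_heq: "braid_eq n u v \<Longrightarrow> heq n (mono1 u) (mono1 v)"
proof (induction rule: braid_eq.induct)
  case (beq_Cons i u v)
  then show ?case unfolding mono1_Cons by (intro heq_mult_left frees_T)
next
  case (beq_far i j u)
  then have "heq n (T i * T j) (T j * T i)" using hrels_far by (simp add: heq_def)
  from heq_mult_right[OF this, of "mono1 u"] show ?case
    using beq_far by (simp add: mono1_Cons mult.assoc frees_mono1 words_def)
next
  case (beq_braid i u)
  then have "heq n (T i * (T (Suc i) * T i)) (T (Suc i) * (T i * T (Suc i)))"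
    using hrels_braid[of i n] by (simp add: heq_def)
  from heq_mult_right[OF this, of "mono1 u"] show ?case
    using beq_braid by (simp add: mono1_Cons mult.assoc frees_mono1 words_def)
qed (auto intro: heq_refl heq_sym heq_trans)

definition tprime :: "nat list \<Rightarrow> 'a::field ncpoly" where
  "tprime u = foldr (\<lambda>i acc. (T i + 1) * acc) u 1"

lemma tprime_Nil [simp]: "tprime [] = 1" and tprime_Cons: "tprime (i # u) = (T i + 1) * tprime u"
  by (simp_all add: tprime_def)

lemma frees_T1: "i \<in> {1..<n} \<Longrightarrow> T i + 1 \<in> frees n"
  by (intro pm.subspace_add[OF subspace_frees] frees_T frees_1)

lemma frees_tprime: "u \<in> words n \<Longrightarrow> tprime u \<in> frees n"
proof (induction u)
  case (Cons i u)
  then have "i \<in> {1..<n}" "u \<in> words n" by (auto simp: words_def)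
  then show ?case unfolding tprime_Cons using Cons.IH by (intro frees_mult frees_T1)
qed (simp add: frees_1)

text \<open>For the shifted generators the braid relation is not formal: it differs from the one for
  the \<open>T i\<close> by the quadratic relations for \<open>i\<close> and
  \<open>Suc i\<close>.\<close>

lemma braid_eq_heq_tprime: "braid_eq n u v \<Longrightarrow> heq n (tprime u) (tprime v)"
proof (induction rule: braid_eq.induct)
  case (beq_Cons i u v)
  then show ?case unfolding tprime_Cons by (intro heq_mult_left frees_T1)
next
  case (beq_far i j u)
  have "(T i + 1) * (T j + 1) - (T j + 1) * (T i + 1) = T i * T j - (T j * T i :: 'a ncpoly)"
    by (simp add: algebra_simps)
  then have "heq n ((T i + 1) * (T j + 1)) ((T j + 1) * (T i + 1) :: 'a ncpoly)"
    using hrels_far[of i n j] beq_far by (simp add: heq_def)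
  from heq_mult_right[OF this, of "tprime u"] show ?case
    using beq_far by (simp only: tprime_Cons mult.assoc frees_tprime words_def mem_Collect_eq)
next
  case (beq_braid i u)
  have "(T i + 1) * ((T (Suc i) + 1) * (T i + 1)) - (T (Suc i) + 1) * ((T i + 1) * (T (Suc i) + 1))
      = (T i * (T (Suc i) * T i) - T (Suc i) * (T i * T (Suc i))) + (T i * T i + T i)
        - (T (Suc i) * T (Suc i) + T (Suc i) :: 'a ncpoly)"
    by (simp add: algebra_simps)
  also have "\<dots> \<in> hideal n"
    using beq_braid
    by (intro pm.subspace_add[OF subspace_hideal] pm.subspace_diff[OF subspace_hideal] hrels_braid hrels_square)
  finally have "heq n ((T i + 1) * ((T (Suc i) + 1) * (T i + 1))) ((T (Suc i) + 1) * ((T i + 1) * (T (Suc i) + 1)) :: 'a ncpoly)"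
    by (simp only: heq_def)
  from heq_mult_right[OF this, of "tprime u"] show ?case
    using beq_braid by (simp only: tprime_Cons mult.assoc frees_tprime words_def mem_Collect_eq)
qed (auto intro: heq_refl heq_sym heq_trans)

abbreviation Tperm :: "nat \<Rightarrow> (nat \<Rightarrow> nat) \<Rightarrow> 'a::field ncpoly" where
  "Tperm n w \<equiv> mono1 (rword n w)"

lemma Tw_eq: "Tw n w = Tperm n w"
proof -
  have "foldr (\<lambda>i acc. ncmult (T i) acc) u nc1 = mono1 u" for u
    by (induction u) (simp_all add: ncmult_eq nc1_eq mono1_Nil mono1_Cons[of _ "_ :: nat list"])
  then show ?thesis by (simp add: Tw_def)
qed

lemma T'w_eq: "T'w n w = tprime (rword n w)"
  by (simp add: T'w_def tprime_def ncmult_eq[abs_def] nc1_eq)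

lemma reduced_words: "reduced_word n w u \<Longrightarrow> u \<in> words n"
  by (simp add: words_def reduced_word_def)

lemma rword_words: "w \<in> Sn n \<Longrightarrow> rword n w \<in> words n"
  using reduced_rword reduced_words by blast

lemma Tperm_frees: "w \<in> Sn n \<Longrightarrow> Tperm n w \<in> frees n"
  by (intro frees_mono1 rword_words)

lemma reduced_heq: "reduced_word n w u \<Longrightarrow> heq n (mono1 u) (Tperm n w)"
  using matsumoto reduced_rword reduced_word_Sn braid_eq_heq by blast

lemma T_Tperm_ascent:
  assumes "w \<in> Sn n" "i \<in> {1..<n}" "\<not> ldesc w i"
  shows "reduced_word n (s i \<circ> w) (i # rword n w)" "heq n (T i * Tperm n w) (Tperm n (s i \<circ> w))"
proof -
  show r: "reduced_word n (s i \<circ> w) (i # rword n w)"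
    using reduced_rword[OF assms(1)] assms ldesc_s_comp[OF assms(1)] Sn_s_comp[OF assms(2,1)]
    by (simp add: reduced_word_Cons del: o_apply)
  show "heq n (T i * Tperm n w) (Tperm n (s i \<circ> w))"
    using reduced_heq[OF r] by (simp only: mono1_Cons)
qed

lemma T_Tperm_descent:
  assumes "w \<in> Sn n" "i \<in> {1..<n}" "ldesc w i"
  shows "heq n (T i * Tperm n w) (- Tperm n w)"
proof -
  let ?v = "s i \<circ> w"
  have v: "?v \<in> Sn n" using assms by (intro Sn_s_comp)
  have 1: "heq n (T i * Tperm n ?v) (Tperm n w)"
    using T_Tperm_ascent(2)[OF v assms(2)] assms ldesc_s_comp[OF assms(1), of i] by (simp del: o_apply)
  have "heq n (T i * Tperm n w) (T i * (T i * Tperm n ?v))"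
    by (rule heq_mult_left[OF heq_sym[OF 1] frees_T[OF assms(2)]])
  also have "T i * (T i * Tperm n ?v) = (T i * T i) * Tperm n ?v" by (simp only: mult.assoc)
  also have "heq n \<dots> (- T i * Tperm n ?v)"
    by (rule heq_mult_right[OF heq_T_T[OF assms(2)] Tperm_frees[OF v]])
  also have "- T i * Tperm n ?v = - (T i * Tperm n ?v)" by simp
  also have "heq n \<dots> (- Tperm n w)" by (rule heq_uminus[OF 1])
  finally show ?thesis .
qed

lemma Tperm_T_ascent:
  assumes "w \<in> Sn n" "j \<in> {1..<n}" "w j < w (Suc j)"
  shows "heq n (Tperm n w * T j) (Tperm n (w \<circ> s j))"
  using reduced_heq[OF reduced_word_snoc[OF reduced_rword[OF assms(1)] assms(2,3)]]
  by (simp only: mono1_append T_def)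

lemma Tperm_T_descent:
  assumes "w \<in> Sn n" "j \<in> {1..<n}" "w (Suc j) < w j"
  shows "heq n (Tperm n w * T j) (- Tperm n w)"
proof -
  let ?v = "w \<circ> s j"
  have v: "?v \<in> Sn n" using assms by (intro Sn_comp Sn_s)
  have "?v \<circ> s j = w" by (simp add: fun_eq_iff)
  then have 1: "heq n (Tperm n ?v * T j) (Tperm n w)"
    using Tperm_T_ascent[OF v assms(2)] assms(3) by simp
  have "heq n (Tperm n w * T j) (Tperm n ?v * T j * T j)"
    by (rule heq_mult_right[OF heq_sym[OF 1] frees_T[OF assms(2)]])
  also have "Tperm n ?v * T j * T j = Tperm n ?v * (T j * T j)" by (simp only: mult.assoc)
  also have "heq n \<dots> (Tperm n ?v * - T j)"
    by (rule heq_mult_left[OF heq_T_T[OF assms(2)] Tperm_frees[OF v]])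
  also have "Tperm n ?v * - T j = - (Tperm n ?v * T j)" by simp
  also have "heq n \<dots> (- Tperm n w)" by (rule heq_uminus[OF 1])
  finally show ?thesis .
qed

text \<open>For \<open>w\<close> the longest element of the parabolic subgroup of
  \<open>Dc \<alpha>\<close> this is the generator of \<open>Pmod n \<alpha>\<close>. The right
  factor is constant on each descent class.\<close>

definition hvec :: "nat \<Rightarrow> (nat \<Rightarrow> nat) \<Rightarrow> 'a::field ncpoly" where
  "hvec n w = Tperm n w * tprime (rword n (longest n ({1..<n} - desc n w)))"

lemma longest_frees: "J \<subseteq> {1..<n} \<Longrightarrow> tprime (rword n (longest n J)) \<in> frees n"
  by (intro frees_tprime rword_words longest_Sn)

lemma hvec_frees: "w \<in> Sn n \<Longrightarrow> hvec n w \<in> frees n"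
  unfolding hvec_def by (intro frees_mult Tperm_frees longest_frees) auto

text \<open>Every \<open>j \<in> J\<close> is the first letter of some reduced word of the longest
  element, and \<open>T j * (T j + 1)\<close> is a relation.\<close>

lemma T_tprime_longest:
  assumes "J \<subseteq> {1..<n}" "j \<in> J"
  shows "heq n (T j * tprime (rword n (longest n J))) 0"
proof -
  let ?w = "longest n J"
  have w: "?w \<in> Sn n" and j: "j \<in> {1..<n}" using assms longest_Sn by auto
  have par: "s j \<circ> ?w \<in> parab J"
  proof -
    obtain u where "?w = word_perm u" "set u \<subseteq> J" using longest_parab(1)[OF assms(1)] by (auto simp: parab_def)
    then show ?thesis
      using assms(2) by (auto simp: parab_def word_perm_Cons simp del: o_apply intro!: exI[of _ "j # u"])
  qed
  have ld: "ldesc ?w j"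
    using longest_parab(2)[OF assms(1) par] inv_count_ascent[OF w j] by (metis Suc_n_not_le_n)
  let ?u = "rword n (s j \<circ> ?w)"
  have v: "s j \<circ> ?w \<in> Sn n" using w j by (intro Sn_s_comp)
  have "reduced_word n ?w (j # ?u)"
    using reduced_word_Cons[OF w] j ld reduced_rword[OF v] by blast
  then have "heq n (tprime (rword n ?w)) ((T j + 1) * tprime ?u)"
    using matsumoto reduced_rword[OF w] braid_eq_heq_tprime unfolding tprime_Cons[symmetric] by blast
  then have "heq n (T j * tprime (rword n ?w)) (T j * ((T j + 1) * tprime ?u))"
    using j by (intro heq_mult_left frees_T)
  also have "T j * ((T j + 1) * tprime ?u) = (T j * T j + T j) * tprime ?u"
    by (simp add: algebra_simps)
  also have "heq n \<dots> (0 * tprime ?u)"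
    using j v hrels_square[of j n] by (intro heq_mult_right frees_tprime rword_words) (simp_all add: heq_def)
  finally show ?thesis by simp
qed

text \<open>In the first two cases only the left factor \<open>T\<^sub>w\<close> is affected. When
  the descent set changes, \<open>T i\<close> is moved across \<open>T\<^sub>w\<close>, where it
  becomes \<open>T j\<close> with a non-descent \<open>j\<close>, and the right factor is
  annihilated by it.\<close>

theorem T_hvec:
  assumes w: "w \<in> Sn n" and i: "i \<in> {1..<n}"
  shows "heq n (T i * hvec n w) (if ldesc w i then - hvec n w
    else if desc n (s i \<circ> w) = desc n w then hvec n (s i \<circ> w) else 0)"
proof -
  let ?J = "{1..<n} - desc n w"
  let ?t = "tprime (rword n (longest n ?J)) :: 'a ncpoly"
  have t: "?t \<in> frees n" by (rule longest_frees) auto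
  have assoc: "T i * hvec n w = (T i * Tperm n w) * ?t"
    by (simp only: hvec_def mult.assoc)
  consider "ldesc w i" | "\<not> ldesc w i" "desc n (s i \<circ> w) = desc n w" | "\<not> ldesc w i" "desc n (s i \<circ> w) \<noteq> desc n w"
    by blast
  then show ?thesis
  proof cases
    case 1
    have "heq n (T i * hvec n w) (- Tperm n w * ?t)"
      unfolding assoc by (rule heq_mult_right[OF T_Tperm_descent[OF w i 1] t])
    then show ?thesis using 1 by (simp add: hvec_def)
  next
    case 2
    have "heq n (T i * hvec n w) (Tperm n (s i \<circ> w) * ?t)"
      unfolding assoc by (rule heq_mult_right[OF T_Tperm_ascent(2)[OF w i 2(1)] t])
    then show ?thesis using 2 by (simp only: hvec_def if_False if_True simp_thms)
  next
    case 3
    obtain j where j: "j \<in> {1..<n}" "w j < w (Suc j)" "s i \<circ> w = w \<circ> s j"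
      using ascent_same_desc_or_right_mult[OF w i 3] .
    have "heq n (T i * Tperm n w) (Tperm n (s i \<circ> w))"
      by (rule T_Tperm_ascent(2)[OF w i 3(1)])
    also have "heq n \<dots> (Tperm n w * T j)"
      unfolding j(3) by (rule heq_sym[OF Tperm_T_ascent[OF w j(1,2)]])
    finally have "heq n (T i * hvec n w) (Tperm n w * T j * ?t)"
      unfolding assoc by (rule heq_mult_right[OF _ t])
    also have "Tperm n w * T j * ?t = Tperm n w * (T j * ?t)" by (simp only: mult.assoc)
    also have "heq n \<dots> (Tperm n w * 0)"
      using j by (intro heq_mult_left[OF T_tprime_longest Tperm_frees[OF w]]) (auto simp: mem_desc)
    finally show ?thesis using 3 by simp
  qed
qed

lemma hvec_step:
  assumes "w \<in> Sn n" "i \<in> {1..<n}" "ldesc w i" "desc n (s i \<circ> w) = desc n w"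
  shows "heq n (T i * hvec n (s i \<circ> w)) (hvec n w)"
  using T_hvec[OF Sn_s_comp[OF assms(2,1)] assms(2)] assms ldesc_s_comp[OF assms(1), of i]
  by (simp del: o_apply)

text \<open>The preimage in the free algebra of the span of the classes of \<open>S\<close> modulo
  \<open>hideal n\<close>; this avoids forming the quotient.\<close>

definition modspan :: "nat \<Rightarrow> 'a::field ncpoly set \<Rightarrow> 'a ncpoly set" where
  "modspan n S = {x. \<exists>y\<in>pm.span S. heq n x y}"

lemma modspanI: "y \<in> pm.span S \<Longrightarrow> heq n x y \<Longrightarrow> x \<in> modspan n S"
  by (auto simp: modspan_def)

lemma subspace_modspan: "pm.subspace (modspan n S)"
proof (rule pm.subspaceI)
  show "0 \<in> modspan n S" by (rule modspanI[OF pm.span_zero heq_refl])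
next
  fix x x' assume "x \<in> modspan n S" "x' \<in> modspan n S"
  then obtain y y' where y: "y \<in> pm.span S" "y' \<in> pm.span S" "x - y \<in> hideal n" "x' - y' \<in> hideal n"
    by (auto simp: modspan_def heq_def)
  have "(x + x') - (y + y') = (x - y) + (x' - y')" by simp
  then have "heq n (x + x') (y + y')"
    unfolding heq_def by (simp only: pm.subspace_add[OF subspace_hideal y(3,4)])
  then show "x + x' \<in> modspan n S" using pm.span_add[OF y(1,2)] by (rule modspanI[rotated])
next
  fix c x assume "x \<in> modspan n S"
  then obtain y where y: "y \<in> pm.span S" "x - y \<in> hideal n"
    by (auto simp: modspan_def heq_def)
  have "heq n (sc c x) (sc c y)"
    unfolding heq_def pm.scale_right_diff_distrib[symmetric] using pm.subspace_scale[OF subspace_hideal y(2)] .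
  then show "sc c x \<in> modspan n S" using pm.span_scale[OF y(1)] by (rule modspanI[rotated])
qed

lemma modspan_base: "x \<in> S \<Longrightarrow> x \<in> modspan n S"
  by (rule modspanI[OF pm.span_base heq_refl])

lemma modspan_heq: "heq n x y \<Longrightarrow> y \<in> modspan n S \<Longrightarrow> x \<in> modspan n S"
  unfolding modspan_def using heq_trans by blast

lemma modspan_minimal:
  assumes "S \<subseteq> modspan n S'"
  shows "modspan n S \<subseteq> modspan n S'"
proof
  fix x assume "x \<in> modspan n S"
  then obtain y where "y \<in> pm.span S" "heq n x y" by (auto simp: modspan_def)
  then show "x \<in> modspan n S'"
    using pm.span_minimal[OF assms subspace_modspan] modspan_heq by blast
qed

lemma modspan_closed:
  assumes F: "lin F" "\<And>x. x \<in> hideal n \<Longrightarrow> F x \<in> hideal n" and S: "\<And>x. x \<in> S \<Longrightarrow> F x \<in> modspan n S" and x: "x \<in> modspan n S"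
  shows "F x \<in> modspan n S"
proof -
  obtain y where y: "y \<in> pm.span S" "x - y \<in> hideal n" using x by (auto simp: modspan_def heq_def)
  have "F y \<in> modspan n S" by (rule lin_span_in[OF F(1) subspace_modspan S y(1)])
  moreover have "heq n (F x) (F y)"
    unfolding heq_def module_hom.diff[OF F(1), symmetric] by (rule F(2)[OF y(2)])
  ultimately show ?thesis by (rule modspan_heq[rotated])
qed

lemma modspan_left_closed:
  assumes "\<And>i x. i \<in> {1..<n} \<Longrightarrow> x \<in> S \<Longrightarrow> T i * x \<in> modspan n S" "x \<in> modspan n S" "a \<in> frees n"
  shows "a * x \<in> modspan n S"
proof -
  have w: "mono1 u * x \<in> modspan n S" if "u \<in> words n" for u
    using that
  proof (induction u)
    case Nil
    then show ?case using assms(2) by (simp add: mono1_Nil)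
  next
    case (Cons i u)
    then have i: "i \<in> {1..<n}" "u \<in> words n" by (auto simp: words_def)
    show ?case
      unfolding mono1_Cons mult.assoc
      by (rule modspan_closed[OF lin_mult_left hideal_mult_left[OF _ frees_T[OF i(1)]] assms(1)[OF i(1)] Cons.IH[OF i(2)]])
  qed
  show ?thesis
    by (rule lin_span_in[OF lin_mult_right subspace_modspan _ frees_span[OF assms(3)]]) (use w in auto)
qed

lemma modspan_right_closed:
  assumes "\<And>j x. j \<in> {1..<n} \<Longrightarrow> x \<in> S \<Longrightarrow> x * T j \<in> modspan n S" "x \<in> modspan n S" "a \<in> frees n"
  shows "x * a \<in> modspan n S"
proof -
  have w: "x * mono1 u \<in> modspan n S" if "u \<in> words n" "x \<in> modspan n S" for u x
    using that
  proof (induction u arbitrary: x)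
    case Nil
    then show ?case by (simp add: mono1_Nil)
  next
    case (Cons j u)
    then have j: "j \<in> {1..<n}" "u \<in> words n" by (auto simp: words_def)
    have "x * T j \<in> modspan n S"
      by (rule modspan_closed[OF lin_mult_right hideal_mult_right[OF _ frees_T[OF j(1)]] assms(1)[OF j(1)] Cons.prems(2)])
    then show ?case
      unfolding mono1_Cons mult.assoc[symmetric] by (rule Cons.IH[OF j(2)])
  qed
  show ?thesis
    by (rule lin_span_in[OF lin_mult_left subspace_modspan _ frees_span[OF assms(3)]]) (use w assms(2) in auto)
qed

section \<open>Triangularity with respect to length\<close>

definition longer :: "nat \<Rightarrow> nat \<Rightarrow> 'a::field ncpoly set" where
  "longer n m = modspan n (Tperm n ` {v \<in> Sn n. m \<le> inv_count n v})"

text \<open>Multiplication by \<open>T j\<close> either lengthens the permutation or only changes a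
  sign. In contrast to the group algebra, length never drops.\<close>

lemma longer_mult_right:
  assumes "x \<in> longer n m" "a \<in> frees n"
  shows "x * a \<in> longer n m"
  unfolding longer_def
proof (rule modspan_right_closed[OF _ assms(1)[unfolded longer_def] assms(2)])
  fix j and x :: "'a ncpoly"
  assume j: "j \<in> {1..<n}" and "x \<in> Tperm n ` {v \<in> Sn n. m \<le> inv_count n v}"
  then obtain v where v: "x = Tperm n v" "v \<in> Sn n" "m \<le> inv_count n v" by auto
  have ne: "v j \<noteq> v (Suc j)" using Sn_eq_iff[OF v(2)] by simp
  show "x * T j \<in> modspan n (Tperm n ` {v \<in> Sn n. m \<le> inv_count n v})"
  proof (cases "v j < v (Suc j)")
    case True
    have "v \<circ> s j \<in> {v \<in> Sn n. m \<le> inv_count n v}"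
      using v inv_count_right_ascent[OF v(2) j True] j Sn_comp[OF v(2) Sn_s[OF j]] by auto
    then show ?thesis
      unfolding v(1) by (intro modspan_heq[OF Tperm_T_ascent[OF v(2) j True]] modspan_base imageI)
  next
    case False
    then have "heq n (Tperm n v * T j) (- Tperm n v)"
      using ne by (intro Tperm_T_descent[OF v(2) j]) simp
    then show ?thesis
      unfolding v(1) by (rule modspan_heq) (intro pm.subspace_neg[OF subspace_modspan] modspan_base imageI, use v in simp)
  qed
qed

lemma longer_ascent:
  assumes "w \<in> Sn n" "j \<in> {1..<n}" "w j < w (Suc j)"
  shows "Tperm n w * T j \<in> longer n (Suc (inv_count n w))"
  unfolding longer_def
  by (rule modspan_heq[OF Tperm_T_ascent[OF assms]], rule modspan_base, rule imageI)
    (use Sn_comp[OF assms(1) Sn_s[OF assms(2)]] inv_count_right_ascent[OF assms] in \<open>simp del: o_apply\<close>)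

text \<open>In each factor \<open>T j + 1\<close> the summand 1 reproduces the earlier expression,
  while \<open>T j\<close> lengthens \<open>w\<close> because \<open>j\<close> is not a descent; the
  remaining factors cannot undo this.\<close>

lemma Tperm_tprime_triangular:
  assumes w: "w \<in> Sn n" and u: "set u \<subseteq> {1..<n} - desc n w"
  shows "Tperm n w * tprime u - Tperm n w \<in> (longer n (Suc (inv_count n w)) :: 'a::field ncpoly set)"
  using u
proof (induction u)
  case Nil
  then show ?case unfolding longer_def by (simp add: pm.subspace_0[OF subspace_modspan])
next
  case (Cons j u)
  then have j: "j \<in> {1..<n}" "\<not> w (Suc j) < w j" by (auto simp: mem_desc)
  have u: "u \<in> words n" using Cons.prems by (auto simp: words_def)
  have "w j < w (Suc j)" using j Sn_eq_iff[OF w, of j "Suc j"] by simp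
  then have "Tperm n w * T j * tprime u \<in> (longer n (Suc (inv_count n w)) :: 'a ncpoly set)"
    by (intro longer_mult_right longer_ascent w j(1) frees_tprime u)
  moreover have "Tperm n w * tprime u - Tperm n w \<in> (longer n (Suc (inv_count n w)) :: 'a ncpoly set)"
    using Cons by simp
  ultimately have "Tperm n w * T j * tprime u + (Tperm n w * tprime u - Tperm n w) \<in> (longer n (Suc (inv_count n w)) :: 'a ncpoly set)"
    unfolding longer_def by (rule pm.subspace_add[OF subspace_modspan])
  then show ?case by (simp add: tprime_Cons algebra_simps)
qed

text \<open>\<open>rword\<close> chooses its letters from all of \<open>{1..<n}\<close>. A first
  letter \<open>i \<notin> J\<close> would be a left descent, contradicting that elements of the
  subgroup preserve the initial segment up to \<open>i\<close>.\<close>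

lemma parab_word_set:
  assumes J: "J \<subseteq> {1..<n}" and "v \<in> parab J" "reduced_word n v u"
  shows "set u \<subseteq> J"
  using assms(2,3)
proof (induction u arbitrary: v)
  case (Cons i u)
  have v: "v \<in> Sn n" using parab_Sn J Cons.prems by blast
  have i: "i \<in> {1..<n}" "ldesc v i" "reduced_word n (s i \<circ> v) u"
    using Cons.prems(2) reduced_word_Cons[OF v] by auto
  have "i \<in> J"
  proof (rule ccontr)
    assume "i \<notin> J"
    have "v (inv v i) = i" "v (inv v (Suc i)) = Suc i" using Sn_inv_eq[OF v] by auto
    then have "inv v i \<le> i" "\<not> inv v (Suc i) \<le> i"
      using parab_stabilizes[OF Cons.prems(1) \<open>i \<notin> J\<close>] by (metis order_refl, metis Suc_n_not_le_n)
    then show False using i(2) by linarith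
  qed
  moreover have "s i \<circ> v \<in> parab J"
  proof -
    obtain x where "v = word_perm x" "set x \<subseteq> J" using Cons.prems(1) by (auto simp: parab_def)
    then show ?thesis
      using \<open>i \<in> J\<close> by (auto simp: parab_def word_perm_Cons simp del: o_apply intro!: exI[of _ "i # x"])
  qed
  ultimately show ?case using Cons.IH i(3) by simp
qed simp

lemma hvec_triangular:
  assumes w: "w \<in> Sn n"
  shows "hvec n w - Tperm n w \<in> longer n (Suc (inv_count n w))"
  unfolding hvec_def
proof (rule Tperm_tprime_triangular[OF w])
  have J: "{1..<n} - desc n w \<subseteq> {1..<n}" by blast
  show "set (rword n (longest n ({1..<n} - desc n w))) \<subseteq> {1..<n} - desc n w"
    by (rule parab_word_set[OF J longest_parab(1)[OF J] reduced_rword[OF longest_Sn[OF J]]])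
qed

text \<open>Inverts the triangular system by downward induction on length, which is bounded on the
  finite set \<open>Sn n\<close>.\<close>

lemma Tperm_in_hspan:
  "w \<in> Sn n \<Longrightarrow> Tperm n w \<in> (modspan n (hvec n ` Sn n) :: 'a::field ncpoly set)"
proof (induction "Max (inv_count n ` Sn n) - inv_count n w" arbitrary: w rule: less_induct)
  case less
  let ?M = "Max (inv_count n ` Sn n)"
  have "longer n (Suc (inv_count n w)) \<subseteq> (modspan n (hvec n ` Sn n) :: 'a ncpoly set)"
    unfolding longer_def
  proof (rule modspan_minimal, rule subsetI)
    fix x assume "x \<in> (Tperm n ` {v \<in> Sn n. Suc (inv_count n w) \<le> inv_count n v} :: 'a ncpoly set)"
    then obtain v where v: "x = Tperm n v" "v \<in> Sn n" "inv_count n w < inv_count n v" by auto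
    have "inv_count n v \<le> ?M" using v by (intro Max_ge) auto
    then have "?M - inv_count n v < ?M - inv_count n w" using v(3) by linarith
    then show "x \<in> (modspan n (hvec n ` Sn n) :: 'a ncpoly set)"
      unfolding v(1) using v(2) by (rule less.hyps)
  qed
  then have "hvec n w - Tperm n w \<in> (modspan n (hvec n ` Sn n) :: 'a ncpoly set)"
    using hvec_triangular[OF less.prems] by blast
  moreover have "hvec n w \<in> (modspan n (hvec n ` Sn n) :: 'a ncpoly set)"
    using less.prems by (intro modspan_base imageI)
  ultimately have "hvec n w - (hvec n w - Tperm n w) \<in> (modspan n (hvec n ` Sn n) :: 'a ncpoly set)"
    by (rule pm.subspace_diff[OF subspace_modspan, rotated])
  then show ?case by simp
qed

text \<open>The predicate on descent sets covers both uses at once: a single class for a summand,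
  and all of \<open>Sn n\<close> for the whole algebra.\<close>

lemma T_hvec_class:
  assumes "i \<in> {1..<n}" "x \<in> hvec n ` {w \<in> Sn n. P (desc n w)}"
  shows "T i * x \<in> modspan n (hvec n ` {w \<in> Sn n. P (desc n w)})" (is "_ \<in> modspan n ?S")
proof -
  obtain w where w: "x = hvec n w" "w \<in> Sn n" "P (desc n w)" using assms(2) by auto
  have base: "hvec n v \<in> modspan n ?S" if "v \<in> Sn n" "P (desc n v)" for v
    using that by (intro modspan_base) auto
  have "- hvec n w \<in> modspan n ?S"
    by (rule pm.subspace_neg[OF subspace_modspan base[OF w(2,3)]])
  moreover have "hvec n (s i \<circ> w) \<in> modspan n ?S" if "desc n (s i \<circ> w) = desc n w"
    by (rule base[OF Sn_s_comp[OF assms(1) w(2)]]) (use that w(3) in simp)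
  ultimately have "(if ldesc w i then - hvec n w
    else if desc n (s i \<circ> w) = desc n w then hvec n (s i \<circ> w) else 0) \<in> modspan n ?S"
    using pm.subspace_0[OF subspace_modspan, of n ?S] by presburger
  then show ?thesis unfolding w(1) by (rule modspan_heq[OF T_hvec[OF w(2) assms(1)]])
qed

lemma frees_modspan: "a \<in> frees n \<Longrightarrow> a \<in> modspan n (hvec n ` Sn n)" for a :: "'a::field ncpoly"
proof -
  assume a: "a \<in> frees n"
  have "Tperm n id \<in> modspan n (hvec n ` Sn n :: 'a ncpoly set)" by (rule Tperm_in_hspan) simp
  then have one: "1 \<in> modspan n (hvec n ` Sn n :: 'a ncpoly set)" unfolding rword_id mono1_Nil .
  have "T i * x \<in> modspan n (hvec n ` Sn n :: 'a ncpoly set)" if "i \<in> {1..<n}" "x \<in> hvec n ` Sn n" for i x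
    using T_hvec_class[of i n x "\<lambda>_. True"] that by simp
  from modspan_left_closed[OF this one a] have "a * 1 \<in> modspan n (hvec n ` Sn n)" .
  then show ?thesis by simp
qed

section \<open>The representation on polynomials and independence in the 0-Hecke algebra\<close>

definition act :: "'a::field ncpoly \<Rightarrow> 'a mpoly \<Rightarrow> 'a mpoly" where
  "act a f = extend (\<lambda>u. foldr pibar u f) a"

lemma lin_act_left: "lin (\<lambda>a. act a f)"
  unfolding act_def[abs_def] by (rule lin_extend)

lemma act_mono1 [simp]: "act (mono1 u) f = foldr pibar u f"
  by (simp add: act_def)

lemma lin_act_right: "lin (act a)"
  unfolding act_def extend_def
  by (rule linI) (simp_all add: module_hom.add[OF lin_foldr_pibar] module_hom.scale[OF lin_foldr_pibar]
    pm.scale_right_distrib sum.distrib pm.scale_sum_right mult.commute)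

lemma act_mult: "act (a * b) f = act a (act b f)"
proof (rule lin_ext[where f = a])
  show "lin (\<lambda>a. act (a * b) f)" by (rule lin_compose[OF lin_act_left lin_mult_right])
  show "lin (\<lambda>a. act a (act b f))" by (rule lin_act_left)
  fix u
  show "act (mono1 u * b) f = act (mono1 u) (act b f)"
  proof (rule lin_ext[where f = b])
    show "lin (\<lambda>b. act (mono1 u * b) f)" by (rule lin_compose[OF lin_act_left lin_mult_left])
    show "lin (\<lambda>b. act (mono1 u) (act b f))" by (rule lin_compose[OF lin_act_right lin_act_left])
  qed (simp add: foldr_append del: mult_single flip: mono1_append)
qed

lemma act_T [simp]: "act (T i) f = pibar i f"
  unfolding T_def by simp

lemmas act_add = module_hom.add[OF lin_act_left] and act_diff = module_hom.diff[OF lin_act_left]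
  and act_sum = module_hom.sum[OF lin_act_left] and act_sc = module_hom.scale[OF lin_act_left]

lemma act_hrels: "r \<in> hrels n \<Longrightarrow> act r f = 0"
  unfolding hrels_def ncmult_eq
  by (auto simp: act_add act_diff act_mult pibar_pibar pibar_braid pibar_commute)

text \<open>The action of the free algebra factors through the 0-Hecke algebra, so relations there
  can be tested on polynomials.\<close>

lemma act_hideal: "x \<in> hideal n \<Longrightarrow> act x f = 0"
  by (induction rule: hideal.induct)
    (simp_all add: ncmult_eq act_add act_mult act_hrels module_hom.zero[OF lin_act_left] module_hom.zero[OF lin_act_right])

text \<open>The elements \<open>T\<^sub>w\<close> are independent because the leading monomials of \<open>pibar_w n w\<close> applied to
  \<open>x\<^sub>1\<^sup>n x\<^sub>2\<^sup>n\<^sup>-\<^sup>1 \<cdots> x\<^sub>n\<close> are distinct.\<close>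

lemma Tperm_independent:
  assumes "(\<Sum>w\<in>Sn n. sc (c w) (Tperm n w)) \<in> (hideal n :: 'a::field ncpoly set)" and v: "v \<in> Sn n"
  shows "c v = 0"
proof -
  define d where "d = (\<Sum>j\<in>{1..n}. Poly_Mapping.single j (Suc n - j))"
  have d: "coef d j = Suc n - j" if "1 \<le> j" "j \<le> n" for j
    using that by (simp add: d_def lookup_sum lookup_single when_def)
  let ?v = "mon_perm v d"
  have "0 = act (\<Sum>w\<in>Sn n. sc (c w) (Tperm n w)) (mono1 d)"
    using act_hideal[OF assms(1)] by simp
  also have "\<dots> = (\<Sum>w\<in>Sn n. sc (c w) (pibar_w n w (mono1 d)))"
    by (simp add: act_sum act_sc pibar_w_def del: sc_single)
  finally have "0 = (\<Sum>w\<in>Sn n. c w * coef (pibar_w n w (mono1 d)) ?v)"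
    by (metis (no_types, lifting) coef_sc lookup_sum lookup_zero sum.cong)
  also have "\<dots> = (\<Sum>w\<in>Sn n. if w = v then c w else 0)"
  proof (rule sum.cong[OF refl])
    fix w assume w: "w \<in> Sn n"
    have "pibar_w n w (mono1 d) - mono1 (mon_perm w d) \<in> (low (nrm d) :: 'a mpoly set)"
      by (rule pibar_w_mono1_leading[OF w]) (auto simp: Invs_def d)
    moreover have "nrm ?v = nrm d" by (rule nrm_mon_perm[OF Sn_bij[OF v]])
    ultimately have "?v \<notin> supp (pibar_w n w (mono1 d) - mono1 (mon_perm w d) :: 'a mpoly)"
      by (auto simp: low_def)
    then have "coef (pibar_w n w (mono1 d)) ?v = coef (mono1 (mon_perm w d) :: 'a mpoly) ?v"
      by (simp add: in_keys_iff lookup_minus)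
    moreover have "w = v" if eq: "mon_perm w d = ?v"
    proof
      fix j
      show "w j = v j"
      proof (cases "1 \<le> j \<and> j \<le> n")
        case True
        define p where "p = inv w (v j)"
        have wp: "w p = v j" using Sn_inv_eq[OF w] p_def by auto
        then have p: "1 \<le> p" "p \<le> n"
          using Sn_range[OF w, of p] Sn_range[OF v, of j] True by auto
        have "coef d p = coef d j"
          using coef_mon_perm[OF Sn_bij[OF w], of d p] coef_mon_perm[OF Sn_bij[OF v], of d j] eq wp by simp
        then have "p = j" using p True d by (metis diff_diff_cancel le_SucI)
        then show ?thesis using wp by simp
      next
        case False
        then have "j \<notin> {1..n}" by auto
        then show ?thesis using w v unfolding Sn_def by (metis mem_Collect_eq permutes_not_in)
      qed
    qed
    ultimately show "c w * coef (pibar_w n w (mono1 d)) ?v = (if w = v then c w else 0)"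
      by (auto simp: lookup_single when_def)
  qed
  also have "\<dots> = c v" using v by simp
  finally show ?thesis by simp
qed

text \<open>By induction the coefficients at shorter permutations vanish. By triangularity the terms
  of the length of \<open>v\<close> then give a combination of \<open>T\<^sub>w\<close> equal to one
  of longer elements, to which \<open>Tperm_independent\<close> applies.\<close>

lemma hvec_independent:
  assumes h: "(\<Sum>w\<in>Sn n. sc (c w) (hvec n w)) \<in> (hideal n :: 'a::field ncpoly set)" and v: "v \<in> Sn n"
  shows "c v = 0"
  using v
proof (induction "inv_count n v" arbitrary: v rule: less_induct)
  case less
  let ?m = "inv_count n v"
  let ?A = "{w \<in> Sn n. inv_count n w = ?m}"
  let ?L = "longer n (Suc ?m) :: 'a ncpoly set"
  have sub: "pm.subspace ?L" unfolding longer_def by (rule subspace_modspan)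
  have rest: "sc (c w) (hvec n w) - (if inv_count n w = ?m then sc (c w) (Tperm n w) else 0) \<in> ?L" if w: "w \<in> Sn n" for w
  proof -
    consider "inv_count n w < ?m" | "inv_count n w = ?m" | "?m < inv_count n w" by linarith
    then show ?thesis
    proof cases
      case 1
      then show ?thesis using less.hyps[OF 1 w] by (simp add: pm.subspace_0[OF sub])
    next
      case 2
      then show ?thesis
        using pm.subspace_scale[OF sub hvec_triangular[OF w, unfolded 2], of "c w"]
        by (simp only: pm.scale_right_diff_distrib if_True simp_thms)
    next
      case 3
      have "longer n (Suc (inv_count n w)) \<subseteq> ?L"
        unfolding longer_def using 3 by (intro modspan_minimal subsetI modspan_base) auto
      then have "hvec n w - Tperm n w \<in> ?L" using hvec_triangular[OF w] by blast
      moreover have "Tperm n w \<in> ?L"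
        unfolding longer_def using 3 w by (intro modspan_base) auto
      ultimately have "(hvec n w - Tperm n w) + Tperm n w \<in> ?L" by (rule pm.subspace_add[OF sub])
      then have "sc (c w) (hvec n w) \<in> ?L" by (intro pm.subspace_scale[OF sub]) simp
      then show ?thesis using 3 by simp
    qed
  qed
  have "(\<Sum>w\<in>Sn n. sc (c w) (hvec n w)) - (\<Sum>w\<in>?A. sc (c w) (Tperm n w)) \<in> ?L"
  proof -
    have "(\<Sum>w\<in>?A. sc (c w) (Tperm n w) :: 'a ncpoly) = (\<Sum>w\<in>Sn n. if inv_count n w = ?m then sc (c w) (Tperm n w) else 0)"
      by (simp add: sum.inter_filter del: sc_single)
    then show ?thesis
      using rest by (simp only: flip: sum_subtractf) (intro pm.subspace_sum[OF sub], simp)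
  qed
  moreover have "(\<Sum>w\<in>Sn n. sc (c w) (hvec n w)) \<in> ?L"
    unfolding longer_def using h by (intro modspanI[OF pm.span_zero]) (simp add: heq_def)
  ultimately have "(\<Sum>w\<in>Sn n. sc (c w) (hvec n w)) - ((\<Sum>w\<in>Sn n. sc (c w) (hvec n w)) - (\<Sum>w\<in>?A. sc (c w) (Tperm n w))) \<in> ?L"
    by (rule pm.subspace_diff[OF sub, rotated])
  then have "(\<Sum>w\<in>?A. sc (c w) (Tperm n w)) \<in> ?L" by simp
  then obtain y where y: "y \<in> pm.span (Tperm n ` {w \<in> Sn n. Suc ?m \<le> inv_count n w} :: 'a ncpoly set)"
      and hy: "(\<Sum>w\<in>?A. sc (c w) (Tperm n w)) - y \<in> hideal n"
    unfolding longer_def modspan_def heq_def by blast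
  let ?B = "{w \<in> Sn n. Suc ?m \<le> inv_count n w}"
  have fin: "finite ?B" by simp
  obtain d where d: "y = (\<Sum>w\<in>?B. sc (d w) (Tperm n w))"
    by (rule span_image_finite[OF y fin])
  \<comment> \<open>Both sides of that congruence in a single family of coefficients; at
    \<open>v\<close> it still has the value \<open>c v\<close>.\<close>
  let ?e = "\<lambda>w. if inv_count n w = ?m then c w else if Suc ?m \<le> inv_count n w then - d w else 0"
  have "(\<Sum>w\<in>Sn n. sc (?e w) (Tperm n w) :: 'a ncpoly)
      = (\<Sum>w\<in>Sn n. (if inv_count n w = ?m then sc (c w) (Tperm n w) else 0) - (if Suc ?m \<le> inv_count n w then sc (d w) (Tperm n w) else 0))"
    by (intro sum.cong) (auto simp: single_uminus)
  also have "\<dots> = (\<Sum>w\<in>?A. sc (c w) (Tperm n w)) - y"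
    unfolding d sum_subtractf by (simp add: sum.inter_filter del: sc_single)
  finally have "(\<Sum>w\<in>Sn n. sc (?e w) (Tperm n w)) \<in> (hideal n :: 'a ncpoly set)" using hy by simp
  from Tperm_independent[OF this less.prems] show ?case by simp
qed

section \<open>Bases of quotients and isomorphisms\<close>

lemma cos_eq_iff:
  assumes "pm.subspace K"
  shows "cos K x = cos K y \<longleftrightarrow> x - y \<in> K"
proof
  assume "cos K x = cos K y"
  then have "x + 0 \<in> cos K y" using pm.subspace_0[OF assms] by (auto simp: cos_def)
  then show "x - y \<in> K" by (auto simp: cos_def)
next
  assume xy: "x - y \<in> K"
  have "z \<in> cos K x \<longleftrightarrow> z \<in> cos K y" for z
  proof -
    have cos: "z \<in> cos K u \<longleftrightarrow> z - u \<in> K" for u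
      by (force simp: cos_def image_iff algebra_simps)
    have "z - y = (z - x) + (x - y)" "z - x = (z - y) - (x - y)" by simp_all
    then show ?thesis
      unfolding cos using pm.subspace_add[OF assms _ xy] pm.subspace_diff[OF assms _ xy] by metis
  qed
  then show "cos K x = cos K y" by blast
qed

definition lincomb :: "'i set \<Rightarrow> ('i \<Rightarrow> 'k \<Rightarrow>\<^sub>0 'a::field) \<Rightarrow> ('i \<Rightarrow> 'a) \<Rightarrow> ('k \<Rightarrow>\<^sub>0 'a)" where
  "lincomb B b c = (\<Sum>w\<in>B. sc (c w) (b w))"

lemma lincomb_add: "lincomb B b (\<lambda>w. c w + d w) = lincomb B b c + lincomb B b d"
  by (simp add: lincomb_def pm.scale_left_distrib sum.distrib)

lemma lincomb_diff: "lincomb B b (\<lambda>w. c w - d w) = lincomb B b c - lincomb B b d"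
  by (simp add: lincomb_def pm.scale_left_diff_distrib sum_subtractf)

lemma lincomb_scale: "lincomb B b (\<lambda>w. a * c w) = sc a (lincomb B b c)"
  by (simp add: lincomb_def pm.scale_sum_right)

text \<open>The target map \<open>v\<close> of an operator need not be injective, so the
  coefficients of all sources with a common target are added.\<close>

lemma lincomb_regroup:
  assumes "finite B" "\<And>w. w \<in> B \<Longrightarrow> v w \<in> B"
  shows "lincomb B b (\<lambda>u. \<Sum>w\<in>B. if v w = u then c w else 0) = (\<Sum>w\<in>B. sc (c w) (b (v w)))"
proof -
  have "lincomb B b (\<lambda>u. \<Sum>w\<in>B. if v w = u then c w else 0) = (\<Sum>u\<in>B. \<Sum>w\<in>B. if v w = u then sc (c w) (b u) else 0)"
    unfolding lincomb_def pm.scale_sum_left by (intro sum.cong) auto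
  also have "\<dots> = (\<Sum>w\<in>B. \<Sum>u\<in>B. if v w = u then sc (c w) (b u) else 0)"
    by (rule sum.swap)
  also have "\<dots> = (\<Sum>w\<in>B. sc (c w) (b (v w)))"
    using assms by (intro sum.cong) auto
  finally show ?thesis .
qed

text \<open>\<open>qbasis\<close> asks basis vectors to lie in \<open>A\<close> only up to
  \<open>K\<close>, so a combination has to be corrected to a representative in \<open>A\<close>.
  For \<open>hvec\<close> and \<open>Pmod\<close> just this congruence is established.\<close>

lemma qbasis_lincomb_mem:
  assumes "qbasis A K B b" "pm.subspace K" "pm.subspace A"
  shows "\<exists>a\<in>A. lincomb B b c - a \<in> K"
proof -
  obtain a where a: "\<And>w. w \<in> B \<Longrightarrow> a w \<in> A \<and> b w - a w \<in> K"
    using assms(1) unfolding qbasis_def by metis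
  have "lincomb B b c - (\<Sum>w\<in>B. sc (c w) (a w)) = (\<Sum>w\<in>B. sc (c w) (b w - a w))"
    by (simp add: lincomb_def sum_subtractf pm.scale_right_diff_distrib)
  also have "\<dots> \<in> K"
    using a by (intro pm.subspace_sum[OF assms(2)] pm.subspace_scale[OF assms(2)]) auto
  finally show ?thesis
    using a by (intro bexI[of _ "\<Sum>w\<in>B. sc (c w) (a w)"] pm.subspace_sum[OF assms(3)] pm.subspace_scale[OF assms(3)]) auto
qed

lemma qbasis_lincomb_act:
  assumes "pm.subspace K" "lin F" "\<And>x. x \<in> K \<Longrightarrow> F x \<in> K" "x - lincomb B b c \<in> K"
    and F: "\<And>w. w \<in> B \<Longrightarrow> F (b w) - sc (e w) (b (v w)) \<in> K"
  shows "F x - (\<Sum>w\<in>B. sc (c w * e w) (b (v w))) \<in> K"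
proof -
  have "F x - (\<Sum>w\<in>B. sc (c w * e w) (b (v w)))
      = F (x - lincomb B b c) + (\<Sum>w\<in>B. sc (c w) (F (b w) - sc (e w) (b (v w))))"
    unfolding module_hom.diff[OF assms(2)] lincomb_def module_hom.sum[OF assms(2)] module_hom.scale[OF assms(2)]
    by (simp add: sum_subtractf pm.scale_right_diff_distrib)
  also have "\<dots> \<in> K"
    using assms(3)[OF assms(4)] F
    by (intro pm.subspace_add[OF assms(1)] pm.subspace_sum[OF assms(1)] pm.subspace_scale[OF assms(1)]) auto
  finally show ?thesis .
qed

text \<open>On both sides an operator sends the basis vector at \<open>w\<close> to the same
  multiple of the basis vector at the same \<open>v\<close>. Matching coordinates therefore commutes
  with all operators.\<close>

lemma qmod_isoI:
  fixes b1 :: "'i \<Rightarrow> 'k \<Rightarrow>\<^sub>0 'a::field" and b2 :: "'i \<Rightarrow> 'l \<Rightarrow>\<^sub>0 'a"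
  assumes K: "pm.subspace K1" "pm.subspace K2" and A: "pm.subspace A1" "pm.subspace A2"
    and basis: "qbasis A1 K1 B b1" "qbasis A2 K2 B b2" and fin: "finite B"
    and lin: "\<And>i. i \<in> Idx \<Longrightarrow> lin (act1 i)" "\<And>i. i \<in> Idx \<Longrightarrow> lin (act2 i)"
    and stable: "\<And>i x. i \<in> Idx \<Longrightarrow> x \<in> K1 \<Longrightarrow> act1 i x \<in> K1" "\<And>i x. i \<in> Idx \<Longrightarrow> x \<in> K2 \<Longrightarrow> act2 i x \<in> K2"
    and table: "\<And>i w. i \<in> Idx \<Longrightarrow> w \<in> B \<Longrightarrow>
      \<exists>v\<in>B. \<exists>e. act1 i (b1 w) - sc e (b1 v) \<in> K1 \<and> act2 i (b2 w) - sc e (b2 v) \<in> K2"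
  shows "qmod_iso Idx A1 K1 act1 A2 K2 act2"
proof -
  let ?L1 = "lincomb B b1" and ?L2 = "lincomb B b2"
  have ex1: "\<exists>c. x - ?L1 c \<in> K1" if "x \<in> A1" for x
    using basis(1) that unfolding qbasis_def lincomb_def by blast
  have ex2: "\<exists>c. y - ?L2 c \<in> K2" if "y \<in> A2" for y
    using basis(2) that unfolding qbasis_def lincomb_def by blast
  have eq1: "c w = d w" if "?L1 c - ?L1 d \<in> K1" "w \<in> B" for c d w
    using basis(1) that unfolding qbasis_def lincomb_diff[symmetric] unfolding lincomb_def by fastforce
  have eq2: "c w = d w" if "?L2 c - ?L2 d \<in> K2" "w \<in> B" for c d w
    using basis(2) that unfolding qbasis_def lincomb_diff[symmetric] unfolding lincomb_def by fastforce
  have cong: "?L1 c = ?L1 d \<and> ?L2 c = ?L2 d" if "\<And>w. w \<in> B \<Longrightarrow> c w = d w" for c d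
    using that unfolding lincomb_def by (auto intro!: sum.cong)
  note in1 = qbasis_lincomb_mem[OF basis(1) K(1) A(1)] and in2 = qbasis_lincomb_mem[OF basis(2) K(2) A(2)]
  \<comment> \<open>The chosen coordinates are determined only on \<open>B\<close>, which suffices
    because \<open>lincomb\<close> ignores all other values.\<close>
  define \<Phi> where "\<Phi> X = cos K2 (?L2 (SOME c. X = cos K1 (?L1 c)))" for X
  have \<Phi>: "\<Phi> (cos K1 x) = cos K2 (?L2 c)" if "x - ?L1 c \<in> K1" for x c
  proof -
    have x: "cos K1 x = cos K1 (?L1 c)" using that by (simp add: cos_eq_iff[OF K(1)])
    define d where "d = (SOME d. cos K1 x = cos K1 (?L1 d))"
    have "cos K1 x = cos K1 (?L1 d)"
      unfolding d_def by (rule someI[of "\<lambda>d. cos K1 x = cos K1 (?L1 d)", OF x])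
    then have "cos K1 (?L1 c) = cos K1 (?L1 d)" using x by (rule trans[OF sym, rotated])
    then have "?L1 c - ?L1 d \<in> K1" by (simp only: cos_eq_iff[OF K(1)])
    then have "?L2 d = ?L2 c" using eq1 cong by metis
    then show ?thesis unfolding \<Phi>_def d_def[symmetric] by simp
  qed
  \<comment> \<open>The conditions in \<open>qmod_iso\<close> allow any representative
    \<open>y\<close> of the image. Giving \<open>x\<close> and \<open>y\<close> a common coordinate
    vector reduces each of them to \<open>\<Phi>I\<close>.\<close>
  have rep: "\<exists>c. x - ?L1 c \<in> K1 \<and> y - ?L2 c \<in> K2" if "x \<in> A1" "\<Phi> (cos K1 x) = cos K2 y" for x y
  proof -
    from ex1[OF that(1)] obtain c where c: "x - ?L1 c \<in> K1" by blast
    then have "cos K2 y = cos K2 (?L2 c)" using \<Phi>[OF c] that(2) by simp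
    then show ?thesis using c by (auto simp: cos_eq_iff[OF K(2)])
  qed
  have \<Phi>I: "\<Phi> (cos K1 x) = cos K2 y" if "x - ?L1 c \<in> K1" "y - ?L2 c \<in> K2" for x y c
    using \<Phi>[OF that(1)] that(2) by (simp add: cos_eq_iff[OF K(2), symmetric])
  have "inj_on \<Phi> (qcar A1 K1)"
    unfolding qcar_def
  proof (rule inj_onI, clarify)
    fix x x' assume x: "x \<in> A1" "x' \<in> A1" and eq: "\<Phi> (cos K1 x) = \<Phi> (cos K1 x')"
    obtain c c' where c: "x - ?L1 c \<in> K1" "x' - ?L1 c' \<in> K1" using ex1 x by blast
    have "cos K2 (?L2 c) = cos K2 (?L2 c')" using eq \<Phi>[OF c(1)] \<Phi>[OF c(2)] by simp
    then have "?L1 c = ?L1 c'" using eq2 cong by (metis cos_eq_iff[OF K(2)])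
    then have "cos K1 x = cos K1 (?L1 c)" "cos K1 x' = cos K1 (?L1 c)"
      using c by (simp_all add: cos_eq_iff[OF K(1)])
    then show "cos K1 x = cos K1 x'" by simp
  qed
  moreover have "\<Phi> ` qcar A1 K1 = qcar A2 K2"
  proof (intro equalityI subsetI)
    fix Y assume "Y \<in> \<Phi> ` qcar A1 K1"
    then obtain x where x: "x \<in> A1" "Y = \<Phi> (cos K1 x)" by (auto simp: qcar_def)
    obtain c where c: "x - ?L1 c \<in> K1" using ex1 x by blast
    obtain a where a: "a \<in> A2" "?L2 c - a \<in> K2" using in2 by blast
    then have "Y = cos K2 a" unfolding x(2) \<Phi>[OF c] by (simp add: cos_eq_iff[OF K(2)])
    then show "Y \<in> qcar A2 K2" using a by (auto simp: qcar_def)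
  next
    fix Y assume "Y \<in> qcar A2 K2"
    then obtain y where y: "y \<in> A2" "Y = cos K2 y" by (auto simp: qcar_def)
    obtain c where c: "y - ?L2 c \<in> K2" using ex2 y by blast
    obtain a where a: "a \<in> A1" "?L1 c - a \<in> K1" using in1 by blast
    have "a - ?L1 c \<in> K1" using pm.subspace_neg[OF K(1) a(2)] by simp
    then have "\<Phi> (cos K1 a) = Y" unfolding y(2) using c by (rule \<Phi>I)
    then show "Y \<in> \<Phi> ` qcar A1 K1" using a by (auto simp: qcar_def)
  qed
  ultimately have "bij_betw \<Phi> (qcar A1 K1) (qcar A2 K2)" by (simp add: bij_betw_def)
  moreover have "\<Phi> (cos K1 (x + x')) = cos K2 (y + y')"
    if "x \<in> A1" "x' \<in> A1" "\<Phi> (cos K1 x) = cos K2 y" "\<Phi> (cos K1 x') = cos K2 y'" for x x' y y'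
  proof -
    from rep[OF that(1,3)] rep[OF that(2,4)]
    obtain c c' where c: "x - ?L1 c \<in> K1" "y - ?L2 c \<in> K2" and c': "x' - ?L1 c' \<in> K1" "y' - ?L2 c' \<in> K2"
      by blast
    show ?thesis
    proof (rule \<Phi>I[of _ "\<lambda>w. c w + c' w"])
      show "x + x' - ?L1 (\<lambda>w. c w + c' w) \<in> K1"
        using pm.subspace_add[OF K(1) c(1) c'(1)] by (simp add: lincomb_add algebra_simps)
      show "y + y' - ?L2 (\<lambda>w. c w + c' w) \<in> K2"
        using pm.subspace_add[OF K(2) c(2) c'(2)] by (simp add: lincomb_add algebra_simps)
    qed
  qed
  moreover have "\<Phi> (cos K1 (sc a x)) = cos K2 (sc a y)" if "x \<in> A1" "\<Phi> (cos K1 x) = cos K2 y" for x y a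
  proof -
    from rep[OF that] obtain c where c: "x - ?L1 c \<in> K1" "y - ?L2 c \<in> K2" by blast
    show ?thesis
    proof (rule \<Phi>I[of _ "\<lambda>w. a * c w"])
      show "sc a x - ?L1 (\<lambda>w. a * c w) \<in> K1"
        using pm.subspace_scale[OF K(1) c(1)] by (simp add: lincomb_scale pm.scale_right_diff_distrib)
      show "sc a y - ?L2 (\<lambda>w. a * c w) \<in> K2"
        using pm.subspace_scale[OF K(2) c(2)] by (simp add: lincomb_scale pm.scale_right_diff_distrib)
    qed
  qed
  moreover have "\<Phi> (cos K1 (act1 i x)) = cos K2 (act2 i y)" if i: "i \<in> Idx" and x: "x \<in> A1" "\<Phi> (cos K1 x) = cos K2 y" for i x y
  proof -
    from rep[OF x] obtain c where c: "x - ?L1 c \<in> K1" "y - ?L2 c \<in> K2" by blast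
    obtain v e where ve: "\<And>w. w \<in> B \<Longrightarrow> v w \<in> B \<and> act1 i (b1 w) - sc (e w) (b1 (v w)) \<in> K1 \<and> act2 i (b2 w) - sc (e w) (b2 (v w)) \<in> K2"
      using table[OF i] by metis
    define d where "d = (\<lambda>u. \<Sum>w\<in>B. if v w = u then c w * e w else 0)"
    have Ld: "?L1 d = (\<Sum>w\<in>B. sc (c w * e w) (b1 (v w)))" "?L2 d = (\<Sum>w\<in>B. sc (c w * e w) (b2 (v w)))"
      unfolding d_def by (rule lincomb_regroup[OF fin]; use ve in blast)+
    have 1: "act1 i x - ?L1 d \<in> K1"
      unfolding Ld by (rule qbasis_lincomb_act[OF K(1) lin(1)[OF i] stable(1)[OF i] c(1)]) (simp_all add: ve)
    have 2: "act2 i y - ?L2 d \<in> K2"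
      unfolding Ld by (rule qbasis_lincomb_act[OF K(2) lin(2)[OF i] stable(2)[OF i] c(2)]) (simp_all add: ve)
    show ?thesis using 1 2 by (rule \<Phi>I)
  qed
  ultimately show ?thesis unfolding qmod_iso_def by blast
qed

section \<open>The decomposition\<close>

lemma pibar_coinv:
  assumes "i \<in> {1..<n}" "x \<in> coinv_ideal n"
  shows "pibar i x \<in> coinv_ideal n"
  using assms(2)
proof (induction rule: coinv_ideal.induct)
  case (step f g h)
  have "sact i f = f" using step(1) s_permutes[OF assms(1)] by (auto simp: sym_plus_def)
  then show ?case
    using step pibar_polys[OF assms(1) step(2)] by (simp add: pibar_add pibar_invariant_factor coinv_ideal.step)
qed (simp add: coinv_ideal.zero)

abbreviation (input) dclass :: "nat \<Rightarrow> nat set \<Rightarrow> (nat \<Rightarrow> nat) set" where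
  "dclass n I \<equiv> {w \<in> Sn n. desc n w = I}"

lemma pibar_bvec_class:
  assumes "i \<in> {1..<n}" "w \<in> dclass n I"
  shows "pibar i (bvec n w :: 'a::field mpoly) \<in> pm.span (bvec n ` dclass n I)" (is "_ \<in> ?S")
proof -
  have w: "w \<in> Sn n" "desc n w = I" using assms(2) by auto
  have base: "bvec n v \<in> ?S" if "v \<in> dclass n I" for v
    using that by (intro pm.span_base imageI)
  have "s i \<circ> w \<in> dclass n I" if "desc n (s i \<circ> w) = desc n w"
    using that w Sn_s_comp[OF assms(1)] by simp
  then show ?thesis
    unfolding pibar_bvec[OF w(1) assms(1)]
    using base[of "s i \<circ> w"] pm.span_neg[OF base[OF assms(2)]] pm.span_zero[of "bvec n ` dclass n I :: 'a mpoly set"]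
    by presburger
qed

text \<open>The span is closed under the operators by the action table; conversely, ascending
  through the descent class from its bottom produces every \<open>bvec\<close>. The table is exact,
  so the equality holds before passing to the quotient.\<close>

lemma hspan_bvec:
  assumes "I \<subseteq> {1..<n}"
  shows "hspan n (bvec n (longest n I)) = (pm.span (bvec n ` dclass n I) :: 'a::field mpoly set)" (is "?H = ?S")
proof
  have l: "longest n I \<in> dclass n I" using longest_Sn[OF assms] desc_longest[OF assms] by simp
  show "?H \<subseteq> ?S"
  proof
    fix x assume "x \<in> ?H"
    then show "x \<in> ?S"
    proof (induction rule: hspan.induct)
      case base
      then show ?case using l by (intro pm.span_base imageI)
    next
      case (act x i)
      show ?case
        by (rule lin_span_in[OF lin_pibar pm.subspace_span _ act.IH]) (use pibar_bvec_class[OF act(2)] in auto)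
    qed (auto intro: pm.span_add pm.span_scale)
  qed
  have "pm.subspace ?H"
  proof (rule pm.subspaceI)
    have "sc 0 (bvec n (longest n I)) \<in> ?H" by (intro hspan.smult hspan.base)
    then show "0 \<in> ?H" by simp
  qed (auto intro: hspan.add hspan.smult)
  moreover have "bvec n w \<in> ?H" if w: "w \<in> dclass n I" for w
  proof -
    have "w \<in> Sn n" "desc n w = I" using w by auto
    from this(1) show ?thesis
    proof (induction w rule: descent_class_induct)
      case longest
      then show ?case using \<open>desc n w = I\<close> by (simp add: hspan.base)
    next
      case (step v i)
      have "pibar i (bvec n (s i \<circ> v)) = (bvec n v :: 'a mpoly)"
        using pibar_bvec[OF Sn_s_comp[OF step(2,1)] step(2)] ldesc_s_comp[OF step(1), of i] step(3-5)
        by (simp del: o_apply)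
      then show ?case using hspan.act[OF step(6) step(2)] by (simp only:)
    qed
  qed
  ultimately show "?S \<subseteq> ?H" by (intro pm.span_minimal) auto
qed

lemma comps_Dc_subset: "\<alpha> \<in> comps n \<Longrightarrow> Dc \<alpha> \<subseteq> {1..<n}"
  using Dc_subset by (auto simp: comps_def)

lemma Msum_eq: "\<alpha> \<in> comps n \<Longrightarrow> Msum n \<alpha> = pm.span (bvec n ` dclass n (Dc \<alpha>))"
  unfolding hspan_bvec[OF comps_Dc_subset, symmetric] Msum_def w0_def
  by (simp add: bvec_def desc_longest[OF comps_Dc_subset])

lemma qbasis_span:
  assumes "finite B" "\<And>c. (\<Sum>x\<in>B. sc (c x) (b x)) \<in> K \<Longrightarrow> \<forall>x\<in>B. c x = 0" "pm.subspace K"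
  shows "qbasis (pm.span (b ` B)) K B b"
  unfolding qbasis_def
proof (intro conjI ballI allI)
  fix x assume "x \<in> B"
  then show "\<exists>a\<in>pm.span (b ` B). b x - a \<in> K"
    using pm.subspace_0[OF assms(3)] by (intro bexI[of _ "b x"] pm.span_base) auto
next
  fix f assume "f \<in> pm.span (b ` B)"
  then obtain c where "f = (\<Sum>x\<in>B. sc (c x) (b x))" using assms(1) by (rule span_image_finite)
  then show "\<exists>c. f - (\<Sum>x\<in>B. sc (c x) (b x)) \<in> K"
    using pm.subspace_0[OF assms(3)] by (intro exI[of _ c]) simp
qed (use assms(2) in blast)

lemma sum_extend_zero:
  "finite S \<Longrightarrow> (\<Sum>w | w \<in> S \<and> P w. sc (c w) (b w)) = (\<Sum>w\<in>S. sc (if P w then c w else 0) (b w))"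
  by (rule sum.mono_neutral_cong_left) auto

lemma qbasis_Msum:
  assumes "\<alpha> \<in> comps n"
  shows "qbasis (Msum n \<alpha> :: 'a::field mpoly set) (coinv_ideal n) (dclass n (Dc \<alpha>)) (bvec n)"
  unfolding Msum_eq[OF assms]
proof (rule qbasis_span[OF _ _ subspace_coinv])
  fix c assume "(\<Sum>w\<in>dclass n (Dc \<alpha>). sc (c w) (bvec n w)) \<in> (coinv_ideal n :: 'a mpoly set)"
  then have "(\<Sum>w\<in>Sn n. sc (if desc n w = Dc \<alpha> then c w else 0) (bvec n w)) \<in> (coinv_ideal n :: 'a mpoly set)"
    by (simp only: sum_extend_zero[OF finite_Sn])
  from coinv_independent[OF this] show "\<forall>w\<in>dclass n (Dc \<alpha>). c w = 0" by fastforce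
qed simp

lemma qbasis_polys: "qbasis (polys n :: 'a::field mpoly set) (coinv_ideal n) (Sn n) (bvec n)"
  unfolding qbasis_def
proof (intro conjI ballI allI impI)
  fix w assume "w \<in> Sn n"
  then show "\<exists>a\<in>polys n. bvec n w - a \<in> (coinv_ideal n :: 'a mpoly set)"
    by (intro bexI[of _ "bvec n w"] bvec_polys) (simp add: coinv_ideal.zero)
next
  fix f :: "'a mpoly" assume "f \<in> polys n"
  then show "\<exists>c. f - (\<Sum>w\<in>Sn n. sc (c w) (bvec n w)) \<in> coinv_ideal n"
    using coinv_spanning by blast
qed (rule coinv_independent)

lemma Pmod_eq:
  assumes "\<alpha> \<in> comps n"
  shows "Pmod n \<alpha> = {a * hvec n (longest n (Dc \<alpha>)) | a. a \<in> frees n}"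
  unfolding Pmod_def ncmult_eq Tw_eq T'w_eq w0_def w0c_def hvec_def
  by (simp only: desc_longest[OF comps_Dc_subset[OF assms]])

lemma subspace_Pmod:
  assumes "\<alpha> \<in> comps n"
  shows "pm.subspace (Pmod n \<alpha> :: 'a::field ncpoly set)"
proof -
  have "(Pmod n \<alpha> :: 'a ncpoly set) = (\<lambda>a. a * hvec n (longest n (Dc \<alpha>))) ` frees n"
    unfolding Pmod_eq[OF assms] by blast
  then show ?thesis
    by (simp only: module_hom.subspace_image[OF lin_mult_right subspace_frees])
qed

lemma qbasis_Pmod:
  assumes \<alpha>: "\<alpha> \<in> comps n"
  shows "qbasis (Pmod n \<alpha> :: 'a::field ncpoly set) (hideal n) (dclass n (Dc \<alpha>)) (hvec n)"
  unfolding qbasis_def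
proof (intro conjI ballI allI impI)
  let ?I = "Dc \<alpha>"
  let ?l = "longest n ?I"
  fix w assume "w \<in> dclass n ?I"
  then have w: "w \<in> Sn n" "desc n w = ?I" by auto
  \<comment> \<open>Each step up the class contributes one left factor \<open>T i\<close> to
    \<open>a\<close>. The equality holds only modulo the relations.\<close>
  from w(1) have "\<exists>a\<in>frees n. heq n (hvec n w) (a * hvec n ?l :: 'a ncpoly)"
  proof (induction w rule: descent_class_induct)
    case longest
    then show ?case unfolding w(2) by (intro bexI[of _ 1] frees_1) (simp add: heq_refl)
  next
    case (step v i)
    then obtain a :: "'a ncpoly" where a: "a \<in> frees n" "heq n (hvec n (s i \<circ> v)) (a * hvec n ?l)" by blast
    have "heq n (hvec n v) (T i * hvec n (s i \<circ> v))"
      using step by (intro heq_sym[OF hvec_step]) auto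
    also have "heq n \<dots> (T i * (a * hvec n ?l))"
      by (rule heq_mult_left[OF a(2) frees_T[OF step(2)]])
    finally show ?case
      by (intro bexI[of _ "T i * a"] frees_mult frees_T[OF step(2)] a(1)) (simp only: mult.assoc)
  qed
  then show "\<exists>a\<in>Pmod n \<alpha>. hvec n w - a \<in> (hideal n :: 'a ncpoly set)"
    unfolding Pmod_eq[OF \<alpha>] heq_def by blast
next
  fix c w assume "(\<Sum>w\<in>dclass n (Dc \<alpha>). sc (c w) (hvec n w)) \<in> (hideal n :: 'a ncpoly set)" and w: "w \<in> dclass n (Dc \<alpha>)"
  then have "(\<Sum>w\<in>Sn n. sc (if desc n w = Dc \<alpha> then c w else 0) (hvec n w)) \<in> (hideal n :: 'a ncpoly set)"
    by (simp only: sum_extend_zero[OF finite_Sn])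
  from hvec_independent[OF this, of w] w show "c w = 0" by simp
next
  fix f :: "'a ncpoly" assume "f \<in> Pmod n \<alpha>"
  then obtain a where a: "f = a * hvec n (longest n (Dc \<alpha>))" "a \<in> frees n" unfolding Pmod_eq[OF \<alpha>] by blast
  note I = comps_Dc_subset[OF \<alpha>]
  have "hvec n (longest n (Dc \<alpha>)) \<in> modspan n (hvec n ` dclass n (Dc \<alpha>) :: 'a ncpoly set)"
    using longest_Sn[OF I] desc_longest[OF I] by (intro modspan_base imageI) simp
  moreover have "T i * x \<in> modspan n (hvec n ` dclass n (Dc \<alpha>))"
    if "i \<in> {1..<n}" "x \<in> hvec n ` dclass n (Dc \<alpha>)" for i and x :: "'a ncpoly"
    using T_hvec_class[of i n x "\<lambda>I. I = Dc \<alpha>"] that by simp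
  ultimately have "f \<in> modspan n (hvec n ` dclass n (Dc \<alpha>))"
    unfolding a(1) by (intro modspan_left_closed[OF _ _ a(2)])
  then obtain y where y: "y \<in> pm.span (hvec n ` dclass n (Dc \<alpha>))" "f - y \<in> hideal n"
    by (auto simp: modspan_def heq_def)
  have fin: "finite (dclass n (Dc \<alpha>))" by simp
  obtain c where "y = (\<Sum>w\<in>dclass n (Dc \<alpha>). sc (c w) (hvec n w))"
    by (rule span_image_finite[OF y(1) fin])
  then show "\<exists>c. f - (\<Sum>w\<in>dclass n (Dc \<alpha>). sc (c w) (hvec n w)) \<in> hideal n" using y(2) by blast
qed

lemma qbasis_frees: "qbasis (frees n :: 'a::field ncpoly set) (hideal n) (Sn n) (hvec n)"
  unfolding qbasis_def
proof (intro conjI ballI allI impI)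
  fix w assume "w \<in> Sn n"
  then show "\<exists>a\<in>frees n. hvec n w - a \<in> (hideal n :: 'a ncpoly set)"
    by (intro bexI[of _ "hvec n w"] hvec_frees) (simp add: hideal.zero)
next
  fix f :: "'a ncpoly" assume "f \<in> frees n"
  then obtain y where y: "y \<in> pm.span (hvec n ` Sn n)" "f - y \<in> hideal n"
    using frees_modspan by (auto simp: modspan_def heq_def)
  obtain c where "y = (\<Sum>w\<in>Sn n. sc (c w) (hvec n w))"
    by (rule span_image_finite[OF y(1) finite_Sn])
  then show "\<exists>c. f - (\<Sum>w\<in>Sn n. sc (c w) (hvec n w)) \<in> hideal n" using y(2) by blast
qed (rule hvec_independent)

lemma lin_lmult: "lin (lmult i)"
  unfolding lmult_def[abs_def] ncmult_eq by (rule lin_mult_left)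

lemma lmult_hideal: "i \<in> {1..<n} \<Longrightarrow> x \<in> hideal n \<Longrightarrow> lmult i x \<in> hideal n"
  unfolding lmult_def ncmult_eq by (intro hideal_mult_left frees_T)

text \<open>The scalar \<open>e\<close> is \<open>-1\<close>, \<open>1\<close> or \<open>0\<close>.
  A vanishing image is encoded by \<open>e = 0\<close> with \<open>v = w\<close>, which keeps the
  target inside the descent class.\<close>

lemma common_table:
  assumes i: "i \<in> {1..<n}" and w: "w \<in> Sn n"
  shows "\<exists>v. v \<in> Sn n \<and> desc n v = desc n w \<and> (\<exists>e. pibar i (bvec n w) - sc e (bvec n v) \<in> (coinv_ideal n :: 'a::field mpoly set)
    \<and> lmult i (hvec n w) - sc e (hvec n v) \<in> (hideal n :: 'a ncpoly set))"
proof -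
  have T: "lmult i (hvec n w) - (if ldesc w i then - hvec n w
    else if desc n (s i \<circ> w) = desc n w then hvec n (s i \<circ> w) else 0) \<in> (hideal n :: 'a ncpoly set)"
    using T_hvec[OF w i] unfolding heq_def lmult_def ncmult_eq .
  consider "ldesc w i" | "\<not> ldesc w i" "desc n (s i \<circ> w) = desc n w" | "\<not> ldesc w i" "desc n (s i \<circ> w) \<noteq> desc n w"
    by blast
  then show ?thesis
  proof cases
    case 1
    then show ?thesis
      using w T by (intro exI[of _ w] conjI exI[of _ "-1"]) (simp_all add: pibar_bvec[OF w i] coinv_ideal.zero)
  next
    case 2
    show ?thesis
      using T by (intro exI[of _ "s i \<circ> w"] conjI Sn_s_comp i w 2 exI[of _ 1])
        (simp_all only: pibar_bvec[OF w i] coinv_ideal.zero 2 if_True if_False simp_thms pm.scale_one diff_self)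
  next
    case 3
    then show ?thesis
      using w T by (intro exI[of _ w] conjI exI[of _ 0]) (simp_all add: pibar_bvec[OF w i] coinv_ideal.zero del: o_apply)
  qed
qed

lemma qmod_iso_summand:
  assumes "\<alpha> \<in> comps n"
  shows "qmod_iso {1..<n} (Msum n \<alpha> :: 'a::field mpoly set) (coinv_ideal n) pibar (Pmod n \<alpha> :: 'a ncpoly set) (hideal n) lmult"
proof (rule qmod_isoI[OF subspace_coinv subspace_hideal _ subspace_Pmod[OF assms] qbasis_Msum[OF assms] qbasis_Pmod[OF assms]])
  show "pm.subspace (Msum n \<alpha> :: 'a mpoly set)" unfolding Msum_eq[OF assms] by (rule pm.subspace_span)
  fix i w assume "i \<in> {1..<n}" "w \<in> dclass n (Dc \<alpha>)"
  then show "\<exists>v\<in>dclass n (Dc \<alpha>). \<exists>e. pibar i (bvec n w) - sc e (bvec n v) \<in> (coinv_ideal n :: 'a mpoly set)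
      \<and> lmult i (hvec n w) - sc e (hvec n v) \<in> (hideal n :: 'a ncpoly set)"
    using common_table[of i n w] by fastforce
qed (simp_all add: lin_pibar lin_lmult pibar_coinv lmult_hideal)

lemma qmod_iso_regular:
  "qmod_iso {1..<n} (polys n :: 'a::field mpoly set) (coinv_ideal n) pibar (frees n :: 'a ncpoly set) (hideal n) lmult"
proof (rule qmod_isoI[OF subspace_coinv subspace_hideal subspace_polys subspace_frees qbasis_polys qbasis_frees])
  fix i w assume "i \<in> {1..<n}" "w \<in> Sn n"
  then show "\<exists>v\<in>Sn n. \<exists>e. pibar i (bvec n w) - sc e (bvec n v) \<in> (coinv_ideal n :: 'a mpoly set)
      \<and> lmult i (hvec n w) - sc e (hvec n v) \<in> (hideal n :: 'a ncpoly set)"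
    using common_table[of i n w] by blast
qed (simp_all add: lin_pibar lin_lmult pibar_coinv lmult_hideal)

text \<open>Compositions of \<open>n\<close> correspond to subsets of \<open>{1..<n}\<close>, so the
  descent classes attached to them partition \<open>Sn n\<close>.\<close>

lemma sum_over_comps:
  assumes "1 \<le> n"
  shows "(\<Sum>\<alpha>\<in>comps n. \<Sum>w\<in>dclass n (Dc \<alpha>). h (Dc \<alpha>) w) = (\<Sum>w\<in>Sn n. h (desc n w) w :: 'b::comm_monoid_add)"
proof -
  have "(\<Sum>\<alpha>\<in>comps n. \<Sum>w\<in>dclass n (Dc \<alpha>). h (Dc \<alpha>) w) = (\<Sum>I\<in>Pow {1..<n}. \<Sum>w\<in>dclass n I. h I w)"
    by (rule sum.reindex_bij_betw[OF bij_betw_Dc[OF assms]])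
  also have "\<dots> = (\<Sum>I\<in>Pow {1..<n}. \<Sum>w\<in>dclass n I. h (desc n w) w)"
    by (intro sum.cong) auto
  also have "\<dots> = (\<Sum>w\<in>Sn n. h (desc n w) w)"
    using desc_subset by (intro sum.group) auto
  finally show ?thesis .
qed

lemma Msum_polys: "\<alpha> \<in> comps n \<Longrightarrow> Msum n \<alpha> \<subseteq> polys n"
  unfolding Msum_eq by (intro pm.span_minimal subspace_polys) (auto intro: bvec_polys)

lemma decomposition_sum:
  fixes f :: "'a::field mpoly"
  assumes n: "1 \<le> n" and f: "f \<in> polys n"
  shows "\<exists>m. (\<forall>\<alpha>\<in>comps n. m \<alpha> \<in> Msum n \<alpha>) \<and> f - (\<Sum>\<alpha>\<in>comps n. m \<alpha>) \<in> coinv_ideal n"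
proof -
  obtain c where c: "f - (\<Sum>w\<in>Sn n. sc (c w) (bvec n w)) \<in> coinv_ideal n"
    using coinv_spanning[OF f] .
  let ?m = "\<lambda>\<alpha>. \<Sum>w\<in>dclass n (Dc \<alpha>). sc (c w) (bvec n w) :: 'a mpoly"
  have "?m \<alpha> \<in> Msum n \<alpha>" if "\<alpha> \<in> comps n" for \<alpha>
    unfolding Msum_eq[OF that] by (intro pm.span_sum pm.span_scale pm.span_base imageI)
  moreover have "(\<Sum>\<alpha>\<in>comps n. ?m \<alpha>) = (\<Sum>w\<in>Sn n. sc (c w) (bvec n w))"
    by (rule sum_over_comps[OF n])
  ultimately show ?thesis using c by (intro exI[of _ ?m]) simp
qed

lemma decomposition_direct:
  fixes m :: "nat list \<Rightarrow> 'a::field mpoly"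
  assumes n: "1 \<le> n" and m: "\<And>\<alpha>. \<alpha> \<in> comps n \<Longrightarrow> m \<alpha> \<in> Msum n \<alpha>"
    and sum: "(\<Sum>\<alpha>\<in>comps n. m \<alpha>) \<in> coinv_ideal n" and \<alpha>: "\<alpha> \<in> comps n"
  shows "m \<alpha> \<in> coinv_ideal n"
proof -
  have "\<exists>c. m \<beta> = (\<Sum>w\<in>dclass n (Dc \<beta>). sc (c w) (bvec n w))" if "\<beta> \<in> comps n" for \<beta>
  proof -
    have fin: "finite (dclass n (Dc \<beta>))" by simp
    show ?thesis using span_image_finite[OF m[OF that, unfolded Msum_eq[OF that]] fin] by blast
  qed
  then have "\<forall>\<beta>\<in>comps n. \<exists>c. m \<beta> = (\<Sum>w\<in>dclass n (Dc \<beta>). sc (c w) (bvec n w))"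
    by blast
  from bchoice[OF this] obtain c
    where c: "\<And>\<beta>. \<beta> \<in> comps n \<Longrightarrow> m \<beta> = (\<Sum>w\<in>dclass n (Dc \<beta>). sc (c \<beta> w) (bvec n w))"
    by blast
  \<comment> \<open>The coefficients were chosen for each composition separately; indexing them by
    descent sets turns the sum of all \<open>m \<alpha>\<close> into one combination over
    \<open>Sn n\<close>.\<close>
  define d where "d I = c (inv_into (comps n) Dc I)" for I
  have d: "d (Dc \<beta>) = c \<beta>" if "\<beta> \<in> comps n" for \<beta>
    unfolding d_def using bij_betw_inv_into_left[OF bij_betw_Dc[OF n] that] by simp
  have "(\<Sum>\<alpha>\<in>comps n. m \<alpha>) = (\<Sum>\<alpha>\<in>comps n. \<Sum>w\<in>dclass n (Dc \<alpha>). sc (d (Dc \<alpha>) w) (bvec n w))"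
    by (intro sum.cong refl) (simp only: c d)
  also have "\<dots> = (\<Sum>w\<in>Sn n. sc (d (desc n w) w) (bvec n w))"
    by (rule sum_over_comps[OF n])
  finally have "(\<Sum>w\<in>Sn n. sc (d (desc n w) w) (bvec n w)) \<in> (coinv_ideal n :: 'a mpoly set)"
    using sum by simp
  then have "d (desc n w) w = 0" if "w \<in> Sn n" for w
    using that by (rule coinv_independent)
  then have "d (Dc \<alpha>) w = 0" if "w \<in> Sn n" "desc n w = Dc \<alpha>" for w
    using that(1) unfolding that(2)[symmetric] by blast
  then have "m \<alpha> = 0"
    unfolding c[OF \<alpha>] d[OF \<alpha>, symmetric] by (intro sum.neutral) auto
  then show ?thesis by (simp add: coinv_ideal.zero)
qed

lemma qbasis_cong: "(\<And>x. x \<in> B \<Longrightarrow> b x = b' x) \<Longrightarrow> qbasis A K B b \<longleftrightarrow> qbasis A K B b'"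
  unfolding qbasis_def by (simp cong: sum.cong)

theorem theorem4p5:
  fixes n :: nat
  assumes "n \<ge> 1"
  shows
    \<comment> \<open>basis of the coinvariant algebra\<close>
    "qbasis (polys n :: ('a::field) mpoly set) (coinv_ideal n) (Sn n)
        (\<lambda>w. pibar_w n w (xI (desc n w)))
   \<and> \<comment> \<open>the summands are submodules and the decomposition is a direct sum\<close>
     (\<forall>\<alpha>\<in>comps n. Msum n \<alpha> \<subseteq> (polys n :: 'a mpoly set))
   \<and> (\<forall>f\<in>(polys n :: 'a mpoly set). \<exists>m. (\<forall>\<alpha>\<in>comps n. m \<alpha> \<in> Msum n \<alpha>)
          \<and> f - (\<Sum>\<alpha>\<in>comps n. m \<alpha>) \<in> coinv_ideal n)
   \<and> (\<forall>m :: nat list \<Rightarrow> 'a mpoly. (\<forall>\<alpha>\<in>comps n. m \<alpha> \<in> Msum n \<alpha>)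
          \<and> (\<Sum>\<alpha>\<in>comps n. m \<alpha>) \<in> coinv_ideal n \<longrightarrow> (\<forall>\<alpha>\<in>comps n. m \<alpha> \<in> coinv_ideal n))
   \<and> \<comment> \<open>basis of each summand\<close>
     (\<forall>\<alpha>\<in>comps n. qbasis (Msum n \<alpha> :: 'a mpoly set) (coinv_ideal n)
          {w \<in> Sn n. desc n w = Dc \<alpha>} (\<lambda>w. pibar_w n w (xI (Dc \<alpha>))))
   \<and> \<comment> \<open>each summand is isomorphic to P_alpha\<close>
     (\<forall>\<alpha>\<in>comps n. qmod_iso {1..<n} (Msum n \<alpha> :: 'a mpoly set) (coinv_ideal n) pibar
          (Pmod n \<alpha> :: 'a ncpoly set) (hideal n) lmult)
   \<and> \<comment> \<open>isomorphic to the regular representation of H_n(0)\<close>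
     qmod_iso {1..<n} (polys n :: 'a mpoly set) (coinv_ideal n) pibar
          (frees n :: 'a ncpoly set) (hideal n) lmult"
proof (intro conjI ballI allI impI subsetI)
  show "qbasis (polys n :: 'a mpoly set) (coinv_ideal n) (Sn n) (\<lambda>w. pibar_w n w (xI (desc n w)))"
    using qbasis_polys unfolding bvec_def[abs_def] .
next
  fix \<alpha> x assume "\<alpha> \<in> comps n" "x \<in> (Msum n \<alpha> :: 'a mpoly set)"
  then show "x \<in> polys n" using Msum_polys by blast
next
  fix f :: "'a mpoly" assume "f \<in> polys n"
  with assms show "\<exists>m. (\<forall>\<alpha>\<in>comps n. m \<alpha> \<in> Msum n \<alpha>) \<and> f - (\<Sum>\<alpha>\<in>comps n. m \<alpha>) \<in> coinv_ideal n"
    by (rule decomposition_sum)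
next
  fix m :: "nat list \<Rightarrow> 'a mpoly" and \<alpha>
  assume "(\<forall>\<alpha>\<in>comps n. m \<alpha> \<in> Msum n \<alpha>) \<and> (\<Sum>\<alpha>\<in>comps n. m \<alpha>) \<in> coinv_ideal n" "\<alpha> \<in> comps n"
  then show "m \<alpha> \<in> coinv_ideal n"
    using decomposition_direct[OF assms, of m \<alpha>] by blast
next
  fix \<alpha> assume "\<alpha> \<in> comps n"
  from qbasis_Msum[OF this] show "qbasis (Msum n \<alpha> :: 'a mpoly set) (coinv_ideal n)
      {w \<in> Sn n. desc n w = Dc \<alpha>} (\<lambda>w. pibar_w n w (xI (Dc \<alpha>)))"
    by (rule qbasis_cong[THEN iffD1, rotated]) (simp add: bvec_def)
next
  fix \<alpha> assume "\<alpha> \<in> comps n"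
  then show "qmod_iso {1..<n} (Msum n \<alpha> :: 'a mpoly set) (coinv_ideal n) pibar (Pmod n \<alpha> :: 'a ncpoly set) (hideal n) lmult"
    by (rule qmod_iso_summand)
qed (rule qmod_iso_regular)

end
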